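(* The following unbounded linear operators are hypermixing. (i) The derivative operator $T=D$ in the Hardy Hilbert space $H^2$ of the open unit disk $\mathbb D$, defined by $Tf=f'$ on $D(T)=\{f\in H^2: f'\in H^2\}$, is hypermixing with respect to its maximal dynamical domain $Y_0=\bigcap_{n=1}^\infty D(T^n)=\{f\in H^2: f^{(n)}\in H^2 \text{ for all } n\ge 1\}$. (ii) Let $\Omega$ be a nonempty bounded open subset of $\mathbb R^2$. The Laplacian operator $\Delta f=f_{xx}+f_{yy}$ in $L^2(\Omega)$ is hypermixing with respect to the dynamical domain $Y=\{f\in L^2(\Omega): f \text{ is a polynomial}\}$ (complex polynomials in $x,y$); that is, the pair $(\Delta,Y)$ is hypermixing. (iii) For all $1\le p<\infty$, $w>1$ and $a>0$, the weighted left translation $T=T_{w,a}$ in $L_p(0,\infty)$ defined by $(Tf)(t)=w^t f(t+a)$ ($t>0$) is hypermixing with respect to its maximal dynamical domain $Y_0=\bigcap_{n=1}^\infty D(T^n)$, where $$D(T^n)=\Big\{f\in L_p(0,\infty): \int_0^\infty \big|w^{nt+\frac{(n-1)na}{2}}f(t+na)\big|^p\,dt<\infty\Big\}\quad(n\ge 1).$$ (iv) For all $w>1$ and $a>0$, the weighted left translation $T=T_{w,a}$ in $C_0[0,\infty)$ defined by $(Tf)(t)=w^t f(t+a)$ ($t\ge 0$) is hypermixing with respect to its maximal dynamical domain $Y_0=\bigcap_{n=1}^\infty D(T^n)$, where $$D(T^n)=\Big\{f\in C_0[0,\infty): \lim_{t\to\infty} w^{nt+\frac{(n-1)na}{2}}f(t+na)=0\Big\}\quad(n\ge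 1).$$
   Context: Let $\mathcal X$ be a separable infinite-dimensional (real or complex) Banach space and $T: D(T)\subseteq\mathcal X\to\mathcal X$ a linear operator defined on a linear subspace $D(T)$ (not necessarily bounded). Powers are defined on their natural domains: $D(T^{n+1})=\{x\in D(T^n): T^nx\in D(T)\}$, and $T^0=I$. Put $Y_0=\bigcap_{n=1}^\infty D(T^n)$, called the maximal dynamical domain of $T$. A dynamical domain of $T$ is a linear (not necessarily closed) subspace $Y\subseteq Y_0$, endowed with the relative norm topology of $\mathcal X$. The pair $(T,Y)$ is called hypermixing if, for every nonempty (relatively) open subset $U$ of $Y$, $Y\setminus\{0\}\subseteq\bigcup_{i=0}^\infty\bigcap_{n=i}^\infty T^n(U)$. One also says that $T$ is hypermixing with respect to $Y$. $L^2(\Omega)$ is the complex Hilbert space of $f:\Omega\to\mathbb C$ with $\|f\|^2=\iint_\Omega|f(x,y)|^2\,dx\,dy<\infty$. $L_p(0,\infty)$ is taken with Lebesgue measure and its usual norm. $C_0[0,\infty)$ is the space of continuous functions on $[0,\infty)$ vanishing at infinity, with the supremum norm. In (ii), the domain of $\Delta$ contains all polynomials, on which $\Delta$ acts by $f_{xx}+f_{yy}$. *)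

theory Defs
  imports "HOL-Analysis.Analysis"
begin

text \<open>
  Normed spaces carry an explicit carrier set because the spaces below depend on parameters
  (an exponent, a domain of integration).  The records are used only for concrete Banach spaces,
  so the vector space and norm laws are not repeated as axioms here.
\<close>

record ('k, 'v) normed_sp =
  carr :: "'v set"
  vzero :: 'v
  vadd :: "'v \<Rightarrow> 'v \<Rightarrow> 'v"
  vscale :: "'k \<Rightarrow> 'v \<Rightarrow> 'v"
  vnorm :: "'v \<Rightarrow> real"

text \<open>The values of \<open>op_app\<close> outside \<open>op_dom\<close> are irrelevant.\<close>

record 'v partial_op =
  op_dom :: "'v set"
  op_app :: "'v \<Rightarrow> 'v"

text \<open>
  Off the carrier the distance is set to 0, since \<^locale>\<open>Metric_space\<close> demands symmetry and
  nonnegativity of the distance on the whole type.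
\<close>

definition vdist :: "('k::ring_1, 'v) normed_sp \<Rightarrow> 'v \<Rightarrow> 'v \<Rightarrow> real" where
  "vdist X x y =
     (if x \<in> carr X \<and> y \<in> carr X then vnorm X (vadd X x (vscale X (-1) y)) else 0)"

definition norm_topology :: "('k::ring_1, 'v) normed_sp \<Rightarrow> 'v topology" where
  "norm_topology X = Metric_space.mtopology (carr X) (vdist X)"

definition linear_subspace :: "('k, 'v) normed_sp \<Rightarrow> 'v set \<Rightarrow> bool" where
  "linear_subspace X Y \<longleftrightarrow>
     Y \<subseteq> carr X \<and> vzero X \<in> Y \<and>
     (\<forall>x\<in>Y. \<forall>y\<in>Y. vadd X x y \<in> Y) \<and> (\<forall>c. \<forall>x\<in>Y. vscale X c x \<in> Y)"

definition linear_operator :: "('k, 'v) normed_sp \<Rightarrow> 'v partial_op \<Rightarrow> bool" where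
  "linear_operator X T \<longleftrightarrow>
     linear_subspace X (op_dom T) \<and>
     (\<forall>x\<in>op_dom T. op_app T x \<in> carr X) \<and>
     (\<forall>x\<in>op_dom T. \<forall>y\<in>op_dom T. op_app T (vadd X x y) = vadd X (op_app T x) (op_app T y)) \<and>
     (\<forall>c. \<forall>x\<in>op_dom T. op_app T (vscale X c x) = vscale X c (op_app T x))"

definition unbounded_operator :: "('k, 'v) normed_sp \<Rightarrow> 'v partial_op \<Rightarrow> bool" where
  "unbounded_operator X T \<longleftrightarrow>
     \<not> (\<exists>C. \<forall>x\<in>op_dom T. vnorm X (op_app T x) \<le> C * vnorm X x)"

primrec power_dom :: "('k, 'v) normed_sp \<Rightarrow> 'v partial_op \<Rightarrow> nat \<Rightarrow> 'v set" where
  "power_dom X T 0 = carr X"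
| "power_dom X T (Suc n) = {x \<in> power_dom X T n. (op_app T ^^ n) x \<in> op_dom T}"

definition maximal_dynamical_domain :: "('k, 'v) normed_sp \<Rightarrow> 'v partial_op \<Rightarrow> 'v set" where
  "maximal_dynamical_domain X T = (\<Inter>n\<in>{1..}. power_dom X T n)"

definition dynamical_domain :: "('k, 'v) normed_sp \<Rightarrow> 'v partial_op \<Rightarrow> 'v set \<Rightarrow> bool" where
  "dynamical_domain X T Y \<longleftrightarrow>
     linear_subspace X Y \<and> Y \<subseteq> maximal_dynamical_domain X T"

definition hypermixing :: "('k::ring_1, 'v) normed_sp \<Rightarrow> 'v partial_op \<Rightarrow> 'v set \<Rightarrow> bool" where
  "hypermixing X T Y \<longleftrightarrow>
     linear_operator X T \<and> dynamical_domain X T Y \<and>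
     (\<forall>U. openin (subtopology (norm_topology X) Y) U \<and> U \<noteq> {} \<longrightarrow>
        Y - {vzero X} \<subseteq> (\<Union>i. \<Inter>n\<in>{i..}. (op_app T ^^ n) ` U))"

text \<open>
  Functions on the disk (and later on \<open>[0,\<infinity>)\<close>) are elements of \<^const>\<open>extensional\<close>, so that
  HOL equality is equality of functions on the domain.
\<close>

definition circle_mean :: "(complex \<Rightarrow> complex) \<Rightarrow> real \<Rightarrow> real" where
  "circle_mean f r = integral {0..2*pi} (\<lambda>\<theta>. (norm (f (rcis r \<theta>)))\<^sup>2) / (2*pi)"

definition H2 :: "(complex, complex \<Rightarrow> complex) normed_sp" where
  "H2 = \<lparr>
     carr = {f \<in> extensional (ball 0 1).
               f holomorphic_on ball 0 1 \<and> bdd_above (circle_mean f ` {0..<1})},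
     vzero = (\<lambda>z\<in>ball 0 1. 0),
     vadd = (\<lambda>f g. \<lambda>z\<in>ball 0 1. f z + g z),
     vscale = (\<lambda>c f. \<lambda>z\<in>ball 0 1. c * f z),
     vnorm = (\<lambda>f. sqrt (SUP r\<in>{0..<1}. circle_mean f r)) \<rparr>"

definition H2_derivative :: "(complex \<Rightarrow> complex) partial_op" where
  "H2_derivative = \<lparr>
     op_dom = {f \<in> carr H2. (\<lambda>z\<in>ball 0 1. deriv f z) \<in> carr H2},
     op_app = (\<lambda>f. \<lambda>z\<in>ball 0 1. deriv f z) \<rparr>"

text \<open>
  Vectors are the classes of measurable functions modulo equality almost everywhere.  The scalar
  type \<open>'k\<close> stands for the reals or the complex numbers, which both have the sort
  \<open>{real_normed_field, euclidean_space}\<close>.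
\<close>

definition ae_class :: "'a measure \<Rightarrow> ('a \<Rightarrow> 'k::euclidean_space) \<Rightarrow> ('a \<Rightarrow> 'k) set" where
  "ae_class M f = {g \<in> borel_measurable M. AE x in M. g x = f x}"

definition rep :: "('a \<Rightarrow> 'k) set \<Rightarrow> 'a \<Rightarrow> 'k" where
  "rep F = (SOME f. f \<in> F)"

definition Lp_space ::
    "real \<Rightarrow> 'a measure \<Rightarrow> ('k::{real_normed_field,euclidean_space}, ('a \<Rightarrow> 'k) set) normed_sp" where
  "Lp_space p M = \<lparr>
     carr = {ae_class M f | f.
               f \<in> borel_measurable M \<and> integrable M (\<lambda>x. norm (f x) powr p)},
     vzero = ae_class M (\<lambda>x. 0),
     vadd = (\<lambda>F G. ae_class M (\<lambda>x. rep F x + rep G x)),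
     vscale = (\<lambda>c F. ae_class M (\<lambda>x. c * rep F x)),
     vnorm = (\<lambda>F. (\<integral>x. norm (rep F x) powr p \<partial>M) powr (1/p)) \<rparr>"

definition Lp_translation ::
    "real \<Rightarrow> real \<Rightarrow> real \<Rightarrow> (real \<Rightarrow> 'k::{real_normed_field,euclidean_space}) set partial_op" where
  "Lp_translation p w a = \<lparr>
     op_dom = {F \<in> carr (Lp_space p (lebesgue_on {0<..})).
                 integrable (lebesgue_on {0<..})
                   (\<lambda>t. norm ((w powr t) *\<^sub>R rep F (t + a)) powr p)},
     op_app = (\<lambda>F. ae_class (lebesgue_on {0<..}) (\<lambda>t. (w powr t) *\<^sub>R rep F (t + a))) \<rparr>"

definition bivariate_polynomial :: "(real \<times> real \<Rightarrow> complex) \<Rightarrow> bool" where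
  "bivariate_polynomial q \<longleftrightarrow>
     (\<exists>N c. q = (\<lambda>(x, y). \<Sum>i\<le>N. \<Sum>j\<le>N. c i j * of_real x ^ i * of_real y ^ j))"

definition partial_x :: "(real \<times> real \<Rightarrow> complex) \<Rightarrow> real \<times> real \<Rightarrow> complex" where
  "partial_x f = (\<lambda>(x, y). vector_derivative (\<lambda>s. f (s, y)) (at x))"

definition partial_y :: "(real \<times> real \<Rightarrow> complex) \<Rightarrow> real \<times> real \<Rightarrow> complex" where
  "partial_y f = (\<lambda>(x, y). vector_derivative (\<lambda>s. f (x, s)) (at y))"

definition laplacian :: "(real \<times> real \<Rightarrow> complex) \<Rightarrow> real \<times> real \<Rightarrow> complex" where
  "laplacian f = (\<lambda>v. partial_x (partial_x f) v + partial_y (partial_y f) v)"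

definition L2_polynomials :: "(real \<times> real) set \<Rightarrow> (real \<times> real \<Rightarrow> complex) set set" where
  "L2_polynomials \<Omega> =
     {F \<in> carr (Lp_space 2 (lebesgue_on \<Omega>)).
        \<exists>q. bivariate_polynomial q \<and> F = ae_class (lebesgue_on \<Omega>) q}"

text \<open>
  The domain of the Laplacian is not fixed: the predicate describes every linear operator in
  \<open>L\<^sup>2(\<Omega>)\<close> that is defined at least on the polynomials and acts on them as \<open>f\<^sub>x\<^sub>x + f\<^sub>y\<^sub>y\<close>.
\<close>

definition is_L2_Laplacian ::
    "(real \<times> real) set \<Rightarrow> (real \<times> real \<Rightarrow> complex) set partial_op \<Rightarrow> bool" where
  "is_L2_Laplacian \<Omega> T \<longleftrightarrow>
     linear_operator (Lp_space 2 (lebesgue_on \<Omega>)) T \<and>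
     L2_polynomials \<Omega> \<subseteq> op_dom T \<and>
     (\<forall>q. bivariate_polynomial q \<longrightarrow>
        op_app T (ae_class (lebesgue_on \<Omega>) q) = ae_class (lebesgue_on \<Omega>) (laplacian q))"

definition C0_space :: "('k::{real_normed_field,euclidean_space}, real \<Rightarrow> 'k) normed_sp" where
  "C0_space = \<lparr>
     carr = {f \<in> extensional {0..}. continuous_on {0..} f \<and> (f \<longlongrightarrow> 0) at_top},
     vzero = (\<lambda>t\<in>{0..}. 0),
     vadd = (\<lambda>f g. \<lambda>t\<in>{0..}. f t + g t),
     vscale = (\<lambda>c f. \<lambda>t\<in>{0..}. c * f t),
     vnorm = (\<lambda>f. SUP t\<in>{0..}. norm (f t)) \<rparr>"

definition C0_translation ::
    "real \<Rightarrow> real \<Rightarrow> (real \<Rightarrow> 'k::{real_normed_field,euclidean_space}) partial_op" where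
  "C0_translation w a = \<lparr>
     op_dom = {f \<in> carr C0_space. ((\<lambda>t. (w powr t) *\<^sub>R f (t + a)) \<longlongrightarrow> 0) at_top},
     op_app = (\<lambda>f. \<lambda>t\<in>{0..}. (w powr t) *\<^sub>R f (t + a)) \<rparr>"

end

theory Submission
  imports Defs "HOL-Complex_Analysis.Complex_Analysis" "HOL-Real_Asymp.Real_Asymp"
begin

text \<open>
  All four operators satisfy the same criterion. Vectors annihilated by some power of \<open>T\<close> are dense
  in \<open>Y\<close>, and every \<open>x \<in> Y\<close> has a backward orbit \<open>u 0 = x\<close>, \<open>T (u (n+1)) = u n\<close> in \<open>Y\<close> whose
  norms decay faster than every geometric sequence. The backward orbits are iterated integration of
  the Taylor series on the disk; iteration of \<open>z\<^sup>i w\<^sup>j \<mapsto> z\<^bsup>i+1\<^esup> w\<^bsup>j+1\<^esup> / (4 (i+1) (j+1))\<close> on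
  polynomials in \<open>z = x + \<i>y\<close> and its conjugate \<open>w\<close>; and weighted right translations on the half line.
\<close>

section \<open>A criterion for hypermixing\<close>

text \<open>Hypermixing asks that \<open>x\<close> itself, not an approximation of it, lie in
  \<open>T^n(U)\<close> for all large \<open>n\<close>. Density of kernels alone cannot give that;
  an exact backward orbit is needed, one for each \<open>x\<close>, with no linearity or continuity
  in \<open>x\<close>. Its decay comes from accumulated factors: \<open>n\<close> integrations
  divide by roughly \<open>n!\<close>, and the weights of \<open>n\<close> right translations
  multiply to about \<open>w\<close> to the power \<open>- n^2 a / 2\<close>. Both beat every
  geometric sequence. Mixing uses only that the orbit tends to 0; the stronger decay yields
  unboundedness from the same orbit. The delicate point is that the orbit must stay in
  \<open>Y\<close>. For a maximal dynamical domain this is automatic once each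
  \<open>u (n+1)\<close> lies in the domain of \<open>T\<close>. On the disk, membership of
  \<open>f''\<close> in the Hardy space makes the Taylor coefficients of \<open>f\<close> absolutely
  summable, so all later estimates there are sums of moduli of coefficients. Vectors are restricted
  functions or classes on a carrier set, so the vector space and norm laws do not come from a type
  class; the locale collects them and each space is shown to satisfy them.\<close>

locale normed_sp_laws =
  fixes X :: "('k::ring_1, 'v) normed_sp"
  assumes zero_mem: "vzero X \<in> carr X"
    and add_mem: "x \<in> carr X \<Longrightarrow> y \<in> carr X \<Longrightarrow> vadd X x y \<in> carr X"
    and scale_mem: "x \<in> carr X \<Longrightarrow> vscale X c x \<in> carr X"
    and add_assoc: "x \<in> carr X \<Longrightarrow> y \<in> carr X \<Longrightarrow> z \<in> carr X \<Longrightarrow>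
           vadd X (vadd X x y) z = vadd X x (vadd X y z)"
    and add_commute: "x \<in> carr X \<Longrightarrow> y \<in> carr X \<Longrightarrow> vadd X x y = vadd X y x"
    and zero_add: "x \<in> carr X \<Longrightarrow> vadd X (vzero X) x = x"
    and scale_zero: "x \<in> carr X \<Longrightarrow> vscale X 0 x = vzero X"
    and scale_one: "x \<in> carr X \<Longrightarrow> vscale X 1 x = x"
    and scale_scale: "x \<in> carr X \<Longrightarrow> vscale X c (vscale X d x) = vscale X (c * d) x"
    and scale_add_left: "x \<in> carr X \<Longrightarrow>
           vscale X (c + d) x = vadd X (vscale X c x) (vscale X d x)"
    and scale_add_right: "x \<in> carr X \<Longrightarrow> y \<in> carr X \<Longrightarrow>
           vscale X c (vadd X x y) = vadd X (vscale X c x) (vscale X c y)"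
    and norm_zero_imp: "x \<in> carr X \<Longrightarrow> vnorm X x = 0 \<Longrightarrow> x = vzero X"
    and norm_zero: "vnorm X (vzero X) = 0"
    and norm_nonneg: "x \<in> carr X \<Longrightarrow> 0 \<le> vnorm X x"
    and norm_minus: "x \<in> carr X \<Longrightarrow> vnorm X (vscale X (-1) x) = vnorm X x"
    and norm_triangle: "x \<in> carr X \<Longrightarrow> y \<in> carr X \<Longrightarrow>
           vnorm X (vadd X x y) \<le> vnorm X x + vnorm X y"
begin

section \<open>The metric induced by a norm on a carrier set\<close>

lemma add_minus:
  assumes "x \<in> carr X"
  shows "vadd X x (vscale X (-1) x) = vzero X"
  using scale_add_left[OF assms, of 1 "-1"] assms by (simp add: scale_zero scale_one)

lemma minus_minus: "x \<in> carr X \<Longrightarrow> vscale X (-1) (vscale X (-1) x) = x"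
  by (simp add: scale_scale scale_one)

lemma add_minus_cancel:
  assumes "x \<in> carr X" "y \<in> carr X"
  shows "vadd X (vadd X y x) (vscale X (-1) x) = y"
  using assms by (metis add_assoc add_commute add_minus scale_mem zero_add zero_mem)

lemma vdist_eq: "x \<in> carr X \<Longrightarrow> y \<in> carr X \<Longrightarrow>
    vdist X x y = vnorm X (vadd X x (vscale X (-1) y))"
  by (simp add: vdist_def)

lemma eq_if_diff_zero:
  assumes "x \<in> carr X" "y \<in> carr X" "vadd X x (vscale X (-1) y) = vzero X"
  shows "x = y"
proof -
  have "vadd X (vadd X x (vscale X (-1) y)) (vscale X (-1) (vscale X (-1) y)) = x"
    using assms by (intro add_minus_cancel scale_mem)
  then show ?thesis using assms by (simp add: minus_minus zero_add)
qed

lemma vdist_commute: "vdist X x y = vdist X y x"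
proof (cases "x \<in> carr X \<and> y \<in> carr X")
  case True
  have "vscale X (-1) (vadd X x (vscale X (-1) y)) = vadd X y (vscale X (-1) x)"
    using True by (simp add: scale_add_right scale_mem minus_minus add_commute)
  then show ?thesis
    using True norm_minus[of "vadd X x (vscale X (-1) y)"] by (simp add: vdist_eq add_mem scale_mem)
qed (auto simp: vdist_def)

lemma vdist_triangle:
  assumes "x \<in> carr X" "y \<in> carr X" "z \<in> carr X"
  shows "vdist X x z \<le> vdist X x y + vdist X y z"
proof -
  define y' z' where "y' = vscale X (-1) y" and "z' = vscale X (-1) z"
  have m: "y' \<in> carr X" "z' \<in> carr X" using assms by (auto simp: y'_def z'_def scale_mem)
  have "vadd X y' (vadd X y z') = z'"
    using assms m by (metis y'_def add_assoc add_commute add_minus zero_add)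
  then have "vadd X (vadd X x y') (vadd X y z') = vadd X x z'"
    using assms m by (simp add: add_assoc add_mem)
  then show ?thesis
    using norm_triangle[of "vadd X x y'" "vadd X y z'"] assms m
    by (simp add: vdist_eq add_mem flip: y'_def z'_def)
qed

lemma Metric_space: "Metric_space (carr X) (vdist X)"
proof
  fix x y
  show "0 \<le> vdist X x y" by (simp add: vdist_def norm_nonneg add_mem scale_mem)
  show "vdist X x y = vdist X y x" by (rule vdist_commute)
next
  fix x y assume "x \<in> carr X" "y \<in> carr X"
  then show "vdist X x y = 0 \<longleftrightarrow> x = y"
    by (metis vdist_eq add_mem scale_mem add_minus norm_zero norm_zero_imp eq_if_diff_zero)
qed (rule vdist_triangle)

text \<open>In the criterion this measures how far adding a small term of a backward orbit moves a
  point of the open set.\<close>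

lemma vdist_add:
  assumes "x \<in> carr X" "y \<in> carr X"
  shows "vdist X x (vadd X x y) = vnorm X y"
  using assms by (metis vdist_commute vdist_eq add_mem add_commute add_minus_cancel)

section \<open>Iterates of a partial operator and its dynamical domains\<close>

context
  fixes T
  assumes T: "linear_operator X T"
begin

lemma op_dom_subset: "op_dom T \<subseteq> carr X"
  using T by (simp add: linear_operator_def linear_subspace_def)

lemma op_app_zero: "op_app T (vzero X) = vzero X"
proof -
  have "vzero X \<in> op_dom T" "op_app T (vzero X) \<in> carr X"
    using T by (auto simp: linear_operator_def linear_subspace_def)
  moreover have "op_app T (vscale X 0 (vzero X)) = vscale X 0 (op_app T (vzero X))"
    using T calculation by (simp add: linear_operator_def)
  ultimately show ?thesis by (simp add: scale_zero zero_mem)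
qed

lemma funpow_zero: "(op_app T ^^ n) (vzero X) = vzero X"
  by (induction n) (auto simp: op_app_zero)

text \<open>The four claims are proved together: that the domain of the next power is a subspace
  rests on additivity and homogeneity of the present one.\<close>

lemma linear_on_power_dom:
  "linear_subspace X (power_dom X T n) \<and>
   (\<forall>x\<in>power_dom X T n. (op_app T ^^ n) x \<in> carr X) \<and>
   (\<forall>x\<in>power_dom X T n. \<forall>y\<in>power_dom X T n.
      (op_app T ^^ n) (vadd X x y) = vadd X ((op_app T ^^ n) x) ((op_app T ^^ n) y)) \<and>
   (\<forall>c. \<forall>x\<in>power_dom X T n. (op_app T ^^ n) (vscale X c x) = vscale X c ((op_app T ^^ n) x))"
proof (induction n)
  case 0
  then show ?case by (auto simp: linear_subspace_def zero_mem add_mem scale_mem)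
next
  case (Suc n)
  then show ?case
    using T by (simp add: linear_subspace_def linear_operator_def funpow_zero Ball_def subset_iff)
qed

lemma linear_subspace_maximal: "linear_subspace X (maximal_dynamical_domain X T)"
  using linear_on_power_dom unfolding linear_subspace_def maximal_dynamical_domain_def
  by (fastforce simp: subset_iff)

lemma dynamical_domain_maximal: "dynamical_domain X T (maximal_dynamical_domain X T)"
  by (simp add: dynamical_domain_def linear_subspace_maximal)

text \<open>Unrolling the recursion, \<open>x\<close> lies in the domain of the \<open>n\<close>-th
  power iff its first \<open>n\<close> iterates, starting with \<open>x\<close>, stay in
  \<open>op_dom T\<close>; intersecting over \<open>n\<close> removes the bound.\<close>

lemma maximal_dynamical_domain_iff:
  "x \<in> maximal_dynamical_domain X T \<longleftrightarrow> x \<in> carr X \<and> (\<forall>n. (op_app T ^^ n) x \<in> op_dom T)"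
proof -
  have "x \<in> power_dom X T n \<longleftrightarrow> x \<in> carr X \<and> (\<forall>k<n. (op_app T ^^ k) x \<in> op_dom T)" for n
    by (induction n) (auto simp: less_Suc_eq)
  moreover have "(\<forall>n\<ge>1. \<forall>k<n. P k) \<longleftrightarrow> (\<forall>k. P k)" for P :: "nat \<Rightarrow> bool"
    by (metis One_nat_def less_Suc_eq_0_disj le_add1 lessI plus_1_eq_Suc)
  ultimately show ?thesis unfolding maximal_dynamical_domain_def by fastforce
qed

text \<open>All iterates of \<open>x\<close> after the start are iterates of
  \<open>op_app T x\<close>. Hence a backward orbit that begins in the maximal domain never leaves
  it, and only membership in \<open>op_dom T\<close> has to be checked.\<close>

lemma maximal_dynamical_domain_preimage:
  assumes "x \<in> op_dom T" "op_app T x \<in> maximal_dynamical_domain X T"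
  shows "x \<in> maximal_dynamical_domain X T"
  unfolding maximal_dynamical_domain_iff
proof (intro conjI allI)
  show "x \<in> carr X" using assms op_dom_subset by blast
  fix n show "(op_app T ^^ n) x \<in> op_dom T"
    using assms by (cases n) (auto simp: maximal_dynamical_domain_iff funpow_Suc_right simp del: funpow.simps)
qed

lemma backward_orbit_in_maximal_dynamical_domain:
  assumes "u 0 \<in> maximal_dynamical_domain X T"
    and "\<And>n. u (Suc n) \<in> op_dom T" "\<And>n. op_app T (u (Suc n)) = u n"
  shows "u n \<in> maximal_dynamical_domain X T"
  by (induction n) (use assms maximal_dynamical_domain_preimage in auto)

text \<open>Serves the polynomials, which the Laplacian maps to polynomials: an invariant subspace
  of \<open>op_dom T\<close> contains every iterate of its elements.\<close>

lemma dynamical_domain_invariant: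
  assumes "linear_subspace X Y" "Y \<subseteq> op_dom T" "op_app T ` Y \<subseteq> Y"
  shows "dynamical_domain X T Y"
proof -
  have "(op_app T ^^ n) x \<in> Y" if "x \<in> Y" for n x
    using that assms(3) by (induction n) auto
  then show ?thesis
    using assms op_dom_subset
    by (auto simp: dynamical_domain_def maximal_dynamical_domain_iff subset_iff)
qed

lemma dynamical_domain_iterates:
  assumes "dynamical_domain X T Y" "x \<in> Y"
  shows "(op_app T ^^ n) x \<in> op_dom T"
  using assms by (auto simp: dynamical_domain_def maximal_dynamical_domain_iff subset_iff)

lemma iterate_add:
  assumes "dynamical_domain X T Y" "x \<in> Y" "y \<in> Y"
  shows "(op_app T ^^ n) (vadd X x y) = vadd X ((op_app T ^^ n) x) ((op_app T ^^ n) y)"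
proof -
  have "x \<in> power_dom X T (Suc n)" "y \<in> power_dom X T (Suc n)"
    using assms by (auto simp: dynamical_domain_def maximal_dynamical_domain_def simp del: power_dom.simps)
  then show ?thesis using linear_on_power_dom[of n] by simp
qed

end

text \<open>
  A vector \<open>y\<close> in the open set is first replaced by a nearby \<open>d\<close> that is annihilated by all high
  powers of \<open>T\<close>; then \<open>T\<^sup>n (d + u\<^sub>n) = x\<close>, and \<open>d + u\<^sub>n\<close> is eventually in the open set.  Since a
  bound \<open>C\<close> for \<open>T\<close> would give \<open>\<parallel>x\<parallel> \<le> C\<^sup>n \<parallel>u\<^sub>n\<parallel>\<close>, superexponential decay
  of the backward orbit also shows that \<open>T\<close> is unbounded.
\<close>

proposition unbounded_hypermixing_criterion:
  assumes T: "linear_operator X T" and Y: "dynamical_domain X T Y"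
    and nontrivial: "Y \<noteq> {vzero X}"
    and kernels_dense: "\<And>y e. y \<in> Y \<Longrightarrow> 0 < e \<Longrightarrow>
      \<exists>d\<in>Y. \<exists>m. vdist X y d < e \<and> (op_app T ^^ m) d = vzero X"
    and backward_orbit: "\<And>x. x \<in> Y \<Longrightarrow> \<exists>u. u 0 = x \<and> (\<forall>n. u n \<in> Y) \<and>
      (\<forall>n. op_app T (u (Suc n)) = u n) \<and> (\<forall>C. (\<lambda>n. C ^ n * vnorm X (u n)) \<longlonglongrightarrow> 0)"
  shows "unbounded_operator X T \<and> hypermixing X T Y"
proof
  have Yc: "Y \<subseteq> carr X" and Yadd: "x \<in> Y \<Longrightarrow> y \<in> Y \<Longrightarrow> vadd X x y \<in> Y" for x y
    using Y by (auto simp: dynamical_domain_def linear_subspace_def)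
  have iter: "(op_app T ^^ n) (u n) = u 0" if "\<forall>n. op_app T (u (Suc n)) = u n" for u :: "nat \<Rightarrow> _" and n
    using that by (induction n) (auto simp: funpow_Suc_right simp del: funpow.simps)
  have Ydom: "Y \<subseteq> op_dom T"
    using dynamical_domain_iterates[OF T Y, where n = 0] by auto
  show "unbounded_operator X T"
    unfolding unbounded_operator_def
  proof
    assume "\<exists>C. \<forall>x\<in>op_dom T. vnorm X (op_app T x) \<le> C * vnorm X x"
    then obtain C where C: "\<And>x. x \<in> op_dom T \<Longrightarrow> vnorm X (op_app T x) \<le> C * vnorm X x" by blast
    obtain x where x: "x \<in> Y" "x \<noteq> vzero X"
      using nontrivial Y by (auto simp: dynamical_domain_def linear_subspace_def)
    \<comment> \<open>The decay is taken for \<open>\<bar>C\<bar>\<close>: the sign of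
      \<open>C\<close> is unknown, and the induction multiplies inequalities by powers of the
      bound.\<close>
    obtain u where u: "u 0 = x" "\<And>n. u n \<in> Y" "\<And>n. op_app T (u (Suc n)) = u n"
      "(\<lambda>n. \<bar>C\<bar> ^ n * vnorm X (u n)) \<longlonglongrightarrow> 0"
      using backward_orbit[OF x(1)] by blast
    have "vnorm X x \<le> \<bar>C\<bar> ^ n * vnorm X (u n)" for n
    proof (induction n)
      case (Suc n)
      have "vnorm X (u n) \<le> C * vnorm X (u (Suc n))" using C u(2,3) Ydom by (metis subsetD)
      also have "\<dots> \<le> \<bar>C\<bar> * vnorm X (u (Suc n))"
        using norm_nonneg u(2) Yc by (intro mult_right_mono) auto
      finally have "\<bar>C\<bar> ^ n * vnorm X (u n) \<le> \<bar>C\<bar> ^ n * (\<bar>C\<bar> * vnorm X (u (Suc n)))"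
        by (intro mult_left_mono) auto
      then show ?case using Suc by (simp add: mult_ac)
    qed (use u(1) in simp)
    then have "vnorm X x \<le> 0" using u(4) by (intro LIMSEQ_le_const) auto
    then show False using x Yc norm_nonneg norm_zero_imp by (metis order_antisym subsetD)
  qed
  show "hypermixing X T Y"
    unfolding hypermixing_def
  proof (intro conjI allI impI T Y, elim conjE)
    fix U assume U: "openin (subtopology (norm_topology X) Y) U" "U \<noteq> {}"
    interpret Metric_space "carr X" "vdist X" by (rule Metric_space)
    obtain W where W: "openin mtopology W" "U = W \<inter> Y"
      using U(1) by (auto simp: openin_subtopology norm_topology_def)
    obtain y where y: "y \<in> W" "y \<in> Y" using U(2) W(2) by auto
    obtain r where r: "r > 0" "mball y r \<subseteq> W" using W(1) y by (auto simp: openin_mtopology)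
    \<comment> \<open>Half of the radius pays for replacing \<open>y\<close> by \<open>d\<close>,
      the other half for adding \<open>u n\<close>.\<close>
    obtain d m where d: "d \<in> Y" "vdist X y d < r / 2" "(op_app T ^^ m) d = vzero X"
      using kernels_dense[OF y(2)] r(1) by (meson half_gt_zero)
    have d_ker: "(op_app T ^^ n) d = vzero X" if "n \<ge> m" for n
    proof -
      have "(op_app T ^^ (n - m)) ((op_app T ^^ m) d) = vzero X"
        using d(3) funpow_zero[OF T] by simp
      then show ?thesis
        by (metis that comp_apply le_add_diff_inverse2 funpow_add)
    qed
    show "Y - {vzero X} \<subseteq> (\<Union>i. \<Inter>n\<in>{i..}. (op_app T ^^ n) ` U)"
    proof
      fix x assume "x \<in> Y - {vzero X}"
      then have xY: "x \<in> Y" by simp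
      obtain u where u: "u 0 = x" "\<And>n. u n \<in> Y" "\<And>n. op_app T (u (Suc n)) = u n"
        \<comment> \<open>The instance \<open>C = 1\<close> of the decay: only convergence to 0
          matters here.\<close>
        "(\<lambda>n. 1 ^ n * vnorm X (u n)) \<longlonglongrightarrow> 0"
        using backward_orbit[OF xY] by blast
      then have "eventually (\<lambda>n. vnorm X (u n) < r / 2) sequentially"
        using r(1) by (intro order_tendstoD(2)[of _ 0]) auto
      then obtain k where k: "\<And>n. n \<ge> k \<Longrightarrow> vnorm X (u n) < r / 2"
        by (auto simp: eventually_sequentially)
      have "x \<in> (op_app T ^^ n) ` U" if n: "n \<ge> max m k" for n
      proof
        have "vdist X y (vadd X d (u n)) \<le> vdist X y d + vdist X d (vadd X d (u n))"
          using y d u(2) Yc by (intro triangle add_mem) auto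
        also have "\<dots> < r"
          using d u(2) Yc k[of n] n by (subst vdist_add) auto
        finally have "vadd X d (u n) \<in> mball y r"
          using y d u(2) Yc by (auto simp: add_mem subset_iff)
        then show "vadd X d (u n) \<in> U" using r W d u(2) Yadd by auto
        show "x = (op_app T ^^ n) (vadd X d (u n))"
          using iterate_add[OF T Y d(1) u(2)] d_ker[of n] n iter u(1,3) xY Yc
          by (simp add: zero_add subset_iff)
      qed
      then show "x \<in> (\<Union>i. \<Inter>n\<in>{i..}. (op_app T ^^ n) ` U)" by blast
    qed
  qed
qed

end

section \<open>The space \<open>L\<^sub>p\<close> of classes of functions\<close>

text \<open>Membership and norm on the level of functions: estimates are made for functions, and
  classes enter only through the transfer lemmas.\<close>

definition Lp_fun :: "real \<Rightarrow> 'a measure \<Rightarrow> ('a \<Rightarrow> 'k::euclidean_space) \<Rightarrow> bool" where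
  "Lp_fun p M f \<longleftrightarrow> f \<in> borel_measurable M \<and> integrable M (\<lambda>x. norm (f x) powr p)"

definition Lp_norm :: "real \<Rightarrow> 'a measure \<Rightarrow> ('a \<Rightarrow> 'k::euclidean_space) \<Rightarrow> real" where
  "Lp_norm p M f = (\<integral>x. norm (f x) powr p \<partial>M) powr (1/p)"

lemma ae_class_eqI:
  assumes "AE x in M. f x = g x"
  shows "ae_class M f = ae_class M g"
  using assms unfolding ae_class_def by (auto elim: eventually_elim2)

lemma self_in_ae_class: "f \<in> borel_measurable M \<Longrightarrow> f \<in> ae_class M f"
  by (simp add: ae_class_def)

lemma rep_in_ae_class:
  assumes "f \<in> borel_measurable M"
  shows "rep (ae_class M f) \<in> ae_class M f"
  unfolding rep_def using self_in_ae_class[OF assms] by (rule someI[where P = "\<lambda>f. f \<in> ae_class M _"])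

lemma rep_measurable: "f \<in> borel_measurable M \<Longrightarrow> rep (ae_class M f) \<in> borel_measurable M"
  and rep_AE: "f \<in> borel_measurable M \<Longrightarrow> AE x in M. rep (ae_class M f) x = f x"
  using rep_in_ae_class[of f M] by (auto simp: ae_class_def)

lemma ae_class_eq_iff:
  assumes "f \<in> borel_measurable M"
  shows "ae_class M f = ae_class M g \<longleftrightarrow> (AE x in M. f x = g x)"
  using ae_class_eqI[of f g M] self_in_ae_class[OF assms] by (auto simp: ae_class_def)

lemma Lp_fun_measurable: "Lp_fun p M f \<Longrightarrow> f \<in> borel_measurable M"
  by (simp add: Lp_fun_def)

text \<open>The value types of \<open>f\<close> and \<open>g\<close> may differ, so that a complex
  function can be compared with a real majorant such as a constant. As \<open>C\<close> may have
  either sign, the proof works with \<open>\<bar>C\<bar>\<close>.\<close>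

lemma Lp_fun_bound:
  fixes f :: "'a \<Rightarrow> 'k::euclidean_space" and g :: "'a \<Rightarrow> 'l::euclidean_space"
  assumes "Lp_fun p M f" "g \<in> borel_measurable M" "0 \<le> p"
    and "AE x in M. norm (g x) \<le> C * norm (f x)"
  shows "Lp_fun p M g"
proof -
  have "integrable M (\<lambda>x. \<bar>C\<bar> powr p * norm (f x) powr p)"
    using assms(1) by (simp add: Lp_fun_def)
  then have "integrable M (\<lambda>x. norm (g x) powr p)"
  proof (rule Bochner_Integration.integrable_bound)
    show "(\<lambda>x. norm (g x) powr p) \<in> borel_measurable M" using assms(2) by measurable
    show "AE x in M. norm (norm (g x) powr p) \<le> norm (\<bar>C\<bar> powr p * norm (f x) powr p)"
      using assms(4)
    proof eventually_elim
      case (elim x)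
      also have "C * norm (f x) \<le> \<bar>C\<bar> * norm (f x)" by (intro mult_right_mono) auto
      finally have "norm (g x) powr p \<le> (\<bar>C\<bar> * norm (f x)) powr p"
        using assms(3) by (intro powr_mono2) auto
      then show ?case by (simp add: powr_mult)
    qed
  qed
  with assms(2) show ?thesis by (simp add: Lp_fun_def)
qed

lemma Lp_norm_bound:
  fixes f :: "'a \<Rightarrow> 'k::euclidean_space" and g :: "'a \<Rightarrow> 'l::euclidean_space"
  assumes "Lp_fun p M f" "g \<in> borel_measurable M" "1 \<le> p" "0 \<le> C"
    and ae: "AE x in M. norm (g x) \<le> C * norm (f x)"
  shows "Lp_norm p M g \<le> C * Lp_norm p M f"
proof -
  have "(\<integral>x. norm (g x) powr p \<partial>M) \<le> (\<integral>x. C powr p * norm (f x) powr p \<partial>M)"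
  proof (rule integral_mono_AE)
    show "integrable M (\<lambda>x. norm (g x) powr p)"
      using Lp_fun_bound[OF assms(1,2) _ ae] assms(3) by (simp add: Lp_fun_def)
    show "integrable M (\<lambda>x. C powr p * norm (f x) powr p)" using assms(1) by (simp add: Lp_fun_def)
    show "AE x in M. norm (g x) powr p \<le> C powr p * norm (f x) powr p"
      using ae
    proof eventually_elim
      case (elim x)
      then have "norm (g x) powr p \<le> (C * norm (f x)) powr p"
        using assms(3) by (intro powr_mono2) auto
      then show ?case using assms(4) by (simp add: powr_mult)
    qed
  qed
  then have "Lp_norm p M g \<le> (C powr p * (\<integral>x. norm (f x) powr p \<partial>M)) powr (1/p)"
    unfolding Lp_norm_def using assms(3) by (intro powr_mono2) auto
  also have "\<dots> = C * Lp_norm p M f"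
    unfolding Lp_norm_def using assms(3,4) by (simp add: powr_mult powr_powr)
  finally show ?thesis .
qed

lemma Lp_fun_cong_AE:
  assumes "f \<in> borel_measurable M" "g \<in> borel_measurable M" "AE x in M. f x = g x"
  shows "Lp_fun p M f \<longleftrightarrow> Lp_fun p M g"
proof -
  have "AE x in M. norm (f x) powr p = norm (g x) powr p" using assms(3) by eventually_elim simp
  then have "integrable M (\<lambda>x. norm (f x) powr p) \<longleftrightarrow> integrable M (\<lambda>x. norm (g x) powr p)"
    using assms by (intro integrable_cong_AE) auto
  with assms show ?thesis by (simp add: Lp_fun_def)
qed

lemma Lp_norm_cong_AE:
  assumes "f \<in> borel_measurable M" "g \<in> borel_measurable M" "AE x in M. f x = g x"
  shows "Lp_norm p M f = Lp_norm p M g"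
proof -
  have "AE x in M. norm (f x) powr p = norm (g x) powr p" using assms(3) by eventually_elim simp
  then have "(\<integral>x. norm (f x) powr p \<partial>M) = (\<integral>x. norm (g x) powr p \<partial>M)"
    using assms by (intro integral_cong_AE) auto
  then show ?thesis by (simp add: Lp_norm_def)
qed

lemma Lp_norm_nonneg: "0 \<le> Lp_norm p M f"
  by (simp add: Lp_norm_def)

lemma Lp_norm_powr: "1 \<le> p \<Longrightarrow> Lp_norm p M f powr p = (\<integral>x. norm (f x) powr p \<partial>M)"
  by (simp add: Lp_norm_def powr_powr integral_nonneg_AE)

lemma Lp_fun_scale:
  fixes f :: "'a \<Rightarrow> 'k::{real_normed_field,euclidean_space}"
  assumes "Lp_fun p M f" "1 \<le> p"
  shows "Lp_fun p M (\<lambda>x. c * f x)"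
  by (rule Lp_fun_bound[OF assms(1), where C = "norm c"])
    (use assms in \<open>auto simp: Lp_fun_def norm_mult\<close>)

text \<open>From \<open>|f + g| \<le> 2 max |f| |g|\<close>, and the \<open>p\<close>-th power of a
  maximum is at most the sum of the \<open>p\<close>-th powers. The sharp inequality comes later and
  needs this integrability.\<close>

lemma Lp_fun_add:
  fixes f g :: "'a \<Rightarrow> 'k::euclidean_space"
  assumes "Lp_fun p M f" "Lp_fun p M g" "1 \<le> p"
  shows "Lp_fun p M (\<lambda>x. f x + g x)"
proof -
  have m: "(\<lambda>x. f x + g x) \<in> borel_measurable M" using assms by (auto simp: Lp_fun_def)
  have "integrable M (\<lambda>x. 2 powr p * (norm (f x) powr p + norm (g x) powr p))"
    using assms by (simp add: Lp_fun_def)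
  then have "integrable M (\<lambda>x. norm (f x + g x) powr p)"
  proof (rule Bochner_Integration.integrable_bound)
    show "(\<lambda>x. norm (f x + g x) powr p) \<in> borel_measurable M" using m by measurable
    have "norm (f x + g x) powr p \<le> 2 powr p * (norm (f x) powr p + norm (g x) powr p)" for x
    proof -
      have "norm (f x + g x) \<le> 2 * max (norm (f x)) (norm (g x))"
        by (rule order_trans[OF norm_triangle_ineq]) auto
      then have "norm (f x + g x) powr p \<le> 2 powr p * max (norm (f x)) (norm (g x)) powr p"
        using assms(3) by (metis norm_ge_zero powr_mono2 powr_mult order_trans zero_le_one)
      also have "max (norm (f x)) (norm (g x)) powr p \<le> norm (f x) powr p + norm (g x) powr p"
        by (simp add: max_def)
      finally show ?thesis by simp
    qed
    then show "AE x in M. norm (norm (f x + g x) powr p)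
        \<le> norm (2 powr p * (norm (f x) powr p + norm (g x) powr p))"
      by (intro AE_I2) (auto intro!: order_trans[OF _ abs_ge_self])
  qed
  with m show ?thesis by (simp add: Lp_fun_def)
qed

text \<open>Convexity is invoked at positive points only. If one point is 0, the claim reduces to
  \<open>r powr p \<le> r\<close> for a weight \<open>r\<close> in \<open>(0,1]\<close>.\<close>

lemma convex_powr_le:
  fixes x y s t :: real
  assumes "1 \<le> p" "0 \<le> x" "0 \<le> y" "0 < s" "0 < t" "s + t = 1"
  shows "(s * x + t * y) powr p \<le> s * x powr p + t * y powr p"
proof -
  have le: "r powr p \<le> r" if "0 < r" "r \<le> 1" for r :: real
    using that assms(1) powr_mono'[of 1 p r] by simp
  consider "x = 0" | "y = 0" | "x > 0" "y > 0" using assms by fastforce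
  then show ?thesis
  proof cases
    case 1
    then show ?thesis
      using assms le[of t] by (simp add: powr_mult mult_right_mono)
  next
    case 2
    then show ?thesis
      using assms le[of s] by (simp add: powr_mult mult_right_mono)
  next
    case 3
    then show ?thesis
      using convex_onD[OF powr_convex[OF assms(1)], of t x y] assms
      by (simp add: eq_diff_eq[symmetric])
  qed
qed

text \<open>After normalisation, \<open>(f + g) / (A + B)\<close> is bounded by a convex combination
  of \<open>|f| / A\<close> and \<open>|g| / B\<close> with weights \<open>A / (A + B)\<close> and
  \<open>B / (A + B)\<close>. Convexity of the \<open>p\<close>-th power is integrated, and each
  normalised integral is at most 1.\<close>

lemma Minkowski_inequality:
  fixes f g :: "'a \<Rightarrow> 'k::euclidean_space"
  assumes f: "Lp_fun p M f" and g: "Lp_fun p M g" and p: "1 \<le> p"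
  shows "Lp_norm p M (\<lambda>x. f x + g x) \<le> Lp_norm p M f + Lp_norm p M g"
proof (rule field_le_epsilon)
  fix e :: real assume e: "e > 0"
  \<comment> \<open>The added \<open>e / 2\<close> keeps both denominators positive even if a norm
    is 0; together they cost \<open>e\<close>.\<close>
  define A B where "A = Lp_norm p M f + e / 2" and "B = Lp_norm p M g + e / 2"
  have pos: "A > 0" "B > 0" using e by (auto simp: A_def B_def Lp_norm_nonneg intro!: add_nonneg_pos)
  have If: "(\<integral>x. norm (f x) powr p \<partial>M) \<le> A powr p" and Ig: "(\<integral>x. norm (g x) powr p \<partial>M) \<le> B powr p"
    unfolding Lp_norm_powr[OF p, symmetric] using e p by (auto simp: A_def B_def Lp_norm_nonneg intro!: powr_mono2)
  have pointwise: "norm (f x + g x) powr p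
      \<le> (A + B) powr p * (A / (A + B) * (norm (f x) powr p / A powr p)
          + B / (A + B) * (norm (g x) powr p / B powr p))" for x
  proof -
    have "norm (f x + g x) \<le> (A + B) * (A / (A + B) * (norm (f x) / A) + B / (A + B) * (norm (g x) / B))"
      using pos by (simp add: divide_simps) (simp add: norm_triangle_ineq flip: distrib_left)
    then have "norm (f x + g x) powr p
        \<le> (A + B) powr p * (A / (A + B) * (norm (f x) / A) + B / (A + B) * (norm (g x) / B)) powr p"
      using p pos by (subst powr_mult[symmetric]) (auto intro!: powr_mono2)
    also have "(A / (A + B) * (norm (f x) / A) + B / (A + B) * (norm (g x) / B)) powr p
        \<le> A / (A + B) * (norm (f x) / A) powr p + B / (A + B) * (norm (g x) / B) powr p"
      using p pos by (intro convex_powr_le) (auto simp: divide_simps)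
    finally show ?thesis using pos by (simp add: powr_divide)
  qed
  have "(\<integral>x. norm (f x + g x) powr p \<partial>M) \<le>
     (\<integral>x. (A + B) powr p * (A / (A + B) * (norm (f x) powr p / A powr p)
          + B / (A + B) * (norm (g x) powr p / B powr p)) \<partial>M)"
    using Lp_fun_add[OF f g p] f g by (intro integral_mono pointwise) (auto simp: Lp_fun_def)
  also have "\<dots> = (A + B) powr p * (A / (A + B) * ((\<integral>x. norm (f x) powr p \<partial>M) / A powr p)
          + B / (A + B) * ((\<integral>x. norm (g x) powr p \<partial>M) / B powr p))"
    using f g by (simp add: Lp_fun_def)
  also have "\<dots> \<le> (A + B) powr p * (A / (A + B) * 1 + B / (A + B) * 1)"
    using pos If Ig by (intro mult_left_mono add_mono) auto
  also have "\<dots> = (A + B) powr p"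
    using pos by (simp flip: add_divide_distrib)
  finally have "Lp_norm p M (\<lambda>x. f x + g x) \<le> ((A + B) powr p) powr (1/p)"
    unfolding Lp_norm_def using p by (intro powr_mono2) auto
  then show "Lp_norm p M (\<lambda>x. f x + g x) \<le> Lp_norm p M f + Lp_norm p M g + e"
    using p pos by (simp add: powr_powr A_def B_def)
qed

lemma Lp_norm_zero_imp:
  assumes "Lp_fun p M f" "1 \<le> p" "Lp_norm p M f = 0"
  shows "AE x in M. f x = 0"
proof -
  have "(\<integral>x. norm (f x) powr p \<partial>M) = 0"
    using Lp_norm_powr[OF assms(2), of M f] assms(2,3) by simp
  then have "AE x in M. norm (f x) powr p = 0"
    using assms by (subst (asm) integral_nonneg_eq_0_iff_AE) (auto simp: Lp_fun_def)
  then show ?thesis by eventually_elim (simp add: powr_def split: if_splits)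
qed

section \<open>From functions to classes\<close>

lemma carr_Lp: "carr (Lp_space p M) = {ae_class M f | f. Lp_fun p M f}"
  by (simp add: Lp_space_def Lp_fun_def)

lemma ae_class_in_Lp_iff:
  assumes "f \<in> borel_measurable M"
  shows "ae_class M f \<in> carr (Lp_space p M) \<longleftrightarrow> Lp_fun p M f"
proof
  assume "ae_class M f \<in> carr (Lp_space p M)"
  then obtain g where "Lp_fun p M g" "AE x in M. f x = g x"
    using assms by (auto simp: carr_Lp ae_class_eq_iff)
  then show "Lp_fun p M f" using assms Lp_fun_cong_AE Lp_fun_measurable by blast
qed (auto simp: carr_Lp)

lemma vzero_Lp: "vzero (Lp_space p M) = ae_class M (\<lambda>x. 0)"
  by (simp add: Lp_space_def)

lemma vadd_ae_class:
  assumes "f \<in> borel_measurable M" "g \<in> borel_measurable M"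
  shows "vadd (Lp_space p M) (ae_class M f) (ae_class M g) = ae_class M (\<lambda>x. f x + g x)"
  unfolding Lp_space_def
  using rep_AE[OF assms(1)] rep_AE[OF assms(2)] by (auto intro!: ae_class_eqI)

lemma vscale_ae_class:
  assumes "f \<in> borel_measurable M"
  shows "vscale (Lp_space p M) c (ae_class M f) = ae_class M (\<lambda>x. c * f x)"
  unfolding Lp_space_def using rep_AE[OF assms] by (auto intro!: ae_class_eqI)

lemma vnorm_ae_class:
  assumes "f \<in> borel_measurable M"
  shows "vnorm (Lp_space p M) (ae_class M f) = Lp_norm p M f"
  using Lp_norm_cong_AE[OF rep_measurable[OF assms] assms rep_AE[OF assms]]
  by (simp add: Lp_space_def Lp_norm_def)

lemma rep_Lp:
  assumes "F \<in> carr (Lp_space p M)"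
  shows "Lp_fun p M (rep F)" "ae_class M (rep F) = F"
proof -
  obtain f where f: "F = ae_class M f" "Lp_fun p M f" using assms by (auto simp: carr_Lp)
  note m = Lp_fun_measurable[OF f(2)]
  show "Lp_fun p M (rep F)"
    using f rep_AE[OF m] rep_measurable[OF m] Lp_fun_cong_AE m by blast
  show "ae_class M (rep F) = F"
    unfolding f(1) by (rule ae_class_eqI[OF rep_AE[OF m]])
qed

lemma normed_sp_laws_Lp:
  assumes p: "1 \<le> p"
  shows "normed_sp_laws (Lp_space p M :: ('k::{real_normed_field,euclidean_space}, ('a \<Rightarrow> 'k) set) normed_sp)"
    (is "normed_sp_laws ?X")
proof -
  have ex: "\<exists>f. Lp_fun p M f \<and> f \<in> borel_measurable M \<and> F = ae_class M f" if "F \<in> carr ?X" for F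
    using that by (auto simp: carr_Lp Lp_fun_measurable)
  note ops = vadd_ae_class vscale_ae_class vnorm_ae_class vzero_Lp ae_class_in_Lp_iff
  show ?thesis
  proof
    show "vzero ?X \<in> carr ?X" by (simp add: ops Lp_fun_def)
    show "vnorm ?X (vzero ?X) = 0" using p by (simp add: ops Lp_norm_def)
  next
    fix x assume "x \<in> carr ?X"
    then obtain f where f: "Lp_fun p M f" "f \<in> borel_measurable M" "x = ae_class M f" using ex by blast
    show "vadd ?X (vzero ?X) x = x" "vscale ?X 0 x = vzero ?X" "vscale ?X 1 x = x" "0 \<le> vnorm ?X x"
      using f by (simp_all add: ops Lp_norm_nonneg)
    show "vscale ?X c x \<in> carr ?X" for c
      using f Lp_fun_scale[OF f(1) p] by (simp add: ops)
    show "vscale ?X c (vscale ?X d x) = vscale ?X (c * d) x" for c d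
      using f by (simp add: ops mult.assoc)
    show "vscale ?X (c + d) x = vadd ?X (vscale ?X c x) (vscale ?X d x)" for c d
      using f by (simp add: ops distrib_right)
    show "x = vzero ?X" if "vnorm ?X x = 0"
      using that f Lp_norm_zero_imp[OF f(1) p] by (simp add: ops ae_class_eq_iff)
    show "vnorm ?X (vscale ?X (-1) x) = vnorm ?X x"
      using f by (simp add: ops Lp_norm_def)
    fix y assume "y \<in> carr ?X"
    then obtain g where g: "Lp_fun p M g" "g \<in> borel_measurable M" "y = ae_class M g" using ex by blast
    show "vadd ?X x y \<in> carr ?X" using f g Lp_fun_add[OF f(1) g(1) p] by (simp add: ops)
    show "vadd ?X x y = vadd ?X y x" using f g by (simp add: ops add.commute)
    show "vscale ?X c (vadd ?X x y) = vadd ?X (vscale ?X c x) (vscale ?X c y)" for c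
      using f g by (simp add: ops distrib_left)
    show "vnorm ?X (vadd ?X x y) \<le> vnorm ?X x + vnorm ?X y"
      using f g Minkowski_inequality[OF f(1) g(1) p] by (simp add: ops)
    fix z assume "z \<in> carr ?X"
    then obtain h where "Lp_fun p M h" "h \<in> borel_measurable M" "z = ae_class M h" using ex by blast
    then show "vadd ?X (vadd ?X x y) z = vadd ?X x (vadd ?X y z)"
      using f g by (simp add: ops add.assoc)
  qed
qed

section \<open>The Laplacian on polynomials\<close>

text \<open>Adding one monomial at a time gives an induction in which additive statements need
  checking only on monomials. The parameters \<open>A\<close>, \<open>B\<close> let the same
  construction serve the real coordinates and the pair \<open>z\<close>, conjugate of
  \<open>z\<close>.\<close>

inductive_set monomial_span :: "('a \<Rightarrow> complex) \<Rightarrow> ('a \<Rightarrow> complex) \<Rightarrow> ('a \<Rightarrow> complex) set"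
  for A B where
  zero: "(\<lambda>v. 0) \<in> monomial_span A B"
| add_monomial: "q \<in> monomial_span A B \<Longrightarrow> (\<lambda>v. q v + c * A v ^ i * B v ^ j) \<in> monomial_span A B"

lemma monomial_in_span: "(\<lambda>v. c * A v ^ i * B v ^ j) \<in> monomial_span A B"
  using add_monomial[OF zero, of c A i B j] by simp

lemma span_add:
  assumes "q \<in> monomial_span A B" "r \<in> monomial_span A B"
  shows "(\<lambda>v. q v + r v) \<in> monomial_span A B"
  using assms(2)
proof induction
  case (add_monomial r c i j)
  then show ?case using monomial_span.add_monomial[OF add_monomial.IH, of c i j] by (simp add: add.assoc)
qed (use assms(1) in simp)

lemma span_mult_monomial:
  assumes "q \<in> monomial_span A B"
  shows "(\<lambda>v. q v * (c * A v ^ i * B v ^ j)) \<in> monomial_span A B"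
  using assms
proof induction
  case zero
  then show ?case using monomial_span.zero by simp
next
  case (add_monomial q d k l)
  show ?case
    using monomial_span.add_monomial[OF add_monomial.IH, of "d * c" "k + i" "l + j"]
    by (simp add: algebra_simps power_add)
qed

lemma span_mult:
  assumes "q \<in> monomial_span A B" "r \<in> monomial_span A B"
  shows "(\<lambda>v. q v * r v) \<in> monomial_span A B"
  using assms(2)
proof induction
  case zero
  then show ?case using monomial_span.zero by simp
next
  case (add_monomial r c i j)
  then show ?case
    using span_add[OF add_monomial.IH span_mult_monomial[OF assms(1), of c i j]]
    by (simp add: distrib_left)
qed

lemma span_const: "(\<lambda>v. c) \<in> monomial_span A B"
  using monomial_in_span[of c A 0 B 0] by simp

lemma span_fst: "A \<in> monomial_span A B" and span_snd: "B \<in> monomial_span A B"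
  using monomial_in_span[of 1 A 1 B 0] monomial_in_span[of 1 A 0 B 1] by simp_all

lemma span_power: "q \<in> monomial_span A B \<Longrightarrow> (\<lambda>v. q v ^ n) \<in> monomial_span A B"
  by (induction n) (auto intro: span_const span_mult)

lemma span_sum:
  "(\<And>i. i \<in> I \<Longrightarrow> q i \<in> monomial_span A B) \<Longrightarrow> (\<lambda>v. \<Sum>i\<in>I. q i v) \<in> monomial_span A B"
  by (induction I rule: infinite_finite_induct) (auto intro: span_add zero)

text \<open>Change of coordinates: spans are closed under sums, products and powers, so substituting
  polynomials for the generators stays inside.\<close>

lemma span_subset:
  assumes "A \<in> monomial_span A' B'" "B \<in> monomial_span A' B'"
  shows "monomial_span A B \<subseteq> monomial_span A' B'"
proof
  fix q assume "q \<in> monomial_span A B"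
  then show "q \<in> monomial_span A' B'"
    by induction (intro zero span_add span_mult span_power span_const assms | assumption)+
qed

section \<open>Polynomials in \<open>z\<close> and its conjugate\<close>

definition coord_z :: "real \<times> real \<Rightarrow> complex" where "coord_z v = of_real (fst v) + \<i> * of_real (snd v)"
definition coord_zbar :: "real \<times> real \<Rightarrow> complex" where "coord_zbar v = of_real (fst v) - \<i> * of_real (snd v)"

lemma bivariate_polynomial_iff_real_coordinates:
  "bivariate_polynomial q \<longleftrightarrow> q \<in> monomial_span (\<lambda>v. of_real (fst v)) (\<lambda>v. of_real (snd v))"
proof
  assume "bivariate_polynomial q"
  then obtain N c where "q = (\<lambda>(x, y). \<Sum>i\<le>N. \<Sum>j\<le>N. c i j * of_real x ^ i * of_real y ^ j)"
    by (auto simp: bivariate_polynomial_def)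
  then have "q = (\<lambda>v. \<Sum>i\<le>(N::nat). \<Sum>j\<le>N. c i j * of_real (fst v) ^ i * of_real (snd v) ^ j)"
    by (simp add: case_prod_unfold)
  then show "q \<in> monomial_span (\<lambda>v. of_real (fst v)) (\<lambda>v. of_real (snd v))"
    by (simp only:) (intro span_sum monomial_in_span)
next
  assume "q \<in> monomial_span (\<lambda>v. of_real (fst v)) (\<lambda>v. of_real (snd v))"
  then show "bivariate_polynomial q"
  proof induction
    case zero
    then show ?case unfolding bivariate_polynomial_def by (intro exI[of _ 0] exI[of _ "\<lambda>_ _. 0"]) auto
  next
    case (add_monomial q c i j)
    then obtain N d where q: "q = (\<lambda>(x, y). \<Sum>k\<le>N. \<Sum>l\<le>N. d k l * of_real x ^ k * of_real y ^ l)"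
      by (auto simp: bivariate_polynomial_def)
    \<comment> \<open>The square array of coefficients has to grow until the exponents
      \<open>i\<close> and \<open>j\<close> fit; old coefficients are padded by 0 outside the old
      square.\<close>
    define N' where "N' = max N (max i j)"
    define d' where "d' k l = (if k \<le> N \<and> l \<le> N then d k l else 0) + (if k = i \<and> l = j then c else 0)" for k l
    have ij: "i \<le> N'" "j \<le> N'" by (simp_all add: N'_def)
    have "(\<Sum>k\<le>N'. \<Sum>l\<le>N'. d' k l * of_real x ^ k * of_real y ^ l) =
        (\<Sum>k\<le>N. \<Sum>l\<le>N. d k l * of_real x ^ k * of_real y ^ l) + c * of_real x ^ i * of_real y ^ j" for x y :: real
    proof -
      have "(\<Sum>k\<le>N'. \<Sum>l\<le>N'. d' k l * of_real x ^ k * of_real y ^ l) =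
         (\<Sum>k\<le>N'. \<Sum>l\<le>N'. (if k \<le> N then if l \<le> N then d k l * of_real x ^ k * of_real y ^ l else 0 else 0))
         + (\<Sum>k\<le>N'. \<Sum>l\<le>N'. if k = i then if l = j then c * of_real x ^ i * of_real y ^ j else 0 else 0)"
        unfolding sum.distrib[symmetric] d'_def by (intro sum.cong refl) (auto simp: algebra_simps)
      also have "(\<Sum>k\<le>N'. \<Sum>l\<le>N'. if k = i then if l = j then c * of_real x ^ i * of_real y ^ j else 0 else 0)
          = (\<Sum>k\<le>N'. if k = i then \<Sum>l\<le>N'. if l = j then c * of_real x ^ i * of_real y ^ j else 0 else 0)"
        by (intro sum.cong) auto
      also have "\<dots> = c * of_real x ^ i * of_real y ^ j" using ij by simp
      also have "(\<Sum>k\<le>N'. \<Sum>l\<le>N'. (if k \<le> N then if l \<le> N then d k l * of_real x ^ k * of_real y ^ l else 0 else 0))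
          = (\<Sum>k\<le>N. \<Sum>l\<le>N'. (if k \<le> N then if l \<le> N then d k l * of_real x ^ k * of_real y ^ l else 0 else 0))"
        by (rule sum.mono_neutral_right) (auto simp: N'_def)
      also have "\<dots> = (\<Sum>k\<le>N. \<Sum>l\<le>N. d k l * of_real x ^ k * of_real y ^ l)"
        by (intro sum.cong refl sum.mono_neutral_cong_right) (auto simp: N'_def)
      finally show ?thesis .
    qed
    then have "(\<lambda>v. q v + c * of_real (fst v) ^ i * of_real (snd v) ^ j)
        = (\<lambda>(x, y). \<Sum>k\<le>N'. \<Sum>l\<le>N'. d' k l * of_real x ^ k * of_real y ^ l)"
      by (auto simp: q)
    then show ?case unfolding bivariate_polynomial_def by blast
  qed
qed

text \<open>The two pairs of coordinates are complex linear combinations of each other: with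
  \<open>w\<close> the conjugate of \<open>z\<close>, \<open>x = (z + w) / 2\<close> and
  \<open>y = (z - w) / (2 \<i>)\<close>.\<close>

lemma bivariate_polynomial_iff: "bivariate_polynomial q \<longleftrightarrow> q \<in> monomial_span coord_z coord_zbar"
proof -
  let ?x = "\<lambda>v::real \<times> real. of_real (fst v) :: complex" and ?y = "\<lambda>v::real \<times> real. of_real (snd v) :: complex"
  have "(\<lambda>v. 1/2 * coord_z v + 1/2 * coord_zbar v) \<in> monomial_span coord_z coord_zbar"
    "(\<lambda>v. - \<i>/2 * coord_z v + \<i>/2 * coord_zbar v) \<in> monomial_span coord_z coord_zbar"
    by (intro span_add span_mult span_const span_fst span_snd)+
  moreover have "?x = (\<lambda>v. 1/2 * coord_z v + 1/2 * coord_zbar v)"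
    "?y = (\<lambda>v. - \<i>/2 * coord_z v + \<i>/2 * coord_zbar v)"
    by (auto simp: coord_z_def coord_zbar_def field_simps)
  ultimately have xy: "?x \<in> monomial_span coord_z coord_zbar" "?y \<in> monomial_span coord_z coord_zbar"
    by metis+
  have "(\<lambda>v. ?x v + \<i> * ?y v) \<in> monomial_span ?x ?y" "(\<lambda>v. ?x v + - \<i> * ?y v) \<in> monomial_span ?x ?y"
    by (intro span_add span_mult span_const span_fst span_snd)+
  then have "coord_z \<in> monomial_span ?x ?y" "coord_zbar \<in> monomial_span ?x ?y"
    by (simp_all add: coord_z_def[abs_def] coord_zbar_def[abs_def])
  then show ?thesis
    unfolding bivariate_polynomial_iff_real_coordinates using xy span_subset by blast
qed

section \<open>Partial derivatives and the Laplacian on monomials\<close>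

abbreviation (input) zmonomial :: "complex \<Rightarrow> nat \<Rightarrow> nat \<Rightarrow> real \<times> real \<Rightarrow> complex" where
  "zmonomial c i j \<equiv> \<lambda>v. c * coord_z v ^ i * coord_zbar v ^ j"

text \<open>With \<open>y\<close> fixed, the monomial extends to a polynomial in a complex variable
  \<open>u\<close> in place of \<open>x\<close>; its complex derivative is restricted to the real
  line. The truncated exponent \<open>i - 1\<close> is harmless, as its coefficient vanishes for
  \<open>i = 0\<close>.\<close>

lemma zmonomial_derivative_x:
  "((\<lambda>s. zmonomial c i j (s, y)) has_vector_derivative
     zmonomial (c * of_nat i) (i - 1) j (x, y) + zmonomial (c * of_nat j) i (j - 1) (x, y)) (at x)"
proof -
  have "((\<lambda>u. c * (u + \<i> * of_real y) ^ i * (u - \<i> * of_real y) ^ j) has_field_derivative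
     zmonomial (c * of_nat i) (i - 1) j (x, y) + zmonomial (c * of_nat j) i (j - 1) (x, y)) (at (of_real x))"
    by (auto intro!: derivative_eq_intros simp: coord_z_def coord_zbar_def algebra_simps)
  from has_vector_derivative_real_field[OF this] show ?thesis by (simp add: coord_z_def coord_zbar_def)
qed

lemma zmonomial_derivative_y:
  "((\<lambda>s. zmonomial c i j (x, s)) has_vector_derivative
     zmonomial (c * \<i> * of_nat i) (i - 1) j (x, y) + zmonomial (- c * \<i> * of_nat j) i (j - 1) (x, y)) (at y)"
proof -
  have "((\<lambda>u. c * (of_real x + \<i> * u) ^ i * (of_real x - \<i> * u) ^ j) has_field_derivative
     zmonomial (c * \<i> * of_nat i) (i - 1) j (x, y) + zmonomial (- c * \<i> * of_nat j) i (j - 1) (x, y)) (at (of_real y))"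
    by (auto intro!: derivative_eq_intros simp: coord_z_def coord_zbar_def algebra_simps)
  from has_vector_derivative_real_field[OF this] show ?thesis by (simp add: coord_z_def coord_zbar_def)
qed

text \<open>\<open>vector_derivative\<close> is a choice operator, so existence of a derivative,
  again a polynomial, has to be known before \<open>partial_x\<close> and \<open>partial_y\<close>
  can be computed.\<close>

lemma span_derivative_ex:
  assumes "q \<in> monomial_span coord_z coord_zbar"
  shows "\<exists>r\<in>monomial_span coord_z coord_zbar. \<forall>x y. ((\<lambda>s. q (s, y)) has_vector_derivative r (x, y)) (at x)"
    and "\<exists>r\<in>monomial_span coord_z coord_zbar. \<forall>x y. ((\<lambda>s. q (x, s)) has_vector_derivative r (x, y)) (at y)"
proof -
  show "\<exists>r\<in>monomial_span coord_z coord_zbar. \<forall>x y. ((\<lambda>s. q (s, y)) has_vector_derivative r (x, y)) (at x)"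
    using assms
  proof induction
    case zero
    show ?case by (intro bexI[OF _ monomial_span.zero] allI) (auto intro: derivative_eq_intros)
  next
    case (add_monomial q c i j)
    then obtain r where r: "r \<in> monomial_span coord_z coord_zbar"
      "\<And>x y. ((\<lambda>s. q (s, y)) has_vector_derivative r (x, y)) (at x)" by blast
    show ?case
      by (rule bexI[where x = "\<lambda>v. r v + (zmonomial (c * of_nat i) (i - 1) j v + zmonomial (c * of_nat j) i (j - 1) v)"])
        (intro allI has_vector_derivative_add r zmonomial_derivative_x span_add monomial_in_span)+
  qed
  show "\<exists>r\<in>monomial_span coord_z coord_zbar. \<forall>x y. ((\<lambda>s. q (x, s)) has_vector_derivative r (x, y)) (at y)"
    using assms
  proof induction
    case zero
    show ?case by (intro bexI[OF _ monomial_span.zero] allI) (auto intro: derivative_eq_intros)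
  next
    case (add_monomial q c i j)
    then obtain r where r: "r \<in> monomial_span coord_z coord_zbar"
      "\<And>x y. ((\<lambda>s. q (x, s)) has_vector_derivative r (x, y)) (at y)" by blast
    show ?case
      by (rule bexI[where x = "\<lambda>v. r v + (zmonomial (c * \<i> * of_nat i) (i - 1) j v + zmonomial (- c * \<i> * of_nat j) i (j - 1) v)"])
        (intro allI has_vector_derivative_add r zmonomial_derivative_y span_add monomial_in_span)+
  qed
qed

lemma partial_x_eqI: "(\<And>x y. ((\<lambda>s. q (s, y)) has_vector_derivative r (x, y)) (at x)) \<Longrightarrow> partial_x q = r"
  and partial_y_eqI: "(\<And>x y. ((\<lambda>s. q (x, s)) has_vector_derivative r (x, y)) (at y)) \<Longrightarrow> partial_y q = r"
  by (auto simp: partial_x_def partial_y_def fun_eq_iff vector_derivative_at)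

lemma
  assumes "q \<in> monomial_span coord_z coord_zbar"
  shows partial_x_in_span: "partial_x q \<in> monomial_span coord_z coord_zbar"
    and partial_y_in_span: "partial_y q \<in> monomial_span coord_z coord_zbar"
    and has_partial_x: "((\<lambda>s. q (s, y)) has_vector_derivative partial_x q (x, y)) (at x)"
    and has_partial_y: "((\<lambda>s. q (x, s)) has_vector_derivative partial_y q (x, y)) (at y)"
  using span_derivative_ex[OF assms] partial_x_eqI partial_y_eqI by metis+

lemma
  assumes "q \<in> monomial_span coord_z coord_zbar" "r \<in> monomial_span coord_z coord_zbar"
  shows partial_x_add: "partial_x (\<lambda>v. q v + r v) = (\<lambda>v. partial_x q v + partial_x r v)"
    and partial_y_add: "partial_y (\<lambda>v. q v + r v) = (\<lambda>v. partial_y q v + partial_y r v)"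
  using assms by (auto intro!: partial_x_eqI partial_y_eqI has_vector_derivative_add has_partial_x has_partial_y)

lemma partial_x_zmonomial:
  "partial_x (zmonomial c i j) = (\<lambda>v. zmonomial (c * of_nat i) (i - 1) j v + zmonomial (c * of_nat j) i (j - 1) v)"
  by (rule partial_x_eqI) (rule zmonomial_derivative_x)

lemma partial_y_zmonomial:
  "partial_y (zmonomial c i j) = (\<lambda>v. zmonomial (c * \<i> * of_nat i) (i - 1) j v + zmonomial (- c * \<i> * of_nat j) i (j - 1) v)"
  by (rule partial_y_eqI) (rule zmonomial_derivative_y)

lemma laplacian_in_span:
  "q \<in> monomial_span coord_z coord_zbar \<Longrightarrow> laplacian q \<in> monomial_span coord_z coord_zbar"
  unfolding laplacian_def by (intro span_add partial_x_in_span partial_y_in_span)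

lemma laplacian_add:
  assumes "q \<in> monomial_span coord_z coord_zbar" "r \<in> monomial_span coord_z coord_zbar"
  shows "laplacian (\<lambda>v. q v + r v) = (\<lambda>v. laplacian q v + laplacian r v)"
  using assms
  by (simp add: laplacian_def partial_x_add partial_y_add partial_x_in_span partial_y_in_span add_ac)

text \<open>In the coordinates \<open>z\<close> and its conjugate, the Laplacian is four times the mixed derivative.\<close>

lemma laplacian_zmonomial:
  "laplacian (zmonomial c i j) = zmonomial (4 * c * of_nat i * of_nat j) (i - 1) (j - 1)"
proof
  fix v
  \<comment> \<open>Two derivatives in \<open>y\<close> bring out \<open>\<i>\<close> twice. The
    pure terms acquire a minus sign and cancel those from \<open>x\<close>, while the mixed term
    occurs twice with a plus sign in each direction, which makes the factor 4.\<close>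
  have neg: "c * \<i> * k * \<i> * l = - (c * k * l)" "- (- c * \<i> * k) * \<i> * l = - (c * k * l)"
    "- (c * \<i> * k) * \<i> * l = c * k * l" "- c * \<i> * k * \<i> * l = c * k * l" for k l
    by (simp_all add: mult_ac)
  have "partial_x (partial_x (zmonomial c i j)) v =
      zmonomial (c * of_nat i * of_nat (i - 1)) (i - 1 - 1) j v + zmonomial (c * of_nat i * of_nat j) (i - 1) (j - 1) v
      + (zmonomial (c * of_nat j * of_nat i) (i - 1) (j - 1) v + zmonomial (c * of_nat j * of_nat (j - 1)) i (j - 1 - 1) v)"
    by (simp only: partial_x_zmonomial partial_x_add[OF monomial_in_span monomial_in_span])
  moreover have "partial_y (partial_y (zmonomial c i j)) v =
      zmonomial (- (c * of_nat i * of_nat (i - 1))) (i - 1 - 1) j v + zmonomial (c * of_nat i * of_nat j) (i - 1) (j - 1) v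
      + (zmonomial (c * of_nat j * of_nat i) (i - 1) (j - 1) v + zmonomial (- (c * of_nat j * of_nat (j - 1))) i (j - 1 - 1) v)"
    by (simp only: partial_y_zmonomial partial_y_add[OF monomial_in_span monomial_in_span] neg)
  ultimately show "laplacian (zmonomial c i j) v = zmonomial (4 * c * of_nat i * of_nat j) (i - 1) (j - 1) v"
    unfolding laplacian_def by (simp only: mult_minus_left minus_mult_left[symmetric]) (simp add: mult_ac)
qed

lemma laplacian_zero: "laplacian (\<lambda>v. 0) = (\<lambda>v. 0)"
  using laplacian_zmonomial[of 0 0 0] by simp

lemma laplacian_iterate_in_span:
  "q \<in> monomial_span coord_z coord_zbar \<Longrightarrow> (laplacian ^^ n) q \<in> monomial_span coord_z coord_zbar"
  by (induction n) (auto intro: laplacian_in_span)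

lemma laplacian_iterate_add:
  assumes "q \<in> monomial_span coord_z coord_zbar" "r \<in> monomial_span coord_z coord_zbar"
  shows "(laplacian ^^ n) (\<lambda>v. q v + r v) = (\<lambda>v. (laplacian ^^ n) q v + (laplacian ^^ n) r v)"
  by (induction n) (simp_all add: laplacian_add laplacian_iterate_in_span assms)

text \<open>Each application lowers both exponents of a monomial by one. The claim is made for all
  \<open>n \<ge> m\<close>, so that the thresholds of two summands combine by taking the
  maximum.\<close>

lemma laplacian_nilpotent:
  assumes "q \<in> monomial_span coord_z coord_zbar"
  shows "\<exists>m. \<forall>n\<ge>m. (laplacian ^^ n) q = (\<lambda>v. 0)"
  using assms
proof induction
  case zero
  have "(laplacian ^^ n) (\<lambda>v. 0) = (\<lambda>v. 0)" for n by (induction n) (auto simp: laplacian_zero)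
  then show ?case by blast
next
  case (add_monomial q c i j)
  then obtain m where m: "\<And>n. n \<ge> m \<Longrightarrow> (laplacian ^^ n) q = (\<lambda>v. 0)" by blast
  \<comment> \<open>The truncated exponents stop at 0, so vanishing is recorded in the coefficient:
    passing from \<open>n = i\<close> to \<open>i + 1\<close> multiplies it by
    \<open>of_nat 0\<close>.\<close>
  have mono: "\<exists>d. (laplacian ^^ n) (zmonomial c i j) = zmonomial d (i - n) (j - n) \<and> (n > i \<longrightarrow> d = 0)" for n
  proof (induction n)
    case (Suc n)
    then obtain d where "(laplacian ^^ n) (zmonomial c i j) = zmonomial d (i - n) (j - n)" "n > i \<Longrightarrow> d = 0"
      by blast
    then show ?case
      by (intro exI[of _ "4 * d * of_nat (i - n) * of_nat (j - n)"]) (auto simp: laplacian_zmonomial)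
  qed auto
  have "(laplacian ^^ n) (\<lambda>v. q v + zmonomial c i j v) = (\<lambda>v. 0)" if n: "n \<ge> max m (Suc i)" for n
  proof -
    have "(laplacian ^^ n) (zmonomial c i j) = (\<lambda>v. 0)" using mono[of n] n by auto
    then show ?thesis
      using m[of n] n by (simp add: laplacian_iterate_add[OF add_monomial.hyps monomial_in_span])
  qed
  then show ?case by blast
qed

text \<open>The bound is uniform on a disk of radius \<open>R\<close> rather than in a norm, so the
  lemma is free of the domain of integration; \<open>R\<close> is later chosen to cover it. The
  sequence \<open>b\<close> is part of the induction because orbits and bounds of summands simply
  add up.\<close>

lemma laplacian_backward_orbit:
  assumes "q \<in> monomial_span coord_z coord_zbar" "0 \<le> R"
  shows "\<exists>u b. u 0 = q \<and> (\<forall>n. u n \<in> monomial_span coord_z coord_zbar) \<and>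
    (\<forall>n. laplacian (u (Suc n)) = u n) \<and>
    (\<forall>n v. norm (coord_z v) \<le> R \<longrightarrow> norm (u n v) \<le> b n) \<and> (\<forall>C::real. (\<lambda>n. C ^ n * b n) \<longlonglongrightarrow> 0)"
  using assms(1)
proof induction
  case zero
  then show ?case
    by (intro exI[of _ "\<lambda>_ _. 0"] exI[of _ "\<lambda>_. 0"]) (auto intro: monomial_span.zero simp: laplacian_zero)
next
  case (add_monomial q c i j)
  then obtain u b where u: "u 0 = q" "\<And>n. u n \<in> monomial_span coord_z coord_zbar"
    "\<And>n. laplacian (u (Suc n)) = u n" "\<And>n v. norm (coord_z v) \<le> R \<Longrightarrow> norm (u n v) \<le> b n"
    "\<And>C. (\<lambda>n. C ^ n * b n) \<longlonglongrightarrow> 0" by blast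
  \<comment> \<open>Closed form of the coefficient after \<open>n\<close> steps of
    \<open>z^i w^j \<mapsto> z^(i+1) w^(j+1) / (4 (i+1) (j+1))\<close>.\<close>
  define d :: "nat \<Rightarrow> complex" where "d n = c * (fact i * fact j / (4 ^ n * fact (i + n) * fact (j + n)))" for n
  have d_Suc: "4 * d (Suc n) * of_nat (i + Suc n) * of_nat (j + Suc n) = d n" for n
  proof -
    have "of_nat (i + Suc n) \<noteq> (0::complex)" "of_nat (j + Suc n) \<noteq> (0::complex)"
      by (simp_all only: of_nat_eq_0_iff)
    then show ?thesis
      by (simp add: d_def divide_simps del: of_nat_Suc of_nat_add)
  qed
  \<comment> \<open>Of the denominator of \<open>d n\<close> only
    \<open>fact n \<le> fact (i + n)\<close> is kept, the other factors being at least 1. The two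
    powers of the radius contribute \<open>R ^ (i + n) * R ^ (j + n)\<close>.\<close>
  define b' where "b' n = norm c * fact i * fact j * R ^ (i + j) * ((R\<^sup>2) ^ n / fact n)" for n
  have bound: "norm (zmonomial (d n) (i + n) (j + n) v) \<le> b' n" if v: "norm (coord_z v) \<le> R" for n v
  proof -
    have "norm (d n) \<le> norm c * (fact i * fact j / fact n)"
    proof -
      have "fact n \<le> (fact (i + n) :: real)" by (intro fact_mono) auto
      moreover have "1 \<le> (fact (j + n) :: real)" "1 \<le> (4::real) ^ n" by (auto simp: fact_ge_1)
      ultimately have "1 * fact n * 1 \<le> (4::real) ^ n * fact (i + n) * fact (j + n)"
        by (intro mult_mono) auto
      then have "fact i * fact j / ((4::real) ^ n * fact (i + n) * fact (j + n)) \<le> fact i * fact j / fact n"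
        by (intro divide_left_mono) auto
      then have "norm c * (fact i * fact j / ((4::real) ^ n * fact (i + n) * fact (j + n)))
          \<le> norm c * (fact i * fact j / fact n)"
        by (rule mult_left_mono) simp
      then show ?thesis by (simp add: d_def norm_mult norm_divide norm_power)
    qed
    moreover have "norm (coord_zbar v) = norm (coord_z v)"
      by (simp add: coord_z_def coord_zbar_def cmod_def)
    then have "norm (coord_z v) ^ (i + n) * norm (coord_zbar v) ^ (j + n) \<le> R ^ (i + n) * R ^ (j + n)"
      using v assms(2) by (intro mult_mono power_mono) auto
    ultimately have "norm (d n) * (norm (coord_z v) ^ (i + n) * norm (coord_zbar v) ^ (j + n))
        \<le> norm c * (fact i * fact j / fact n) * (R ^ (i + n) * R ^ (j + n))"
      by (rule mult_mono) auto
    also have "\<dots> = b' n"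
      by (simp add: b'_def power_add power2_eq_square power_mult_distrib)
    finally show ?thesis by (simp add: norm_mult norm_power mult.assoc)
  qed
  have lim: "(\<lambda>n. C ^ n * b' n) \<longlonglongrightarrow> 0" for C
  proof -
    have "(\<lambda>n. inverse (fact n) * (C * R\<^sup>2) ^ n) \<longlonglongrightarrow> 0"
      by (rule summable_LIMSEQ_zero[OF summable_exp])
    then have "(\<lambda>n. norm c * fact i * fact j * R ^ (i + j) * (inverse (fact n) * (C * R\<^sup>2) ^ n)) \<longlonglongrightarrow> 0"
      by (rule tendsto_mult_right_zero)
    then show ?thesis by (simp add: b'_def power_mult_distrib field_simps)
  qed
  show ?case
  proof (intro exI conjI allI impI)
    let ?u = "\<lambda>n v. u n v + zmonomial (d n) (i + n) (j + n) v"
    show "?u 0 = (\<lambda>v. q v + zmonomial c i j v)" by (simp add: u(1) d_def)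
    fix n
    show "?u n \<in> monomial_span coord_z coord_zbar" by (intro span_add u(2) monomial_in_span)
    show "laplacian (?u (Suc n)) = ?u n"
      unfolding laplacian_add[OF u(2) monomial_in_span] u(3) laplacian_zmonomial d_Suc by simp
    show "norm (?u n v) \<le> b n + b' n" if "norm (coord_z v) \<le> R" for v
      using norm_triangle_ineq add_mono[OF u(4)[OF that, of n] bound[OF that, of n]] by (rule order_trans)
    show "(\<lambda>n. C ^ n * (b n + b' n)) \<longlonglongrightarrow> 0" for C
      using tendsto_add_zero[OF u(5) lim] by (simp add: distrib_left)
  qed
qed

lemma continuous_on_span:
  assumes "q \<in> monomial_span coord_z coord_zbar"
  shows "continuous_on S q"
  using assms
  by induction (auto simp: coord_z_def coord_zbar_def intro!: continuous_intros)

section \<open>Polynomials as elements of \<open>L\<^sup>2(\<Omega>)\<close>\<close>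

context
  fixes \<Omega> :: "(real \<times> real) set"
  assumes open_\<Omega>: "open \<Omega>" and bounded_\<Omega>: "bounded \<Omega>"
begin

lemma measurable_span:
  assumes "q \<in> monomial_span coord_z coord_zbar"
  shows "q \<in> borel_measurable (lebesgue_on \<Omega>)"
  using open_\<Omega> by (intro continuous_imp_measurable_on_sets_lebesgue continuous_on_span assms) auto

text \<open>A bounded set has finite measure. The norm of the constant 1 is the factor that turns
  uniform bounds on polynomials into \<open>L\<^sup>2\<close> bounds.\<close>

lemma L2_one: "Lp_fun 2 (lebesgue_on \<Omega>) (\<lambda>v. 1::real)"
proof -
  have "emeasure lebesgue \<Omega> < \<infinity>" using bounded_\<Omega> open_\<Omega> emeasure_bounded_finite by auto
  then have "finite_measure (lebesgue_on \<Omega>)"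
    using open_\<Omega> by (intro finite_measureI) (auto simp: emeasure_restrict_space)
  then show ?thesis by (simp add: Lp_fun_def finite_measure.integrable_const)
qed

lemma
  assumes "q \<in> monomial_span coord_z coord_zbar" "\<And>v. v \<in> \<Omega> \<Longrightarrow> norm (q v) \<le> B" "0 \<le> B"
  shows L2_span_bounded: "Lp_fun 2 (lebesgue_on \<Omega>) q"
    and L2_norm_span_le: "Lp_norm 2 (lebesgue_on \<Omega>) q \<le> B * Lp_norm 2 (lebesgue_on \<Omega>) (\<lambda>v. 1::real)"
proof -
  have ae: "AE v in lebesgue_on \<Omega>. norm (q v) \<le> B * norm (1::real)"
    using assms(2) by (intro AE_I2) simp
  show "Lp_fun 2 (lebesgue_on \<Omega>) q"
    by (rule Lp_fun_bound[OF L2_one measurable_span[OF assms(1)] _ ae]) simp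
  show "Lp_norm 2 (lebesgue_on \<Omega>) q \<le> B * Lp_norm 2 (lebesgue_on \<Omega>) (\<lambda>v. 1::real)"
    by (rule Lp_norm_bound[OF L2_one measurable_span[OF assms(1)] _ assms(3) ae]) simp
qed

lemma \<Omega>_radius: "\<exists>R\<ge>0. \<forall>v\<in>\<Omega>. norm (coord_z v) \<le> R"
proof -
  obtain R where R: "\<And>v. v \<in> \<Omega> \<Longrightarrow> norm v \<le> R" using bounded_\<Omega> by (auto simp: bounded_iff)
  have "norm (coord_z v) = norm v" for v by (cases v) (simp add: coord_z_def cmod_def norm_Pair)
  \<comment> \<open>The set may still be empty here, and then the bound \<open>R\<close> could be
    negative.\<close>
  then show ?thesis using R by (intro exI[of _ "max 0 R"]) (auto simp: le_max_iff_disj)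
qed

text \<open>Boundedness of a polynomial on \<open>\<Omega>\<close> is read off its backward orbit at
  index 0, where the orbit is the polynomial itself.\<close>

lemma L2_span:
  assumes "q \<in> monomial_span coord_z coord_zbar"
  shows "Lp_fun 2 (lebesgue_on \<Omega>) q"
proof -
  obtain R where R: "R \<ge> 0" "\<And>v. v \<in> \<Omega> \<Longrightarrow> norm (coord_z v) \<le> R" using \<Omega>_radius by blast
  from laplacian_backward_orbit[OF assms R(1)]
  obtain u b where u: "u 0 = q" "\<forall>n. u n \<in> monomial_span coord_z coord_zbar"
    "\<forall>n. laplacian (u (Suc n)) = u n" "\<forall>n v. norm (coord_z v) \<le> R \<longrightarrow> norm (u n v) \<le> b n"
    "\<forall>C::real. (\<lambda>n. C ^ n * b n) \<longlonglongrightarrow> 0"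
    by (elim exE conjE)
  have "norm (q v) \<le> max 0 (b 0)" if "v \<in> \<Omega>" for v
    using u(4)[rule_format, of v 0] R(2)[OF that] u(1) by simp
  then show ?thesis by (rule L2_span_bounded[OF assms]) auto
qed

lemma L2_polynomials_eq:
  "L2_polynomials \<Omega> = ae_class (lebesgue_on \<Omega>) ` monomial_span coord_z coord_zbar"
  unfolding L2_polynomials_def bivariate_polynomial_iff
  using L2_span by (auto simp: ae_class_in_Lp_iff measurable_span)

text \<open>On classes of polynomials \<open>\<Delta>\<close> is determined by
  \<open>laplacian\<close>, whatever its full domain is, so nilpotency and backward orbits carry
  over from polynomials to their classes.\<close>

proposition laplacian_unbounded_hypermixing:
  fixes X :: "(complex, (real \<times> real \<Rightarrow> complex) set) normed_sp"
  defines "X \<equiv> Lp_space 2 (lebesgue_on \<Omega>)"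
  assumes nonempty: "\<Omega> \<noteq> {}" and \<Delta>: "is_L2_Laplacian \<Omega> \<Delta>"
  shows "unbounded_operator X \<Delta> \<and> hypermixing X \<Delta> (L2_polynomials \<Omega>)"
proof -
  let ?M = "lebesgue_on \<Omega>"
  let ?P = "monomial_span coord_z coord_zbar"
  interpret normed_sp_laws X unfolding X_def by (rule normed_sp_laws_Lp) simp
  have T: "linear_operator X \<Delta>" and dom: "L2_polynomials \<Omega> \<subseteq> op_dom \<Delta>"
    and app: "\<And>q. q \<in> ?P \<Longrightarrow> op_app \<Delta> (ae_class ?M q) = ae_class ?M (laplacian q)"
    using \<Delta> by (auto simp: is_L2_Laplacian_def X_def bivariate_polynomial_iff)
  have app_iterate: "(op_app \<Delta> ^^ n) (ae_class ?M q) = ae_class ?M ((laplacian ^^ n) q)" if "q \<in> ?P" for q n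
    using that by (induction n) (auto simp: app laplacian_iterate_in_span)
  have Y: "dynamical_domain X \<Delta> (L2_polynomials \<Omega>)"
  proof (rule dynamical_domain_invariant[OF T _ dom])
    show "linear_subspace X (L2_polynomials \<Omega>)"
      unfolding linear_subspace_def
    proof (intro conjI ballI allI)
      show "L2_polynomials \<Omega> \<subseteq> carr X" by (auto simp: L2_polynomials_def X_def)
      show "vzero X \<in> L2_polynomials \<Omega>"
        unfolding X_def vzero_Lp L2_polynomials_eq by (intro imageI zero)
    next
      fix F c assume "F \<in> L2_polynomials \<Omega>"
      then obtain q where q: "q \<in> ?P" "F = ae_class ?M q" by (auto simp: L2_polynomials_eq)
      show "vscale X c F \<in> L2_polynomials \<Omega>"
        unfolding X_def q(2) vscale_ae_class[OF measurable_span[OF q(1)]] L2_polynomials_eq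
        by (intro imageI span_mult span_const q(1))
      fix G assume "G \<in> L2_polynomials \<Omega>"
      then obtain r where r: "r \<in> ?P" "G = ae_class ?M r" by (auto simp: L2_polynomials_eq)
      show "vadd X F G \<in> L2_polynomials \<Omega>"
        unfolding X_def q(2) r(2) vadd_ae_class[OF measurable_span[OF q(1)] measurable_span[OF r(1)]] L2_polynomials_eq
        by (intro imageI span_add q(1) r(1))
    qed
    show "op_app \<Delta> ` L2_polynomials \<Omega> \<subseteq> L2_polynomials \<Omega>"
      by (auto simp: L2_polynomials_eq app laplacian_in_span)
  qed
  show ?thesis
  proof (rule unbounded_hypermixing_criterion[OF T Y])
    \<comment> \<open>A nonempty open set is not a null set, so the constant 1 represents a nonzero
      class.\<close>
    have "ae_class ?M (\<lambda>v. 1::complex) \<noteq> vzero X"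
    proof
      assume "ae_class ?M (\<lambda>v. 1::complex) = vzero X"
      then have "AE v in ?M. (1::complex) = 0" by (simp add: X_def vzero_Lp ae_class_eq_iff)
      then have "AE v in lebesgue. v \<notin> \<Omega>" using open_\<Omega> by (simp add: AE_restrict_space_iff)
      then have "emeasure lebesgue \<Omega> = 0" using open_\<Omega> by (subst (asm) AE_iff_measurable[OF _ refl]) auto
      then show False using open_\<Omega> nonempty open_not_negligible[of \<Omega>]
        by (simp add: negligible_iff_emeasure0)
    qed
    then show "L2_polynomials \<Omega> \<noteq> {vzero X}" unfolding L2_polynomials_eq using span_const by blast
  next
    fix F and e :: real assume F: "F \<in> L2_polynomials \<Omega>" and e: "0 < e"
    obtain q where q: "q \<in> ?P" "F = ae_class ?M q" using F by (auto simp: L2_polynomials_eq)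
    obtain m where "(laplacian ^^ m) q = (\<lambda>v. 0)" using laplacian_nilpotent[OF q(1)] by blast
    then have "(op_app \<Delta> ^^ m) F = vzero X" using q by (simp add: app_iterate X_def vzero_Lp)
    \<comment> \<open>No approximation takes place: every polynomial is itself annihilated by a
      power of the Laplacian.\<close>
    moreover have "vdist X F F < e"
      using F e Y add_minus norm_zero by (auto simp: vdist_eq dynamical_domain_def linear_subspace_def subset_iff)
    ultimately show "\<exists>d\<in>L2_polynomials \<Omega>. \<exists>m. vdist X F d < e \<and> (op_app \<Delta> ^^ m) d = vzero X"
      using F by blast
  next
    fix F assume "F \<in> L2_polynomials \<Omega>"
    then obtain q where q: "q \<in> ?P" "F = ae_class ?M q" by (auto simp: L2_polynomials_eq)
    obtain R where R: "R \<ge> 0" "\<And>v. v \<in> \<Omega> \<Longrightarrow> norm (coord_z v) \<le> R" using \<Omega>_radius by blast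
    from laplacian_backward_orbit[OF q(1) R(1)]
    obtain u b where u: "u 0 = q" "\<forall>n. u n \<in> ?P" "\<forall>n. laplacian (u (Suc n)) = u n"
      "\<forall>n v. norm (coord_z v) \<le> R \<longrightarrow> norm (u n v) \<le> b n" "\<forall>C::real. (\<lambda>n. C ^ n * b n) \<longlonglongrightarrow> 0"
      by (elim exE conjE)
    note u = u(1) u(2-5)[rule_format]
    \<comment> \<open>A point of \<open>\<Omega>\<close> shows that the bounds \<open>b n\<close>
      are nonnegative, as the norm estimate requires.\<close>
    obtain v0 where "v0 \<in> \<Omega>" using nonempty by blast
    then have "b n \<ge> 0" for n by (rule order_trans[OF norm_ge_zero u(4)[OF R(2)]])
    then have norm_le: "vnorm X (ae_class ?M (u n)) \<le> b n * Lp_norm 2 ?M (\<lambda>v. 1::real)" for n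
      unfolding X_def vnorm_ae_class[OF measurable_span[OF u(2)]]
      using R(2) u(4) by (intro L2_norm_span_le u(2)) auto
    have "(\<lambda>n. C ^ n * vnorm X (ae_class ?M (u n))) \<longlonglongrightarrow> 0" for C
    proof (rule Lim_null_comparison)
      have "0 \<le> vnorm X (ae_class ?M (u n))" for n
        unfolding X_def vnorm_ae_class[OF measurable_span[OF u(2)]] by (rule Lp_norm_nonneg)
      then show "\<forall>\<^sub>F n in sequentially. norm (C ^ n * vnorm X (ae_class ?M (u n)))
          \<le> \<bar>C\<bar> ^ n * b n * Lp_norm 2 ?M (\<lambda>v. 1::real)"
        using norm_le by (intro always_eventually allI)
          (simp add: abs_mult power_abs mult.assoc mult_left_mono)
      show "(\<lambda>n. \<bar>C\<bar> ^ n * b n * Lp_norm 2 ?M (\<lambda>v. 1::real)) \<longlonglongrightarrow> 0"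
        by (intro tendsto_mult_left_zero u(5))
    qed
    then show "\<exists>u. u 0 = F \<and> (\<forall>n. u n \<in> L2_polynomials \<Omega>) \<and> (\<forall>n. op_app \<Delta> (u (Suc n)) = u n) \<and>
        (\<forall>C. (\<lambda>n. C ^ n * vnorm X (u n)) \<longlonglongrightarrow> 0)"
      using u(1,2,3) q app
      by (intro exI[of _ "\<lambda>n. ae_class ?M (u n)"]) (auto simp: L2_polynomials_eq)
  qed
qed

end

section \<open>Weighted left translations\<close>

text \<open>Closed form of the \<open>n\<close>-th iterate: the exponent is the sum of
  \<open>t + k a\<close> over \<open>k < n\<close>. Writing \<open>real n - 1\<close> instead of a
  truncated difference keeps the formula uniform at \<open>n = 0\<close>.\<close>

definition translation_power ::
    "real \<Rightarrow> real \<Rightarrow> nat \<Rightarrow> (real \<Rightarrow> 'k::real_vector) \<Rightarrow> real \<Rightarrow> 'k" where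
  "translation_power w a n f t =
     w powr (real n * t + (real n - 1) * real n * a / 2) *\<^sub>R f (t + real n * a)"

text \<open>The \<open>n\<close>-th iterate of
  \<open>g \<mapsto> (\<lambda>t. w powr (a - t) *\<^sub>R g (t - a))\<close>, a right inverse of
  the translation. It evaluates \<open>f\<close> at negative arguments, so an extension of
  \<open>f\<close> to the whole line must be chosen before it is applied.\<close>

definition translation_inverse_power ::
    "real \<Rightarrow> real \<Rightarrow> nat \<Rightarrow> (real \<Rightarrow> 'k::real_vector) \<Rightarrow> real \<Rightarrow> 'k" where
  "translation_inverse_power w a n f t =
     w powr (real n * (real n + 1) * a / 2 - real n * t) *\<^sub>R f (t - real n * a)"

lemma translation_power_0: "0 < w \<Longrightarrow> translation_power w a 0 f = f"
  by (auto simp: translation_power_def)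

lemma translation_power_Suc:
  assumes "0 < w"
  shows "translation_power w a (Suc n) f t = w powr t *\<^sub>R translation_power w a n f (t + a)"
proof -
  have "real (Suc n) * t + (real (Suc n) - 1) * real (Suc n) * a / 2
      = t + (real n * (t + a) + (real n - 1) * real n * a / 2)"
    by (simp add: field_simps)
  moreover have "t + real (Suc n) * a = t + a + real n * a" by (simp add: field_simps)
  ultimately show ?thesis by (simp only: translation_power_def powr_add scaleR_scaleR)
qed

lemma translation_inverse_power_0: "0 < w \<Longrightarrow> translation_inverse_power w a 0 f = f"
  by (auto simp: translation_inverse_power_def)

lemma translation_inverse_power_Suc:
  assumes "0 < w"
  shows "w powr t *\<^sub>R translation_inverse_power w a (Suc n) f (t + a) = translation_inverse_power w a n f t"
proof -
  have "real n * (real n + 1) * a / 2 - real n * t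
     = t + (real (Suc n) * (real (Suc n) + 1) * a / 2 - real (Suc n) * (t + a))"
    by (simp add: field_simps)
  moreover have "t + a - real (Suc n) * a = t - real n * a" by (simp add: field_simps)
  ultimately show ?thesis by (simp only: translation_inverse_power_def powr_add scaleR_scaleR)
qed

text \<open>The weight \<open>w powr t\<close> is at least 1 for \<open>t \<ge> 0\<close>. This is
  what makes the condition for one power imply the condition for the preceding power, so that the
  explicit domains need a single condition each.\<close>

lemma norm_translation_power_le_Suc:
  fixes f :: "real \<Rightarrow> 'k::real_normed_vector"
  assumes "1 < w" "0 \<le> t"
  shows "norm (translation_power w a n f (t + a)) \<le> norm (translation_power w a (Suc n) f t)"
proof -
  have "1 \<le> w powr t" using assms by (simp add: ge_one_powr_ge_zero)
  then show ?thesis using assms by (simp add: translation_power_Suc mult_le_cancel_right1)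
qed

text \<open>Only \<open>t \<ge> (n - 1) a\<close> matters, as otherwise \<open>f\<close> is
  evaluated left of \<open>-a\<close>. There the exponent is at most
  \<open>n (n + 1) a / 2 - n (n - 1) a = - n (n - 3) a / 2\<close>. Allowing support down to
  \<open>-a\<close> leaves room for a continuous extension.\<close>

lemma norm_translation_inverse_power_le:
  fixes f :: "real \<Rightarrow> 'k::real_normed_vector"
  assumes "1 < w" "0 < a" and supp: "\<And>s. s < - a \<Longrightarrow> f s = 0"
  shows "norm (translation_inverse_power w a n f t)
    \<le> w powr (- (real n * (real n - 3) * a / 2)) * norm (f (t - real n * a))"
proof (cases "t < (real n - 1) * a")
  case True
  then have "t - real n * a < - a" by (simp add: algebra_simps)
  then show ?thesis using supp by (simp add: translation_inverse_power_def)
next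
  case False
  then have "real n * ((real n - 1) * a) \<le> real n * t" by (intro mult_left_mono) auto
  then have "real n * (real n + 1) * a / 2 - real n * t \<le> - (real n * (real n - 3) * a / 2)"
    by (simp add: field_simps)
  then have "w powr (real n * (real n + 1) * a / 2 - real n * t) \<le> w powr (- (real n * (real n - 3) * a / 2))"
    using assms by (intro powr_mono) auto
  then show ?thesis by (simp add: translation_inverse_power_def mult_right_mono)
qed

lemma power_times_gaussian_tendsto_0:
  fixes w a C :: real
  assumes "1 < w" "0 < a"
  shows "(\<lambda>n. C ^ n * w powr (- (real n * (real n - 3) * a / 2))) \<longlonglongrightarrow> 0"
proof -
  \<comment> \<open>The \<open>n\<close>-th root of the modulus of the \<open>n\<close>-th term. It
    tends to 0, so the terms are eventually dominated by powers of \<open>1/2\<close>.\<close>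
  define b where "b n = \<bar>C\<bar> * w powr (- ((real n - 3) * a / 2))" for n :: nat
  have eq: "\<bar>C\<bar> ^ n * w powr (- (real n * (real n - 3) * a / 2)) = b n ^ n" for n
    using assms by (simp add: b_def power_mult_distrib powr_power mult_ac)
  have "b \<longlonglongrightarrow> 0" unfolding b_def using assms by real_asymp
  then have "eventually (\<lambda>n. b n < 1 / 2) sequentially" by (rule order_tendstoD) simp
  then have "eventually (\<lambda>n. norm (C ^ n * w powr (- (real n * (real n - 3) * a / 2))) \<le> (1/2) ^ n) sequentially"
  proof eventually_elim
    case (elim n)
    have "b n ^ n \<le> (1/2) ^ n" using elim assms by (intro power_mono) (auto simp: b_def)
    then show ?case by (simp add: abs_mult power_abs eq)
  qed
  moreover have "(\<lambda>n. (1/2 :: real) ^ n) \<longlonglongrightarrow> 0" by (rule LIMSEQ_power_zero) simp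
  ultimately show ?thesis by (rule Lim_null_comparison)
qed

section \<open>The space \<open>C\<^sub>0[0,\<infinity>)\<close>\<close>

lemma C0_carr_iff: "f \<in> carr C0_space \<longleftrightarrow>
    f \<in> extensional {0..} \<and> continuous_on {0..} f \<and> (f \<longlongrightarrow> 0) at_top"
  by (simp add: C0_space_def)

lemma restrict_in_C0_iff: "restrict f {0..} \<in> carr C0_space \<longleftrightarrow>
    continuous_on {0..} f \<and> (f \<longlongrightarrow> 0) at_top"
proof -
  have "continuous_on {0..} (restrict f {0..}) \<longleftrightarrow> continuous_on {0..} f"
    by (intro continuous_on_cong) auto
  moreover have "eventually (\<lambda>t. restrict f {0..} t = f t) at_top"
    using eventually_ge_at_top[of 0] by eventually_elim simp
  then have "(restrict f {0..} \<longlongrightarrow> 0) at_top \<longleftrightarrow> (f \<longlongrightarrow> 0) at_top" by (rule tendsto_cong)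
  ultimately show ?thesis by (simp add: C0_carr_iff)
qed

lemma C0_norm_le:
  assumes "\<And>t. 0 \<le> t \<Longrightarrow> norm (f t) \<le> B"
  shows "vnorm C0_space f \<le> B"
  unfolding C0_space_def using assms by (auto intro!: cSUP_least)

text \<open>The norm is a real supremum and is meaningful only for bounded functions: the tail is
  below 1, and the rest lies over a compact interval.\<close>

lemma C0_bounded:
  assumes "f \<in> carr C0_space"
  shows "bdd_above ((\<lambda>t. norm (f t)) ` {0..})"
proof -
  have f: "continuous_on {0..} f" "(f \<longlongrightarrow> 0) at_top" using assms by (auto simp: C0_carr_iff)
  have "eventually (\<lambda>t. norm (f t) < 1) at_top"
    using f(2) order_tendstoD(2)[OF tendsto_norm_zero] by fastforce
  then obtain R where R: "\<And>t. t \<ge> R \<Longrightarrow> norm (f t) < 1" by (auto simp: eventually_at_top_linorder)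
  have "compact (f ` {0..R})"
    using f(1) by (intro compact_continuous_image) (auto intro: continuous_on_subset)
  then obtain B where B: "\<And>t. t \<in> {0..R} \<Longrightarrow> norm (f t) \<le> B"
    using compact_imp_bounded by (fastforce simp: bounded_iff)
  have "norm (f t) \<le> max 1 B" if "0 \<le> t" for t
    using R[of t] B[of t] that by (cases "t \<le> R") (auto simp: max_def not_le intro: less_imp_le)
  then show ?thesis by (intro bdd_aboveI2[of _ _ "max 1 B"]) auto
qed

lemma C0_norm_ge:
  assumes "f \<in> carr C0_space" "0 \<le> t"
  shows "norm (f t) \<le> vnorm C0_space f"
  unfolding C0_space_def using cSUP_upper[OF _ C0_bounded[OF assms(1)], of t] assms(2) by simp

lemma C0_ops:
  "vzero C0_space = (\<lambda>t\<in>{0..}. 0)"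
  "vadd C0_space f g = (\<lambda>t\<in>{0..}. f t + g t)"
  "vscale C0_space c f = (\<lambda>t\<in>{0..}. c * f t)"
  by (simp_all add: C0_space_def)

lemma normed_sp_laws_C0:
  "normed_sp_laws (C0_space :: ('k::{real_normed_field,euclidean_space}, real \<Rightarrow> 'k) normed_sp)"
    (is "normed_sp_laws ?X")
proof -
  note [simp] = C0_ops
  have ext: "restrict f {0..} = f" if "f \<in> carr ?X" for f :: "real \<Rightarrow> 'k"
    using that by (auto simp: C0_carr_iff extensional_restrict)
  show ?thesis
  proof
    show z: "vzero ?X \<in> carr ?X" by (simp add: restrict_in_C0_iff)
    show "vnorm ?X (vzero ?X) = 0"
      using C0_norm_ge[OF z, of 0] by (intro antisym C0_norm_le) simp_all
  next
    fix x assume x: "x \<in> carr ?X"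
    then have lim: "continuous_on {0..} x" "(x \<longlongrightarrow> 0) at_top" by (auto simp: C0_carr_iff)
    have "vadd ?X (vzero ?X) x = restrict x {0..}" "vscale ?X 1 x = restrict x {0..}" by auto
    then show "vadd ?X (vzero ?X) x = x" "vscale ?X 1 x = x"
      unfolding ext[OF x] .
    show "vscale ?X 0 x = vzero ?X" by simp
    show "0 \<le> vnorm ?X x" using C0_norm_ge[OF x, of 0] norm_ge_zero by (rule order_trans[rotated]) auto
    show "vscale ?X c x \<in> carr ?X" for c
      using lim by (auto simp: restrict_in_C0_iff intro!: continuous_intros tendsto_mult_right_zero)
    show "vscale ?X c (vscale ?X d x) = vscale ?X (c * d) x" for c d
      by (auto simp: mult.assoc)
    show "vscale ?X (c + d) x = vadd ?X (vscale ?X c x) (vscale ?X d x)" for c d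
      by (auto simp: distrib_right)
    show "x = vzero ?X" if "vnorm ?X x = 0"
    proof -
      have "x t = 0" if "0 \<le> t" for t using C0_norm_ge[OF x that] \<open>vnorm ?X x = 0\<close> by simp
      then have "restrict x {0..} = vzero ?X" by (auto simp: fun_eq_iff)
      then show ?thesis using ext[OF x] by simp
    qed
    show "vnorm ?X (vscale ?X (-1) x) = vnorm ?X x"
      by (simp add: C0_space_def cong: image_cong_simp)
    fix y assume y: "y \<in> carr ?X"
    then have lim_y: "continuous_on {0..} y" "(y \<longlongrightarrow> 0) at_top" by (auto simp: C0_carr_iff)
    show "vadd ?X x y \<in> carr ?X"
      using lim lim_y by (auto simp: restrict_in_C0_iff intro!: continuous_intros tendsto_add_zero)
    show "vadd ?X x y = vadd ?X y x" by (simp add: add.commute)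
    show "vscale ?X c (vadd ?X x y) = vadd ?X (vscale ?X c x) (vscale ?X c y)" for c
      by (auto simp: distrib_left)
    show "vnorm ?X (vadd ?X x y) \<le> vnorm ?X x + vnorm ?X y"
      using C0_norm_ge[OF x] C0_norm_ge[OF y]
      by (intro C0_norm_le) (auto intro: order_trans[OF norm_triangle_ineq] add_mono)
    fix z assume "z \<in> carr ?X"
    show "vadd ?X (vadd ?X x y) z = vadd ?X x (vadd ?X y z)" by (auto simp: add.assoc)
  qed
qed

section \<open>The translation in \<open>C\<^sub>0\<close>: domains of powers, cutoffs, backward
  orbits\<close>

context
  fixes w a :: real
  assumes w: "1 < w" and a: "0 < a"
begin

lemma C0_translation_app:
  "op_app (C0_translation w a) f = (\<lambda>t\<in>{0..}. w powr t *\<^sub>R f (t + a))"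
  by (simp add: C0_translation_def)

lemma C0_translation_dom_iff:
  "f \<in> op_dom (C0_translation w a) \<longleftrightarrow>
     f \<in> carr C0_space \<and> ((\<lambda>t. w powr t *\<^sub>R f (t + a)) \<longlongrightarrow> 0) at_top"
  by (simp add: C0_translation_def)

lemma continuous_on_shift:
  fixes f :: "real \<Rightarrow> 'k::real_normed_vector"
  assumes "continuous_on {0..} f" "0 \<le> b"
  shows "continuous_on {0..} (\<lambda>t. f (t + b))"
  by (rule continuous_on_compose2[OF assms(1)]) (use assms(2) in \<open>auto intro!: continuous_intros\<close>)

lemma linear_operator_C0_translation:
  "linear_operator C0_space (C0_translation w a ::
     (real \<Rightarrow> 'k::{real_normed_field,euclidean_space}) partial_op)"
proof -
  interpret X: normed_sp_laws "C0_space :: ('k, real \<Rightarrow> 'k) normed_sp" by (rule normed_sp_laws_C0)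
  have shift: "((\<lambda>t. w powr t *\<^sub>R restrict f {0..} (t + a)) \<longlongrightarrow> 0) at_top \<longleftrightarrow>
      ((\<lambda>t. w powr t *\<^sub>R f (t + a)) \<longlongrightarrow> 0) at_top" for f :: "real \<Rightarrow> 'k"
    using a by (intro tendsto_cong eventually_mono[OF eventually_ge_at_top[of 0]]) auto
  show ?thesis
    unfolding linear_operator_def linear_subspace_def
  proof (intro conjI ballI allI)
    show "op_dom (C0_translation w a) \<subseteq> carr (C0_space :: ('k, real \<Rightarrow> 'k) normed_sp)"
      by (auto simp: C0_translation_dom_iff)
    show "vzero (C0_space :: ('k, real \<Rightarrow> 'k) normed_sp) \<in> op_dom (C0_translation w a)"
      using X.zero_mem by (simp add: C0_translation_dom_iff C0_ops shift del: restrict_apply)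
  next
    fix x y :: "real \<Rightarrow> 'k" and c :: 'k
    assume x: "x \<in> op_dom (C0_translation w a)"
    show "vscale C0_space c x \<in> op_dom (C0_translation w a)"
      using x X.scale_mem[of x c] tendsto_mult_right_zero[of "\<lambda>t. w powr t *\<^sub>R x (t + a)" at_top c]
      by (simp add: C0_translation_dom_iff C0_ops shift del: restrict_apply)
    show "op_app (C0_translation w a) x \<in> carr C0_space"
    proof -
      have "continuous_on {0..} (\<lambda>t. w powr t *\<^sub>R x (t + a))"
        using x a w continuous_on_shift[of x a]
        by (auto simp: C0_translation_dom_iff C0_carr_iff intro!: continuous_intros)
      then show ?thesis
        using x by (simp add: C0_translation_dom_iff C0_translation_app restrict_in_C0_iff)
    qed
    show "op_app (C0_translation w a) (vscale C0_space c x) = vscale C0_space c (op_app (C0_translation w a) x)"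
      using a by (auto simp: C0_translation_app C0_ops)
    assume y: "y \<in> op_dom (C0_translation w a)"
    show "vadd C0_space x y \<in> op_dom (C0_translation w a)"
      using x y X.add_mem[of x y]
        tendsto_add_zero[of "\<lambda>t. w powr t *\<^sub>R x (t + a)" at_top "\<lambda>t. w powr t *\<^sub>R y (t + a)"]
      by (simp add: C0_translation_dom_iff C0_ops shift scaleR_add_right del: restrict_apply)
    show "op_app (C0_translation w a) (vadd C0_space x y) =
        vadd C0_space (op_app (C0_translation w a) x) (op_app (C0_translation w a) y)"
      using a by (auto simp: C0_translation_app C0_ops scaleR_add_right)
  qed
qed

lemma C0_translation_iterate:
  assumes "f \<in> extensional {0..}"
  shows "(op_app (C0_translation w a) ^^ n) f = restrict (translation_power w a n f) {0..}"
proof (induction n)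
  case 0
  then show ?case using assms w by (auto simp: translation_power_0 extensional_def)
next
  case (Suc n)
  then show ?case
    using a w by (auto simp: C0_translation_app translation_power_Suc)
qed

text \<open>Comparison controls the \<open>n\<close>-th iterate at \<open>t + a\<close> only;
  substituting \<open>t - a\<close> for \<open>t\<close> recovers the limit itself.\<close>

lemma translation_power_tendsto_Suc_imp:
  fixes f :: "real \<Rightarrow> 'k::real_normed_vector"
  assumes "(translation_power w a (Suc n) f \<longlongrightarrow> 0) at_top"
  shows "(translation_power w a n f \<longlongrightarrow> 0) at_top"
proof -
  have "((\<lambda>t. translation_power w a n f (t + a)) \<longlongrightarrow> 0) at_top"
  proof (rule Lim_null_comparison)
    show "\<forall>\<^sub>F t in at_top. norm (translation_power w a n f (t + a)) \<le> norm (translation_power w a (Suc n) f t)"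
      using eventually_ge_at_top[of 0] by eventually_elim (rule norm_translation_power_le_Suc[OF w])
    show "((\<lambda>t. norm (translation_power w a (Suc n) f t)) \<longlongrightarrow> 0) at_top"
      using assms by (rule tendsto_norm_zero)
  qed
  moreover have "filterlim (\<lambda>t. t - a) at_top at_top" by real_asymp
  ultimately have "((\<lambda>t. translation_power w a n f (t - a + a)) \<longlongrightarrow> 0) at_top"
    by (rule filterlim_compose)
  then show ?thesis by simp
qed

text \<open>The recursive domain asks every earlier iterate to lie in the domain of the operator.
  Continuity of the iterates is automatic and their decay follows from that of the last one, so a
  single limit condition remains.\<close>

lemma power_dom_C0_translation:
  "power_dom C0_space (C0_translation w a) n =
     {f :: real \<Rightarrow> 'k::{real_normed_field,euclidean_space}.
        f \<in> carr C0_space \<and> (translation_power w a n f \<longlongrightarrow> 0) at_top}"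
proof (induction n)
  case 0
  then show ?case using w by (auto simp: translation_power_0 C0_carr_iff)
next
  case (Suc n)
  have "(op_app (C0_translation w a) ^^ n) f \<in> op_dom (C0_translation w a) \<longleftrightarrow>
      (translation_power w a (Suc n) f \<longlongrightarrow> 0) at_top" if f: "f \<in> carr C0_space" for f :: "real \<Rightarrow> 'k"
  proof -
    have "continuous_on {0..} (translation_power w a n f)"
      using f a w continuous_on_shift[of f "real n * a"]
      by (auto simp: translation_power_def[abs_def] C0_carr_iff intro!: continuous_intros)
    then have "restrict (translation_power w a n f) {0..} \<in> carr C0_space"
      if "(translation_power w a (Suc n) f \<longlongrightarrow> 0) at_top"
      using translation_power_tendsto_Suc_imp[OF that] by (simp add: restrict_in_C0_iff)
    moreover have "((\<lambda>t. w powr t *\<^sub>R restrict (translation_power w a n f) {0..} (t + a)) \<longlongrightarrow> 0) at_top \<longleftrightarrow>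
        (translation_power w a (Suc n) f \<longlongrightarrow> 0) at_top"
      using a w by (intro tendsto_cong eventually_mono[OF eventually_ge_at_top[of 0]])
        (auto simp: translation_power_Suc)
    ultimately show ?thesis
      using f by (auto simp: C0_translation_iterate C0_carr_iff C0_translation_dom_iff)
  qed
  then show ?case using Suc translation_power_tendsto_Suc_imp by auto
qed

lemma maximal_dynamical_domain_C0_iff:
  fixes f :: "real \<Rightarrow> 'k::{real_normed_field,euclidean_space}"
  shows "f \<in> maximal_dynamical_domain C0_space (C0_translation w a) \<longleftrightarrow>
    f \<in> carr C0_space \<and> (\<forall>n\<ge>1. (translation_power w a n f \<longlongrightarrow> 0) at_top)"
  unfolding maximal_dynamical_domain_def power_dom_C0_translation by auto

text \<open>The \<open>n\<close>-th iterate reads its argument at \<open>t + n a\<close>, beyond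
  \<open>R\<close> for large \<open>t\<close> and, once \<open>n a \<ge> R\<close>, for all
  \<open>t \<ge> 0\<close>. No growth of the weight can matter where the function is 0.\<close>

lemma cutoff_in_C0_domain:
  fixes f :: "real \<Rightarrow> 'k::{real_normed_field,euclidean_space}"
  assumes "continuous_on {0..} f" "\<And>t. t \<ge> R \<Longrightarrow> f t = 0"
  shows "restrict f {0..} \<in> maximal_dynamical_domain C0_space (C0_translation w a)"
    and "\<exists>m. (op_app (C0_translation w a) ^^ m) (restrict f {0..}) = vzero C0_space"
proof -
  have zero: "translation_power w a n (restrict f {0..}) t = 0" if "t \<ge> R - real n * a" "0 \<le> t" for n t
    using that a assms(2)[of "t + real n * a"] by (simp add: translation_power_def)
  have "(translation_power w a n (restrict f {0..}) \<longlongrightarrow> 0) at_top" for n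
    by (intro tendsto_eventually eventually_mono[OF eventually_ge_at_top[of "max 0 (R - real n * a)"]])
      (auto simp: zero)
  moreover have "(f \<longlongrightarrow> 0) at_top"
    using assms(2) by (intro tendsto_eventually eventually_mono[OF eventually_ge_at_top[of R]])
  ultimately show "restrict f {0..} \<in> maximal_dynamical_domain C0_space (C0_translation w a)"
    using assms(1) by (simp add: maximal_dynamical_domain_C0_iff restrict_in_C0_iff)
  obtain m :: nat where "R / a \<le> real m" using real_arch_simple by blast
  then have "R - real m * a \<le> 0" using a by (simp add: field_simps)
  then have "(op_app (C0_translation w a) ^^ m) (restrict f {0..}) = vzero C0_space"
    by (auto simp: C0_translation_iterate C0_ops zero)
  then show "\<exists>m. (op_app (C0_translation w a) ^^ m) (restrict f {0..}) = vzero C0_space" ..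
qed

text \<open>
  The function \<open>y\<close> extends \<open>x\<close> continuously to the real line, linearly on \<open>[-a,0]\<close> and
  by \<open>0\<close> to the left of \<open>-a\<close>; extending by a nonzero constant would destroy the decay of the
  backward orbit.
\<close>

lemma C0_backward_orbit:
  fixes x :: "real \<Rightarrow> 'k::{real_normed_field,euclidean_space}"
  assumes x: "x \<in> carr C0_space"
  defines "y \<equiv> \<lambda>s. max 0 (min 1 (1 + s / a)) *\<^sub>R x (max 0 s)"
  defines "u \<equiv> \<lambda>n. restrict (translation_inverse_power w a n y) {0..}"
  shows "u 0 = x" "u (Suc n) \<in> op_dom (C0_translation w a)"
    "op_app (C0_translation w a) (u (Suc n)) = u n"
    "(\<lambda>n. C ^ n * vnorm C0_space (u n)) \<longlonglongrightarrow> 0"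
proof -
  have x': "x \<in> extensional {0..}" "continuous_on {0..} x" "(x \<longlongrightarrow> 0) at_top"
    using x by (auto simp: C0_carr_iff)
  have y_eq: "y s = x s" if "0 \<le> s" for s using that a by (simp add: y_def)
  have "continuous_on UNIV (\<lambda>s. x (max 0 s))"
    by (rule continuous_on_compose2[OF x'(2)]) (auto intro!: continuous_intros)
  then have "continuous_on UNIV y" unfolding y_def using a by (intro continuous_intros) auto
  then have y_cont: "continuous_on {0..} (\<lambda>t. y (t - b))" for b
    by (rule continuous_on_compose2) (auto intro!: continuous_intros)
  have y_lim: "(y \<longlongrightarrow> 0) at_top"
    using x'(3) by (subst tendsto_cong[where g = x])
      (auto intro: eventually_mono[OF eventually_ge_at_top[of 0]] simp: y_eq)
  have y_norm: "norm (y s) \<le> vnorm C0_space x" for s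
  proof -
    have "norm (y s) \<le> 1 * norm (x (max 0 s))"
      unfolding y_def norm_scaleR by (intro mult_right_mono) auto
    then show ?thesis using C0_norm_ge[OF x, of "max 0 s"] by simp
  qed
  have y_zero: "y s = 0" if "s < - a" for s using that a by (simp add: y_def field_simps)
  note bound = norm_translation_inverse_power_le[OF w a y_zero]
  show "u 0 = x" using x'(1) w by (auto simp: u_def translation_inverse_power_0 y_eq extensional_def)
  have lim: "(translation_inverse_power w a n y \<longlongrightarrow> 0) at_top" for n
  proof (rule Lim_null_comparison)
    show "\<forall>\<^sub>F t in at_top. norm (translation_inverse_power w a n y t)
        \<le> w powr (- (real n * (real n - 3) * a / 2)) * norm (y (t - real n * a))"
      using bound by (intro always_eventually) auto
    have "filterlim (\<lambda>t. t - real n * a) at_top at_top" by real_asymp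
    then show "((\<lambda>t. w powr (- (real n * (real n - 3) * a / 2)) * norm (y (t - real n * a))) \<longlongrightarrow> 0) at_top"
      by (intro tendsto_mult_right_zero tendsto_norm_zero filterlim_compose[OF y_lim])
  qed
  have u_carr: "u n \<in> carr C0_space" for n
    unfolding u_def restrict_in_C0_iff
    using lim[of n] w y_cont by (auto simp: translation_inverse_power_def[abs_def] intro!: continuous_intros)
  show app: "op_app (C0_translation w a) (u (Suc n)) = u n" for n
    using a w by (auto simp: u_def C0_translation_app translation_inverse_power_Suc)
  have "((\<lambda>t. w powr t *\<^sub>R u (Suc n) (t + a)) \<longlongrightarrow> 0) at_top \<longleftrightarrow> (translation_inverse_power w a n y \<longlongrightarrow> 0) at_top"
    using a w by (intro tendsto_cong eventually_mono[OF eventually_ge_at_top[of 0]])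
      (auto simp: u_def translation_inverse_power_Suc)
  then show "u (Suc n) \<in> op_dom (C0_translation w a)"
    using u_carr lim by (simp add: C0_translation_dom_iff)
  have u_norm: "vnorm C0_space (u n) \<le> w powr (- (real n * (real n - 3) * a / 2)) * vnorm C0_space x" for n
  proof (rule C0_norm_le)
    fix t :: real assume "0 \<le> t"
    then have "norm (u n t) \<le> w powr (- (real n * (real n - 3) * a / 2)) * norm (y (t - real n * a))"
      using bound by (simp add: u_def)
    also have "\<dots> \<le> w powr (- (real n * (real n - 3) * a / 2)) * vnorm C0_space x"
      by (intro mult_left_mono y_norm) auto
    finally show "norm (u n t) \<le> \<dots>" .
  qed
  show "(\<lambda>n. C ^ n * vnorm C0_space (u n)) \<longlonglongrightarrow> 0"
  proof (rule Lim_null_comparison)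
    have "0 \<le> vnorm C0_space (u n)" for n
      using C0_norm_ge[OF u_carr, of 0 n] norm_ge_zero by (rule order_trans[rotated]) auto
    then show "\<forall>\<^sub>F n in sequentially. norm (C ^ n * vnorm C0_space (u n))
        \<le> \<bar>C\<bar> ^ n * w powr (- (real n * (real n - 3) * a / 2)) * vnorm C0_space x"
      using u_norm by (intro always_eventually allI)
        (simp add: abs_mult power_abs mult.assoc mult_left_mono)
    show "(\<lambda>n. \<bar>C\<bar> ^ n * w powr (- (real n * (real n - 3) * a / 2)) * vnorm C0_space x) \<longlonglongrightarrow> 0"
      by (intro tendsto_mult_left_zero power_times_gaussian_tendsto_0 w a)
  qed
qed

proposition C0_translation_unbounded_hypermixing:
  fixes X :: "('k::{real_normed_field,euclidean_space}, real \<Rightarrow> 'k) normed_sp"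
  defines "X \<equiv> C0_space"
  shows "unbounded_operator X (C0_translation w a) \<and>
    hypermixing X (C0_translation w a) (maximal_dynamical_domain X (C0_translation w a))"
proof -
  interpret normed_sp_laws X unfolding X_def by (rule normed_sp_laws_C0)
  define T :: "(real \<Rightarrow> 'k) partial_op" where "T = C0_translation w a"
  have T: "linear_operator X T" unfolding X_def T_def by (rule linear_operator_C0_translation)
  let ?Y = "maximal_dynamical_domain X T"
  have "unbounded_operator X T \<and> hypermixing X T ?Y"
  proof (rule unbounded_hypermixing_criterion[OF T dynamical_domain_maximal[OF T]])
    \<comment> \<open>A ramp with value 1 at 0 that vanishes from 1 on: a nonzero element of the
      maximal domain.\<close>
    let ?b = "\<lambda>t::real. of_real (max 0 (1 - t)) :: 'k"
    have "restrict ?b {0..} \<in> ?Y" unfolding X_def T_def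
      by (rule cutoff_in_C0_domain[where R = 1]) (auto intro!: continuous_intros)
    moreover have "restrict ?b {0..} \<noteq> vzero X"
      by (auto simp: X_def C0_ops fun_eq_iff restrict_def intro!: exI[of _ 0])
    ultimately show "?Y \<noteq> {vzero X}" by auto
  next
    fix f :: "real \<Rightarrow> 'k" and e :: real assume f: "f \<in> ?Y" and e: "0 < e"
    have fc: "f \<in> carr X" using f by (simp add: X_def T_def maximal_dynamical_domain_C0_iff)
    then have f': "continuous_on {0..} f" "(f \<longlongrightarrow> 0) at_top" by (auto simp: X_def C0_carr_iff)
    \<comment> \<open>Half of \<open>e\<close>, because a pointwise bound passes to the supremum
      norm only as a weak inequality.\<close>
    have "eventually (\<lambda>t. norm (f t) < e / 2) at_top"
      using order_tendstoD(2)[OF tendsto_norm_zero[OF f'(2)], of "e/2"] e by simp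
    then obtain R where R: "\<And>t. t \<ge> R \<Longrightarrow> norm (f t) < e / 2" by (auto simp: eventually_at_top_linorder)
    \<comment> \<open>The cutoff factor is 1 up to \<open>R\<close> and falls linearly to 0 at
      \<open>R + 1\<close>, so \<open>f\<close> is altered only where it is already small, and
      continuity is kept.\<close>
    define g where "g t = max 0 (min 1 (R + 1 - t)) *\<^sub>R f t" for t
    have g: "restrict g {0..} \<in> ?Y" "\<exists>m. (op_app T ^^ m) (restrict g {0..}) = vzero X"
      unfolding X_def T_def using f'(1)
      by (auto simp: g_def intro!: cutoff_in_C0_domain[where R = "R + 1"] continuous_intros)
    have gc: "restrict g {0..} \<in> carr X"
      using g(1) by (simp add: X_def T_def maximal_dynamical_domain_C0_iff)
    have "vdist X f (restrict g {0..}) \<le> e / 2"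
      unfolding vdist_eq[OF fc gc] unfolding X_def
    proof (rule C0_norm_le)
      fix t :: real assume t: "0 \<le> t"
      define c where "c = max 0 (min 1 (R + 1 - t))"
      have "norm (f t - c *\<^sub>R f t) \<le> e / 2"
      proof (cases "t \<ge> R")
        case True
        have "norm (f t - c *\<^sub>R f t) = \<bar>1 - c\<bar> * norm (f t)"
          by (metis norm_scaleR scaleR_left_diff_distrib scaleR_one)
        also have "\<dots> \<le> 1 * norm (f t)" by (intro mult_right_mono) (auto simp: c_def)
        finally show ?thesis using R[OF True] by simp
      qed (use e in \<open>auto simp: c_def\<close>)
      then show "norm (vadd C0_space f (vscale C0_space (- 1) (restrict g {0..})) t) \<le> e / 2"
        using t by (simp add: C0_ops g_def c_def)
    qed
    then have "vdist X f (restrict g {0..}) < e" using e by simp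
    with g show "\<exists>d\<in>?Y. \<exists>m. vdist X f d < e \<and> (op_app T ^^ m) d = vzero X" by blast
  next
    fix x assume x: "x \<in> ?Y"
    then have xc: "x \<in> carr C0_space" by (simp add: X_def T_def maximal_dynamical_domain_C0_iff)
    note orbit = C0_backward_orbit[OF xc]
    let ?u = "\<lambda>n. restrict (translation_inverse_power w a n (\<lambda>s. max 0 (min 1 (1 + s / a)) *\<^sub>R x (max 0 s))) {0..}"
    have "?u n \<in> ?Y" for n
      by (rule backward_orbit_in_maximal_dynamical_domain[OF T]) (simp_all only: T_def orbit x[unfolded T_def])
    then show "\<exists>u. u 0 = x \<and> (\<forall>n. u n \<in> ?Y) \<and> (\<forall>n. op_app T (u (Suc n)) = u n) \<and>
        (\<forall>C. (\<lambda>n. C ^ n * vnorm X (u n)) \<longlonglongrightarrow> 0)"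
      using orbit unfolding X_def T_def by (intro exI[of _ ?u]) blast
  qed
  then show ?thesis by (simp add: T_def)
qed

end

section \<open>Weighted left translations in \<open>L\<^sub>p(0,\<infinity>)\<close>\<close>

lemma lebesgue_translation: "distr lebesgue lebesgue (\<lambda>x::real. x + b) = lebesgue"
proof -
  have "lebesgue = density (distr lebesgue lebesgue (\<lambda>x::real. b + 1 * x)) (\<lambda>_. ennreal \<bar>1\<bar>)"
    by (rule lebesgue_real_affine) simp
  then show ?thesis by (simp add: density_1 add.commute)
qed

lemma measurable_lebesgue_translation: "(\<lambda>x::real. x + b) \<in> lebesgue \<rightarrow>\<^sub>M lebesgue"
  using lebesgue_affine_measurable[of "\<lambda>_. 1" b] by (simp add: euclidean_representation add.commute)

lemma borel_measurable_half_line_iff: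
  fixes f :: "real \<Rightarrow> 'k::euclidean_space"
  shows "f \<in> borel_measurable (lebesgue_on {0<..}) \<longleftrightarrow>
    (\<lambda>x. if 0 < x then f x else 0) \<in> borel_measurable lebesgue"
  using borel_measurable_if[of "{0<..}" f] by simp

text \<open>Both claims pass to the extension by 0 to the whole line, where translation preserves
  the measure. As \<open>0 \<le> b\<close>, the left shift maps the half line into itself and never
  reads the artificial zeros.\<close>

lemma
  fixes f :: "real \<Rightarrow> 'k::euclidean_space"
  assumes "0 \<le> b"
  shows borel_measurable_shift_left: "f \<in> borel_measurable (lebesgue_on {0<..}) \<Longrightarrow>
      (\<lambda>t. f (t + b)) \<in> borel_measurable (lebesgue_on {0<..})"
    and integrable_shift_left: "integrable (lebesgue_on {0<..}) f \<Longrightarrow>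
      integrable (lebesgue_on {0<..}) (\<lambda>t. f (t + b))"
proof -
  let ?F = "\<lambda>x. if 0 < x then f x else 0"
  {
    assume "f \<in> borel_measurable (lebesgue_on {0<..})"
    then have "?F \<in> borel_measurable lebesgue" by (simp add: borel_measurable_half_line_iff)
    then have "(\<lambda>x. ?F (x + b)) \<in> borel_measurable lebesgue"
      by (rule measurable_compose[OF measurable_lebesgue_translation])
    then have "(\<lambda>x. ?F (x + b)) \<in> borel_measurable (lebesgue_on {0<..})"
      by (rule measurable_restrict_space1)
    then show "(\<lambda>t. f (t + b)) \<in> borel_measurable (lebesgue_on {0<..})"
      by (rule measurable_cong[THEN iffD1, rotated]) (use assms in auto)
  next
    assume "integrable (lebesgue_on {0<..}) f"
    then have "integrable lebesgue (\<lambda>x. indicator {0<..} x *\<^sub>R f x)"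
      by (simp add: integrable_restrict_space)
    then have "integrable (distr lebesgue lebesgue (\<lambda>x. x + b)) (\<lambda>x. indicator {0<..} x *\<^sub>R f x)"
      by (simp add: lebesgue_translation)
    then have "integrable lebesgue (\<lambda>x. indicator {0<..} (x + b) *\<^sub>R f (x + b))"
      by (rule integrable_distr[OF measurable_lebesgue_translation])
    then have "integrable lebesgue (\<lambda>x. indicator {0<..} x *\<^sub>R (indicator {0<..} (x + b) *\<^sub>R f (x + b)))"
      by (intro integrable_mult_indicator) auto
    also have "(\<lambda>x. indicator {0<..} x *\<^sub>R (indicator {0<..} (x + b) *\<^sub>R f (x + b)))
        = (\<lambda>x. indicator {0<..} x *\<^sub>R f (x + b))"
      using assms by (auto simp: indicator_def)
    finally show "integrable (lebesgue_on {0<..}) (\<lambda>t. f (t + b))"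
      by (simp add: integrable_restrict_space)
  }
qed

text \<open>Makes the translation well defined on classes: its value does not depend on the
  representative that \<open>rep\<close> picks.\<close>

lemma AE_shift_left:
  fixes P :: "real \<Rightarrow> bool"
  assumes "0 \<le> b" "AE x in lebesgue_on {0<..}. P x"
  shows "AE t in lebesgue_on {0<..}. P (t + b)"
proof -
  have "AE x in distr lebesgue lebesgue (\<lambda>x. x + b). 0 < x \<longrightarrow> P x"
    using assms(2) unfolding lebesgue_translation by (simp add: AE_restrict_space_iff)
  then have "AE x in lebesgue. 0 < x + b \<longrightarrow> P (x + b)"
    by (rule AE_distrD[OF measurable_lebesgue_translation])
  then have "AE x in lebesgue. x \<in> {0<..} \<longrightarrow> P (x + b)"
    by eventually_elim (use assms(1) in auto)
  then show ?thesis by (simp add: AE_restrict_space_iff)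
qed

text \<open>Filling \<open>(0,b]\<close> with 0 makes the right shift preserve integrals; applied to
  \<open>|f|^p\<close> this gives an isometry of \<open>L\<^sub>p\<close>.\<close>

lemma
  fixes f :: "real \<Rightarrow> 'k::euclidean_space"
  assumes "0 \<le> b"
  shows borel_measurable_shift_right: "f \<in> borel_measurable (lebesgue_on {0<..}) \<Longrightarrow>
      (\<lambda>t. if b < t then f (t - b) else 0) \<in> borel_measurable (lebesgue_on {0<..})"
    and integrable_shift_right: "integrable (lebesgue_on {0<..}) f \<Longrightarrow>
      integrable (lebesgue_on {0<..}) (\<lambda>t. if b < t then f (t - b) else 0)"
    and integral_shift_right: "integrable (lebesgue_on {0<..}) f \<Longrightarrow>
      (\<integral>t. (if b < t then f (t - b) else 0) \<partial>lebesgue_on {0<..}) = (\<integral>t. f t \<partial>lebesgue_on {0<..})"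
proof -
  let ?F = "\<lambda>x. if 0 < x then f x else 0"
  {
    assume "f \<in> borel_measurable (lebesgue_on {0<..})"
    then have "?F \<in> borel_measurable lebesgue" by (simp add: borel_measurable_half_line_iff)
    then have "(\<lambda>x. ?F (x + - b)) \<in> borel_measurable lebesgue"
      by (rule measurable_compose[OF measurable_lebesgue_translation])
    then have "(\<lambda>x. if b < x then f (x - b) else 0) \<in> borel_measurable lebesgue"
      by (simp cong: if_cong)
    then show "(\<lambda>t. if b < t then f (t - b) else 0) \<in> borel_measurable (lebesgue_on {0<..})"
      by (rule measurable_restrict_space1)
  next
    let ?G = "\<lambda>x. indicator {0<..} x *\<^sub>R f x"
    have eq: "(\<lambda>x. indicator {0<..} x *\<^sub>R (if b < x then f (x - b) else 0)) = (\<lambda>x. ?G (x + - b))"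
      using assms by (auto simp: indicator_def)
    assume "integrable (lebesgue_on {0<..}) f"
    then have i: "integrable lebesgue ?G" by (simp add: integrable_restrict_space)
    then have "integrable (distr lebesgue lebesgue (\<lambda>x. x + - b)) ?G"
      by (simp only: lebesgue_translation)
    then have "integrable lebesgue (\<lambda>x. ?G (x + - b))"
      by (rule integrable_distr[OF measurable_lebesgue_translation])
    then have "integrable lebesgue (\<lambda>x. indicator {0<..} x *\<^sub>R (if b < x then f (x - b) else 0))"
      by (simp only: eq)
    then show "integrable (lebesgue_on {0<..}) (\<lambda>t. if b < t then f (t - b) else 0)"
      by (subst integrable_restrict_space) auto
    have "(\<integral>x. ?G (x + - b) \<partial>lebesgue) = (\<integral>x. ?G x \<partial>distr lebesgue lebesgue (\<lambda>x. x + - b))"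
      using i by (intro integral_distr[symmetric] measurable_lebesgue_translation borel_measurable_integrable)
    also have "\<dots> = (\<integral>x. ?G x \<partial>lebesgue)" by (simp only: lebesgue_translation)
    finally have "(\<integral>x. indicator {0<..} x *\<^sub>R (if b < x then f (x - b) else 0) \<partial>lebesgue) = (\<integral>x. ?G x \<partial>lebesgue)"
      by (simp only: eq)
    then show "(\<integral>t. (if b < t then f (t - b) else 0) \<partial>lebesgue_on {0<..}) = (\<integral>t. f t \<partial>lebesgue_on {0<..})"
      by (simp add: integral_restrict_space)
  }
qed

lemma Lp_fun_shift_left:
  fixes f :: "real \<Rightarrow> 'k::euclidean_space"
  assumes "0 \<le> b" "Lp_fun p (lebesgue_on {0<..}) f"
  shows "Lp_fun p (lebesgue_on {0<..}) (\<lambda>t. f (t + b))"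
  using assms borel_measurable_shift_left[of b f] integrable_shift_left[of b "\<lambda>x. norm (f x) powr p"]
  by (simp add: Lp_fun_def)

lemma
  fixes f :: "real \<Rightarrow> 'k::euclidean_space"
  assumes "0 \<le> b" "Lp_fun p (lebesgue_on {0<..}) f" "1 \<le> p"
  shows Lp_fun_shift_right: "Lp_fun p (lebesgue_on {0<..}) (\<lambda>t. if b < t then f (t - b) else 0)"
    and Lp_norm_shift_right: "Lp_norm p (lebesgue_on {0<..}) (\<lambda>t. if b < t then f (t - b) else 0)
      = Lp_norm p (lebesgue_on {0<..}) f"
proof -
  have eq: "norm (if b < t then f (t - b) else 0) powr p = (if b < t then norm (f (t - b)) powr p else 0)" for t
    using assms(3) by simp
  have "f \<in> borel_measurable (lebesgue_on {0<..})" and i: "integrable (lebesgue_on {0<..}) (\<lambda>x. norm (f x) powr p)"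
    using assms(2) by (auto simp: Lp_fun_def)
  then show "Lp_fun p (lebesgue_on {0<..}) (\<lambda>t. if b < t then f (t - b) else 0)"
    using borel_measurable_shift_right[OF assms(1)] integrable_shift_right[OF assms(1) i]
    by (simp add: Lp_fun_def eq)
  show "Lp_norm p (lebesgue_on {0<..}) (\<lambda>t. if b < t then f (t - b) else 0) = Lp_norm p (lebesgue_on {0<..}) f"
    using integral_shift_right[OF assms(1) i] by (simp add: Lp_norm_def eq)
qed

text \<open>Dominated convergence with majorant \<open>|f|^p\<close>: at each point the truncated
  function is eventually 0.\<close>

lemma Lp_norm_tail_tendsto_0:
  fixes f :: "real \<Rightarrow> 'k::euclidean_space"
  assumes f: "Lp_fun p M f" and p: "1 \<le> p"
    and meas: "\<And>N. (\<lambda>t. if t < real N then 0 else f t) \<in> borel_measurable M"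
  shows "(\<lambda>N. Lp_norm p M (\<lambda>t. if t < real N then 0 else f t)) \<longlonglongrightarrow> 0"
proof -
  have i: "integrable M (\<lambda>x. norm (f x) powr p)" using f by (simp add: Lp_fun_def)
  have "(\<lambda>N. \<integral>t. norm (if t < real N then 0 else f t) powr p \<partial>M) \<longlonglongrightarrow> (\<integral>t. 0 \<partial>M)"
  proof (rule integral_dominated_convergence[OF _ _ i])
    show "AE t in M. (\<lambda>N. norm (if t < real N then 0 else f t) powr p) \<longlonglongrightarrow> 0"
    proof (rule AE_I2)
      fix t
      obtain N0 :: nat where "t < real N0" using reals_Archimedean2 by blast
      then show "(\<lambda>N. norm (if t < real N then 0 else f t) powr p) \<longlonglongrightarrow> 0"
        using p by (intro tendsto_eventually eventually_sequentiallyI[of N0]) auto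
    qed
  qed (use meas p in auto)
  then have "(\<lambda>N. (\<integral>t. norm (if t < real N then 0 else f t) powr p \<partial>M) powr (1/p)) \<longlonglongrightarrow> 0 powr (1/p)"
    using p by (intro tendsto_powr2) (auto intro!: always_eventually)
  then show ?thesis using p by (simp add: Lp_norm_def)
qed

section \<open>The translation in \<open>L\<^sub>p\<close>: domains of powers, backward orbits,
  truncations\<close>

context
  fixes p w a :: real
  assumes p: "1 \<le> p" and w: "1 < w" and a: "0 < a"
begin

lemma translation_power_measurable:
  fixes f :: "real \<Rightarrow> 'k::euclidean_space"
  assumes "f \<in> borel_measurable (lebesgue_on {0<..})"
  shows "translation_power w a n f \<in> borel_measurable (lebesgue_on {0<..})"
proof -
  have "(\<lambda>t. f (t + real n * a)) \<in> borel_measurable (lebesgue_on {0<..})"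
    using a by (intro borel_measurable_shift_left assms) auto
  moreover have "(\<lambda>t. w powr (real n * t + (real n - 1) * real n * a / 2)) \<in> borel_measurable (lebesgue_on {0<..})"
    by (intro measurable_restrict_space1 measurable_completion) measurable
  ultimately show ?thesis unfolding translation_power_def[abs_def] by measurable
qed

lemma translation_power_1: "translation_power w a 1 f = (\<lambda>t. w powr t *\<^sub>R f (t + a))"
  by (auto simp: translation_power_def)

lemma weighted_shift_rep_AE:
  fixes f :: "real \<Rightarrow> 'k::euclidean_space"
  assumes "f \<in> borel_measurable (lebesgue_on {0<..})"
  shows "AE t in lebesgue_on {0<..}. w powr t *\<^sub>R rep (ae_class (lebesgue_on {0<..}) f) (t + a) = w powr t *\<^sub>R f (t + a)"
proof -
  have "AE t in lebesgue_on {0<..}. rep (ae_class (lebesgue_on {0<..}) f) (t + a) = f (t + a)"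
    using a by (intro AE_shift_left rep_AE assms) auto
  then show ?thesis by eventually_elim simp
qed

lemma Lp_translation_app:
  fixes f :: "real \<Rightarrow> 'k::{real_normed_field,euclidean_space}"
  assumes "f \<in> borel_measurable (lebesgue_on {0<..})"
  shows "op_app (Lp_translation p w a) (ae_class (lebesgue_on {0<..}) f) =
    ae_class (lebesgue_on {0<..}) (\<lambda>t. w powr t *\<^sub>R f (t + a))"
  unfolding Lp_translation_def using weighted_shift_rep_AE[OF assms] by (auto intro!: ae_class_eqI)

lemma Lp_translation_dom_iff:
  fixes f :: "real \<Rightarrow> 'k::{real_normed_field,euclidean_space}"
  assumes f: "f \<in> borel_measurable (lebesgue_on {0<..})"
  shows "ae_class (lebesgue_on {0<..}) f \<in> op_dom (Lp_translation p w a) \<longleftrightarrow>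
    Lp_fun p (lebesgue_on {0<..}) f \<and> Lp_fun p (lebesgue_on {0<..}) (\<lambda>t. w powr t *\<^sub>R f (t + a))"
proof -
  let ?g = "rep (ae_class (lebesgue_on {0<..}) f)"
  have m: "(\<lambda>t. w powr t *\<^sub>R ?g (t + a)) \<in> borel_measurable (lebesgue_on {0<..})"
    "(\<lambda>t. w powr t *\<^sub>R f (t + a)) \<in> borel_measurable (lebesgue_on {0<..})"
    using translation_power_measurable[OF rep_measurable[OF f], of 1] translation_power_measurable[OF f, of 1]
    by (simp_all add: translation_power_1 del: One_nat_def)
  have "integrable (lebesgue_on {0<..}) (\<lambda>t. norm (w powr t *\<^sub>R ?g (t + a)) powr p) \<longleftrightarrow>
    Lp_fun p (lebesgue_on {0<..}) (\<lambda>t. w powr t *\<^sub>R ?g (t + a))"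
    using m(1) by (simp add: Lp_fun_def)
  also have "\<dots> \<longleftrightarrow> Lp_fun p (lebesgue_on {0<..}) (\<lambda>t. w powr t *\<^sub>R f (t + a))"
    by (rule Lp_fun_cong_AE[OF m weighted_shift_rep_AE[OF f]])
  finally show ?thesis
    by (simp add: Lp_translation_def ae_class_in_Lp_iff[OF f])
qed

lemma linear_operator_Lp_translation:
  "linear_operator (Lp_space p (lebesgue_on {0<..})) (Lp_translation p w a ::
     (real \<Rightarrow> 'k::{real_normed_field,euclidean_space}) set partial_op)"
proof -
  let ?M = "lebesgue_on {0<..} :: real measure"
  let ?X = "Lp_space p ?M :: ('k, (real \<Rightarrow> 'k) set) normed_sp"
  let ?T = "Lp_translation p w a :: (real \<Rightarrow> 'k) set partial_op"
  interpret normed_sp_laws ?X by (rule normed_sp_laws_Lp[OF p])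
  have sub: "op_dom ?T \<subseteq> carr ?X" by (auto simp: Lp_translation_def)
  have ex: "\<exists>f. Lp_fun p ?M f \<and> f \<in> borel_measurable ?M \<and> Lp_fun p ?M (\<lambda>t. w powr t *\<^sub>R f (t + a))
      \<and> F = ae_class ?M f" if "F \<in> op_dom ?T" for F
  proof -
    have F: "F \<in> carr ?X" using that sub by blast
    note rep = rep_Lp[OF F]
    show ?thesis
      using that rep Lp_fun_measurable[OF rep(1)] Lp_translation_dom_iff[of "rep F"]
      by (intro exI[of _ "rep F"]) auto
  qed
  note ops = vadd_ae_class vscale_ae_class vzero_Lp ae_class_in_Lp_iff Lp_translation_app Lp_translation_dom_iff
  show ?thesis
    unfolding linear_operator_def linear_subspace_def
  proof (intro conjI ballI allI sub)
    show "vzero ?X \<in> op_dom ?T" by (simp add: ops Lp_fun_def)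
  next
    fix F :: "(real \<Rightarrow> 'k) set" and c :: 'k
    assume "F \<in> op_dom ?T"
    then obtain f where f: "Lp_fun p ?M f" "f \<in> borel_measurable ?M"
      "Lp_fun p ?M (\<lambda>t. w powr t *\<^sub>R f (t + a))" "F = ae_class ?M f" using ex by blast
    note f_meas = Lp_fun_measurable[OF f(3)]
    show "vscale ?X c F \<in> op_dom ?T"
      using f Lp_fun_scale[OF f(1) p] Lp_fun_scale[OF f(3) p, of c] by (simp add: ops)
    show "op_app ?T F \<in> carr ?X" using f f_meas by (simp add: ops)
    show "op_app ?T (vscale ?X c F) = vscale ?X c (op_app ?T F)" using f f_meas by (simp add: ops)
    fix G :: "(real \<Rightarrow> 'k) set"
    assume "G \<in> op_dom ?T"
    then obtain g where g: "Lp_fun p ?M g" "g \<in> borel_measurable ?M"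
      "Lp_fun p ?M (\<lambda>t. w powr t *\<^sub>R g (t + a))" "G = ae_class ?M g" using ex by blast
    note g_meas = Lp_fun_measurable[OF g(3)]
    show "vadd ?X F G \<in> op_dom ?T"
      using f g Lp_fun_add[OF f(1) g(1) p] Lp_fun_add[OF f(3) g(3) p] by (simp add: ops scaleR_add_right)
    show "op_app ?T (vadd ?X F G) = vadd ?X (op_app ?T F) (op_app ?T G)"
      using f g f_meas g_meas by (simp add: ops scaleR_add_right)
  qed
qed

lemma Lp_translation_iterate:
  fixes f :: "real \<Rightarrow> 'k::{real_normed_field,euclidean_space}"
  assumes "f \<in> borel_measurable (lebesgue_on {0<..})"
  shows "(op_app (Lp_translation p w a) ^^ n) (ae_class (lebesgue_on {0<..}) f) =
    ae_class (lebesgue_on {0<..}) (translation_power w a n f)"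
  using w translation_power_measurable[OF assms]
  by (induction n) (simp_all add: translation_power_0 Lp_translation_app translation_power_Suc flip: translation_power_Suc)

text \<open>For \<open>t > a\<close> the values of the \<open>n\<close>-th iterate are dominated by those of the next one at \<open>t - a\<close>.\<close>

lemma Lp_fun_translation_power_Suc_imp:
  fixes f :: "real \<Rightarrow> 'k::{real_normed_field,euclidean_space}"
  assumes f: "Lp_fun p (lebesgue_on {0<..}) f"
    and Suc: "Lp_fun p (lebesgue_on {0<..}) (translation_power w a (Suc n) f)"
  shows "Lp_fun p (lebesgue_on {0<..}) (translation_power w a n f)"
proof -
  let ?M = "lebesgue_on {0<..} :: real measure"
  \<comment> \<open>Bounds the weight of the \<open>n\<close>-th iterate on \<open>(0,a]\<close>,
    where \<open>t - a\<close> leaves the half line and the next iterate gives no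
    information.\<close>
  define C where "C = w powr (real n * a + (real n - 1) * real n * a / 2)"
  define g where "g t = (if a < t then translation_power w a (Suc n) f (t - a) else 0)" for t
  have g: "Lp_fun p ?M g" unfolding g_def using a Suc p by (intro Lp_fun_shift_right) auto
  have shift: "Lp_fun p ?M (\<lambda>t. f (t + real n * a))" using a f by (intro Lp_fun_shift_left) auto
  then have "Lp_fun p ?M (\<lambda>t. C * norm (f (t + real n * a)))"
    by (rule Lp_fun_bound[where C = C]) (use Lp_fun_measurable[OF shift] p in \<open>auto simp: C_def\<close>)
  moreover have "Lp_fun p ?M (\<lambda>t. norm (g t))"
    by (rule Lp_fun_bound[OF g, where C = 1]) (use Lp_fun_measurable[OF g] p in auto)
  ultimately have "Lp_fun p ?M (\<lambda>t. C * norm (f (t + real n * a)) + norm (g t))"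
    using p by (rule Lp_fun_add)
  then show ?thesis
  proof (rule Lp_fun_bound[where C = 1])
    show "translation_power w a n f \<in> borel_measurable ?M"
      by (intro translation_power_measurable Lp_fun_measurable[OF f])
    have "norm (translation_power w a n f t) \<le> C * norm (f (t + real n * a)) + norm (g t)" if "0 < t" for t
    proof (cases "a < t")
      case True
      then have "norm (translation_power w a n f t) \<le> norm (g t)"
        using norm_translation_power_le_Suc[OF w, of "t - a" a n f] by (simp add: g_def)
      then show ?thesis by (rule order_trans) (simp add: C_def)
    next
      case False
      then have "real n * t \<le> real n * a" by (intro mult_left_mono) auto
      then have "w powr (real n * t + (real n - 1) * real n * a / 2) \<le> C"
        unfolding C_def using w by (intro powr_mono) auto
      then have "norm (translation_power w a n f t) \<le> C * norm (f (t + real n * a))"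
        by (simp add: translation_power_def mult_right_mono)
      then show ?thesis by (rule order_trans) simp
    qed
    then show "AE t in ?M. norm (translation_power w a n f t)
        \<le> 1 * norm (C * norm (f (t + real n * a)) + norm (g t))"
      by (intro AE_I2) (auto simp: C_def intro: order_trans[OF _ abs_ge_self])
  qed (use p in auto)
qed

lemma power_dom_Lp_translation_iff:
  fixes f :: "real \<Rightarrow> 'k::{real_normed_field,euclidean_space}"
  assumes f: "f \<in> borel_measurable (lebesgue_on {0<..})"
  shows "ae_class (lebesgue_on {0<..}) f \<in> power_dom (Lp_space p (lebesgue_on {0<..})) (Lp_translation p w a) n \<longleftrightarrow>
    Lp_fun p (lebesgue_on {0<..}) f \<and> Lp_fun p (lebesgue_on {0<..}) (translation_power w a n f)"
proof (induction n)
  case 0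
  then show ?case using w by (simp add: ae_class_in_Lp_iff[OF f] translation_power_0)
next
  case (Suc n)
  have "translation_power w a (Suc n) f = (\<lambda>t. w powr t *\<^sub>R translation_power w a n f (t + a))"
    using w by (auto simp: translation_power_Suc)
  then show ?case
    using Suc Lp_fun_translation_power_Suc_imp[of f n]
    by (auto simp: Lp_translation_iterate[OF f] Lp_translation_dom_iff[OF translation_power_measurable[OF f]])
qed

lemma power_dom_Lp_translation:
  "power_dom (Lp_space p (lebesgue_on {0<..})) (Lp_translation p w a) n =
     {F :: (real \<Rightarrow> 'k::{real_normed_field,euclidean_space}) set.
        F \<in> carr (Lp_space p (lebesgue_on {0<..})) \<and>
        integrable (lebesgue_on {0<..}) (\<lambda>t. norm (translation_power w a n (rep F) t) powr p)}"
proof -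
  have "power_dom X T n \<subseteq> carr X" for X :: "('k, (real \<Rightarrow> 'k) set) normed_sp" and T
    by (induction n) auto
  moreover have "F \<in> power_dom (Lp_space p (lebesgue_on {0<..})) (Lp_translation p w a) n \<longleftrightarrow>
      integrable (lebesgue_on {0<..}) (\<lambda>t. norm (translation_power w a n (rep F) t) powr p)"
    if F: "F \<in> carr (Lp_space p (lebesgue_on {0<..}))" for F :: "(real \<Rightarrow> 'k) set"
    using power_dom_Lp_translation_iff[OF Lp_fun_measurable[OF rep_Lp(1)[OF F]], of n] rep_Lp[OF F]
      translation_power_measurable[OF Lp_fun_measurable[OF rep_Lp(1)[OF F]], of n]
    by (simp add: Lp_fun_def)
  ultimately show ?thesis by blast
qed

lemma maximal_dynamical_domain_Lp_iff:
  fixes f :: "real \<Rightarrow> 'k::{real_normed_field,euclidean_space}"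
  assumes "f \<in> borel_measurable (lebesgue_on {0<..})"
  shows "ae_class (lebesgue_on {0<..}) f \<in>
      maximal_dynamical_domain (Lp_space p (lebesgue_on {0<..})) (Lp_translation p w a) \<longleftrightarrow>
    Lp_fun p (lebesgue_on {0<..}) f \<and> (\<forall>n\<ge>1. Lp_fun p (lebesgue_on {0<..}) (translation_power w a n f))"
  unfolding maximal_dynamical_domain_def INT_iff power_dom_Lp_translation_iff[OF assms] by auto

text \<open>Without continuity to preserve, extension by 0 to the left is enough. The unweighted
  right shifts are isometric, so the norms are governed by the Gaussian factor alone.\<close>

lemma Lp_backward_orbit:
  fixes x :: "real \<Rightarrow> 'k::{real_normed_field,euclidean_space}"
  assumes x: "Lp_fun p (lebesgue_on {0<..}) x"
  defines "y \<equiv> \<lambda>s. if 0 < s then x s else 0"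
  defines "u \<equiv> \<lambda>n. ae_class (lebesgue_on {0<..}) (translation_inverse_power w a n y)"
  shows "u 0 = ae_class (lebesgue_on {0<..}) x" "u (Suc n) \<in> op_dom (Lp_translation p w a)"
    "op_app (Lp_translation p w a) (u (Suc n)) = u n"
    "(\<lambda>n. C ^ n * vnorm (Lp_space p (lebesgue_on {0<..})) (u n)) \<longlonglongrightarrow> 0"
proof -
  let ?M = "lebesgue_on {0<..} :: real measure"
  let ?X = "Lp_space p ?M :: ('k, (real \<Rightarrow> 'k) set) normed_sp"
  show "u 0 = ae_class ?M x"
    unfolding u_def using w by (intro ae_class_eqI AE_I2) (auto simp: translation_inverse_power_0 y_def)
  \<comment> \<open>The unweighted right shift of \<open>x\<close> by \<open>n a\<close>, whose norm
    is that of \<open>x\<close>.\<close>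
  define v where "v n t = (if real n * a < t then x (t - real n * a) else 0)" for n t
  have yv: "y (t - real n * a) = v n t" for n t by (simp add: y_def v_def)
  have v: "Lp_fun p ?M (v n)" "Lp_norm p ?M (v n) = Lp_norm p ?M x" for n
    unfolding v_def[abs_def] using a x p
    by (auto intro!: Lp_fun_shift_right Lp_norm_shift_right)
  have bound: "norm (translation_inverse_power w a n y t)
      \<le> w powr (- (real n * (real n - 3) * a / 2)) * norm (v n t)" for n t
    using norm_translation_inverse_power_le[OF w a, of y n t] a unfolding yv by (simp add: y_def)
  have meas: "translation_inverse_power w a n y \<in> borel_measurable ?M" for n
  proof -
    have "(\<lambda>t. w powr (real n * (real n + 1) * a / 2 - real n * t)) \<in> borel_measurable ?M"
      by (intro measurable_restrict_space1 measurable_completion) measurable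
    then show ?thesis
      using Lp_fun_measurable[OF v(1)[of n]] unfolding translation_inverse_power_def[abs_def] yv by measurable
  qed
  have Lp: "Lp_fun p ?M (translation_inverse_power w a n y)" for n
    by (rule Lp_fun_bound[OF v(1) meas]) (use p bound in \<open>auto intro!: AE_I2\<close>)
  have shift: "(\<lambda>t. w powr t *\<^sub>R translation_inverse_power w a (Suc n) y (t + a)) = translation_inverse_power w a n y" for n
    using w by (auto simp: translation_inverse_power_Suc)
  show "u (Suc n) \<in> op_dom (Lp_translation p w a)" "op_app (Lp_translation p w a) (u (Suc n)) = u n"
    unfolding u_def using Lp meas by (simp_all add: Lp_translation_dom_iff Lp_translation_app shift)
  have u_norm: "vnorm ?X (u n) \<le> w powr (- (real n * (real n - 3) * a / 2)) * Lp_norm p ?M x" for n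
    unfolding u_def vnorm_ae_class[OF meas] v(2)[of n, symmetric]
    by (rule Lp_norm_bound[OF v(1) meas p]) (use bound in \<open>auto intro!: AE_I2\<close>)
  show "(\<lambda>n. C ^ n * vnorm ?X (u n)) \<longlonglongrightarrow> 0"
  proof (rule Lim_null_comparison)
    have "0 \<le> vnorm ?X (u n)" for n unfolding u_def vnorm_ae_class[OF meas] by (rule Lp_norm_nonneg)
    then show "\<forall>\<^sub>F n in sequentially. norm (C ^ n * vnorm ?X (u n))
        \<le> \<bar>C\<bar> ^ n * w powr (- (real n * (real n - 3) * a / 2)) * Lp_norm p ?M x"
      using u_norm by (intro always_eventually allI)
        (simp add: abs_mult power_abs mult.assoc mult_left_mono)
    show "(\<lambda>n. \<bar>C\<bar> ^ n * w powr (- (real n * (real n - 3) * a / 2)) * Lp_norm p ?M x) \<longlonglongrightarrow> 0"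
      by (intro tendsto_mult_left_zero power_times_gaussian_tendsto_0 w a)
  qed
qed

text \<open>A truncation has bounded support: every weight is bounded on it, and enough left
  translations push it off the half line. Unlike in the continuous case a sharp cutoff is
  allowed.\<close>

lemma cutoff_in_Lp_domain:
  fixes f :: "real \<Rightarrow> 'k::{real_normed_field,euclidean_space}"
  assumes f: "Lp_fun p (lebesgue_on {0<..}) f"
  defines "g \<equiv> \<lambda>N t. if t < real N then f t else 0"
  shows "ae_class (lebesgue_on {0<..}) (g N) \<in>
      maximal_dynamical_domain (Lp_space p (lebesgue_on {0<..})) (Lp_translation p w a)"
    and "\<exists>m. (op_app (Lp_translation p w a) ^^ m) (ae_class (lebesgue_on {0<..}) (g N)) =
      vzero (Lp_space p (lebesgue_on {0<..}))"
    and "Lp_fun p (lebesgue_on {0<..}) (g N)"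
    and "(\<lambda>N. Lp_norm p (lebesgue_on {0<..}) (\<lambda>t. f t - g N t)) \<longlonglongrightarrow> 0"
proof -
  let ?M = "lebesgue_on {0<..} :: real measure"
  have m: "f \<in> borel_measurable ?M" by (rule Lp_fun_measurable[OF f])
  have half: "{t \<in> space ?M. t < real N} \<in> sets ?M" for N
  proof -
    have "(\<lambda>t. t) \<in> borel_measurable ?M"
      by (intro measurable_restrict_space1 measurable_completion) measurable
    then show ?thesis by measurable
  qed
  have gm: "g N \<in> borel_measurable ?M" for N
    unfolding g_def using m half by (intro measurable_If) auto
  show g: "Lp_fun p ?M (g N)" for N
    by (rule Lp_fun_bound[OF f gm, where C = 1]) (use p in \<open>auto simp: g_def\<close>)
  have zero: "translation_power w a n (g N) t = 0" if "0 < t" "real N \<le> real n * a" for n t N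
    using that by (simp add: translation_power_def g_def)
  \<comment> \<open>Where the shifted truncation is nonzero, \<open>t < N\<close>; hence the weight
    is at most its value at \<open>t = N\<close>.\<close>
  have "Lp_fun p ?M (translation_power w a n (g N))" for n
  proof (rule Lp_fun_bound)
    show "Lp_fun p ?M (\<lambda>t. g N (t + real n * a))" using a g by (intro Lp_fun_shift_left) auto
    show "translation_power w a n (g N) \<in> borel_measurable ?M" by (intro translation_power_measurable gm)
    show "AE t in ?M. norm (translation_power w a n (g N) t)
        \<le> w powr (real n * real N + (real n - 1) * real n * a / 2) * norm (g N (t + real n * a))"
    proof (rule AE_I2)
      fix t
      show "norm (translation_power w a n (g N) t)
        \<le> w powr (real n * real N + (real n - 1) * real n * a / 2) * norm (g N (t + real n * a))"
      proof (cases "t < real N")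
        case True
        then have "real n * t \<le> real n * real N" by (intro mult_left_mono) auto
        then show ?thesis
          using w by (auto simp: translation_power_def intro!: mult_right_mono powr_mono)
      next
        case False
        then have "\<not> t + real n * a < real N" using a by (simp add: add_increasing2 not_less)
        then show ?thesis by (simp add: translation_power_def g_def)
      qed
    qed
  qed (use p in auto)
  then show "ae_class ?M (g N) \<in> maximal_dynamical_domain (Lp_space p ?M) (Lp_translation p w a)"
    using g by (simp add: maximal_dynamical_domain_Lp_iff[OF gm])
  obtain n :: nat where "real N / a \<le> real n" using real_arch_simple by blast
  then have "real N \<le> real n * a" using a by (simp add: field_simps)
  then have "(op_app (Lp_translation p w a) ^^ n) (ae_class ?M (g N)) = vzero (Lp_space p ?M)"
    unfolding Lp_translation_iterate[OF gm] vzero_Lp by (intro ae_class_eqI AE_I2) (simp add: zero)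
  then show "\<exists>n. (op_app (Lp_translation p w a) ^^ n) (ae_class ?M (g N)) = vzero (Lp_space p ?M)" ..
  have "(\<lambda>t. f t - g N t) = (\<lambda>t. if t < real N then 0 else f t)" for N by (auto simp: g_def)
  moreover have "(\<lambda>t. if t < real N then 0 else f t) \<in> borel_measurable ?M" for N
    using m half by (intro measurable_If) auto
  ultimately show "(\<lambda>N. Lp_norm p ?M (\<lambda>t. f t - g N t)) \<longlonglongrightarrow> 0"
    using Lp_norm_tail_tendsto_0[OF f p] by simp
qed

proposition Lp_translation_unbounded_hypermixing:
  fixes X :: "('k::{real_normed_field,euclidean_space}, (real \<Rightarrow> 'k) set) normed_sp"
  defines "X \<equiv> Lp_space p (lebesgue_on {0<..})"
  shows "unbounded_operator X (Lp_translation p w a) \<and>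
    hypermixing X (Lp_translation p w a) (maximal_dynamical_domain X (Lp_translation p w a))"
proof -
  let ?M = "lebesgue_on {0<..} :: real measure"
  interpret normed_sp_laws X unfolding X_def by (rule normed_sp_laws_Lp[OF p])
  define T :: "(real \<Rightarrow> 'k) set partial_op" where "T = Lp_translation p w a"
  have T: "linear_operator X T" unfolding X_def T_def by (rule linear_operator_Lp_translation)
  let ?Y = "maximal_dynamical_domain X T"
  have ex: "\<exists>f. Lp_fun p ?M f \<and> f \<in> borel_measurable ?M \<and> F = ae_class ?M f" if "F \<in> ?Y" for F
  proof -
    have "F \<in> carr X" using that maximal_dynamical_domain_iff[OF T] by simp
    then show ?thesis unfolding X_def by (auto simp: carr_Lp Lp_fun_measurable)
  qed
  have "unbounded_operator X T \<and> hypermixing X T ?Y"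
  proof (rule unbounded_hypermixing_criterion[OF T dynamical_domain_maximal[OF T]])
    \<comment> \<open>The indicator of \<open>(0,1)\<close>, written as its own truncation at
      \<open>N = 1\<close> so that the facts on truncations apply to it.\<close>
    define b where "b t = (if t < real 1 then (indicator {0<..<1} t :: 'k) else 0)" for t :: real
    have bi: "Lp_fun p ?M (indicator {0<..<1} :: real \<Rightarrow> 'k)"
    proof -
      have "norm (indicator {0<..<1} t :: 'k) powr p = indicator {0<..<1} t" for t :: real
        using p by (simp add: indicator_def)
      moreover have "integrable ?M (indicator {0<..<1::real} :: real \<Rightarrow> real)"
      proof -
        have "{0<..<1::real} \<inter> {0<..} = {0<..<1}" "{0<..<1::real} \<subseteq> {0<..}" by auto
        then show ?thesis
          by (simp add: integrable_indicator_iff emeasure_restrict_space sets_restrict_space_iff)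
      qed
      moreover have "(indicator {0<..<1} :: real \<Rightarrow> 'k) \<in> borel_measurable ?M"
        by (intro borel_measurable_indicator) (auto simp: sets_restrict_space_iff)
      ultimately show ?thesis by (simp add: Lp_fun_def)
    qed
    have "ae_class ?M b \<in> ?Y" unfolding X_def T_def b_def[abs_def] by (rule cutoff_in_Lp_domain(1)[OF bi])
    moreover have "ae_class ?M b \<noteq> vzero X"
    proof
      assume "ae_class ?M b = vzero X"
      moreover have "b \<in> borel_measurable ?M"
        unfolding b_def[abs_def] by (rule Lp_fun_measurable[OF cutoff_in_Lp_domain(3)[OF bi]])
      ultimately have "AE t in ?M. b t = 0" by (simp add: X_def vzero_Lp ae_class_eq_iff)
      then have "AE t in lebesgue. t \<notin> {0<..<1::real}"
        by (auto simp: AE_restrict_space_iff b_def indicator_def elim!: eventually_mono)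
      then have "emeasure lebesgue {0<..<1::real} = 0"
        by (subst (asm) AE_iff_measurable[OF _ refl]) (auto simp: greaterThanLessThan_eq greaterThan_def lessThan_def Int_def)
      then show False by simp
    qed
    ultimately show "?Y \<noteq> {vzero X}" by auto
  next
    fix F and e :: real assume "F \<in> ?Y" and e: "0 < e"
    then obtain f where f: "Lp_fun p ?M f" "f \<in> borel_measurable ?M" "F = ae_class ?M f"
      using ex by blast
    define g where "g N t = (if t < real N then f t else 0)" for N t
    note g = cutoff_in_Lp_domain[OF f(1), folded g_def]
    have "eventually (\<lambda>N. Lp_norm p ?M (\<lambda>t. f t - g N t) < e) sequentially"
      using order_tendstoD(2)[OF g(4) e] .
    then obtain N where N: "Lp_norm p ?M (\<lambda>t. f t - g N t) < e" by (auto simp: eventually_sequentially)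
    have "vdist X F (ae_class ?M (g N)) = Lp_norm p ?M (\<lambda>t. f t - g N t)"
      using f g(3)[of N] Lp_fun_measurable[OF g(3)[of N]] unfolding X_def vdist_def
      by (simp add: ae_class_in_Lp_iff vscale_ae_class vadd_ae_class vnorm_ae_class)
    then show "\<exists>d\<in>?Y. \<exists>m. vdist X F d < e \<and> (op_app T ^^ m) d = vzero X"
      using N g(1,2)[of N] unfolding X_def T_def
      by (intro bexI[of _ "ae_class ?M (g N)"]) auto
  next
    fix F assume F: "F \<in> ?Y"
    then obtain x where x: "Lp_fun p ?M x" "F = ae_class ?M x" using ex by blast
    note orbit = Lp_backward_orbit[OF x(1)]
    let ?u = "\<lambda>n. ae_class ?M (translation_inverse_power w a n (\<lambda>s. if 0 < s then x s else 0))"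
    have "?u n \<in> ?Y" for n
      by (rule backward_orbit_in_maximal_dynamical_domain[OF T]) (simp_all only: T_def orbit x(2)[symmetric] F[unfolded T_def])
    then show "\<exists>u. u 0 = F \<and> (\<forall>n. u n \<in> ?Y) \<and> (\<forall>n. op_app T (u (Suc n)) = u n) \<and>
        (\<forall>C. (\<lambda>n. C ^ n * vnorm X (u n)) \<longlonglongrightarrow> 0)"
      using orbit x(2) unfolding X_def T_def by (intro exI[of _ ?u]) blast
  qed
  then show ?thesis by (simp add: T_def)
qed

end

section \<open>The derivative on the Hardy space\<close>

lemma continuous_on_circle:
  assumes "continuous_on (ball 0 1) f" "0 \<le> r" "r < 1"
  shows "continuous_on S (\<lambda>\<theta>. f (rcis r \<theta>))"
proof (rule continuous_on_compose2[OF assms(1)])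
  show "continuous_on S (rcis r)"
    unfolding rcis_def[abs_def] by (intro continuous_intros continuous_on_cis)
qed (use assms(2,3) in auto)

text \<open>The root of a circle mean is a normalised \<open>L\<^sup>2\<close> norm on
  \<open>[0,2\<pi>]\<close>, so Minkowski's inequality becomes available on each circle. Continuity
  reconciles the gauge integral of \<open>circle_mean\<close> with the Lebesgue integral.\<close>

lemma
  assumes "continuous_on (ball 0 1) f" "0 \<le> r" "r < 1"
  shows L2_circle: "Lp_fun 2 (lebesgue_on {0..2*pi}) (\<lambda>\<theta>. f (rcis r \<theta>))"
    and sqrt_circle_mean: "sqrt (circle_mean f r) =
      Lp_norm 2 (lebesgue_on {0..2*pi}) (\<lambda>\<theta>. f (rcis r \<theta>)) / sqrt (2*pi)"
    and circle_integrable: "(\<lambda>\<theta>. (norm (f (rcis r \<theta>)))\<^sup>2) integrable_on {0..2*pi}"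
proof -
  note cont = continuous_on_circle[OF assms]
  have i: "integrable (lebesgue_on {0..2*pi}) (\<lambda>\<theta>. (norm (f (rcis r \<theta>)))\<^sup>2)"
    by (intro continuous_imp_integrable_real continuous_intros cont)
  have "(\<lambda>\<theta>. f (rcis r \<theta>)) \<in> borel_measurable (lebesgue_on {0..2*pi})"
    by (intro continuous_imp_measurable_on_sets_lebesgue cont) auto
  with i show "Lp_fun 2 (lebesgue_on {0..2*pi}) (\<lambda>\<theta>. f (rcis r \<theta>))"
    by (simp add: Lp_fun_def)
  have "(\<integral>\<theta>. (norm (f (rcis r \<theta>)))\<^sup>2 \<partial>lebesgue_on {0..2*pi}) = integral {0..2*pi} (\<lambda>\<theta>. (norm (f (rcis r \<theta>)))\<^sup>2)"
    by (rule lebesgue_integral_eq_integral[OF i]) auto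
  moreover have "0 \<le> (\<integral>\<theta>. (norm (f (rcis r \<theta>)))\<^sup>2 \<partial>lebesgue_on {0..2*pi})"
    by (intro Bochner_Integration.integral_nonneg) auto
  ultimately show "sqrt (circle_mean f r) = Lp_norm 2 (lebesgue_on {0..2*pi}) (\<lambda>\<theta>. f (rcis r \<theta>)) / sqrt (2*pi)"
    by (simp add: circle_mean_def Lp_norm_def real_sqrt_divide powr_half_sqrt)
  show "(\<lambda>\<theta>. (norm (f (rcis r \<theta>)))\<^sup>2) integrable_on {0..2*pi}"
    by (intro integrable_continuous_interval continuous_intros cont)
qed

text \<open>Includes the nonintegrable case, where the integral takes the default value 0.\<close>

lemma circle_mean_nonneg: "0 \<le> circle_mean f r"
proof -
  have "0 \<le> integral {0..2*pi} (\<lambda>\<theta>. (norm (f (rcis r \<theta>)))\<^sup>2)"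
    by (cases "(\<lambda>\<theta>. (norm (f (rcis r \<theta>)))\<^sup>2) integrable_on {0..2*pi}")
      (auto intro: Henstock_Kurzweil_Integration.integral_nonneg simp: not_integrable_integral)
  then show ?thesis by (simp add: circle_mean_def)
qed

lemma circle_mean_cong:
  assumes "\<And>z. z \<in> ball 0 1 \<Longrightarrow> norm (f z) = norm (g z)" "0 \<le> r" "r < 1"
  shows "circle_mean f r = circle_mean g r"
  unfolding circle_mean_def using assms by simp

lemma circle_mean_bounded:
  assumes "continuous_on (ball 0 1) f" "0 \<le> r" "r < 1" "\<And>z. z \<in> ball 0 1 \<Longrightarrow> norm (f z) \<le> B"
  shows "circle_mean f r \<le> B\<^sup>2"
proof -
  have "integral {0..2*pi} (\<lambda>\<theta>. (norm (f (rcis r \<theta>)))\<^sup>2) \<le> integral {0..2*pi} (\<lambda>\<theta>. B\<^sup>2)"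
    using assms by (intro integral_le circle_integrable power_mono) auto
  then show ?thesis by (simp add: circle_mean_def divide_simps mult.commute)
qed

lemma H2_carr_iff: "f \<in> carr H2 \<longleftrightarrow> f \<in> extensional (ball 0 1) \<and>
    f holomorphic_on ball 0 1 \<and> bdd_above (circle_mean f ` {0..<1})"
  by (simp add: H2_def)

lemma H2_ops:
  "vzero H2 = (\<lambda>z\<in>ball 0 1. 0)"
  "vadd H2 f g = (\<lambda>z\<in>ball 0 1. f z + g z)"
  "vscale H2 c f = (\<lambda>z\<in>ball 0 1. c * f z)"
  by (simp_all add: H2_def)

lemma H2_restrict: "f \<in> carr H2 \<Longrightarrow> restrict f (ball 0 1) = f"
  by (simp add: H2_carr_iff extensional_restrict)

lemma H2_continuous: "f \<in> carr H2 \<Longrightarrow> continuous_on (ball 0 1) f"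
  by (simp add: H2_carr_iff holomorphic_on_imp_continuous_on)

lemma H2_norm_ge:
  assumes "f \<in> carr H2" "0 \<le> r" "r < 1"
  shows "sqrt (circle_mean f r) \<le> vnorm H2 f"
  unfolding H2_def using assms cSUP_upper[of r "{0..<1}" "circle_mean f"] by (simp add: H2_carr_iff)

lemma H2_norm_nonneg: "f \<in> carr H2 \<Longrightarrow> 0 \<le> vnorm H2 f"
  using H2_norm_ge[of f 0] circle_mean_nonneg[of f 0] by (meson order_trans real_sqrt_ge_zero order_refl zero_less_one)

lemma H2_norm_le:
  assumes "\<And>r. 0 \<le> r \<Longrightarrow> r < 1 \<Longrightarrow> sqrt (circle_mean f r) \<le> B"
  shows "vnorm H2 f \<le> B"
proof -
  have "0 \<le> B"
    using assms[of 0] circle_mean_nonneg[of f 0] by (meson order_trans real_sqrt_ge_zero order_refl zero_less_one)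
  moreover have "(SUP r\<in>{0..<1}. circle_mean f r) \<le> B\<^sup>2"
    using assms by (intro cSUP_least) (auto simp: sqrt_le_D)
  ultimately show ?thesis unfolding H2_def by (simp add: real_le_lsqrt real_sqrt_le_iff)
qed

lemma restrict_in_H2:
  assumes "f holomorphic_on ball 0 1"
    and "\<And>r. 0 \<le> r \<Longrightarrow> r < 1 \<Longrightarrow> sqrt (circle_mean f r) \<le> B"
  shows "restrict f (ball 0 1) \<in> carr H2"
proof -
  have "circle_mean (restrict f (ball 0 1)) r \<le> B\<^sup>2" if "0 \<le> r" "r < 1" for r
    using assms(2)[OF that] circle_mean_cong[of "restrict f (ball 0 1)" f r] that by (simp add: sqrt_le_D)
  then have "bdd_above (circle_mean (restrict f (ball 0 1)) ` {0..<1})" by (intro bdd_aboveI2) auto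
  moreover have "restrict f (ball 0 1) holomorphic_on ball 0 1"
    using assms(1) by (rule holomorphic_transform) auto
  ultimately show ?thesis by (simp add: H2_carr_iff)
qed

text \<open>Every circle mean is an average of \<open>|f|^2\<close>, so the supremum on the disk
  dominates the Hardy norm. Power series enter the space this way.\<close>

lemma bounded_in_H2:
  assumes f: "f holomorphic_on ball 0 1" and B: "\<And>z. z \<in> ball 0 1 \<Longrightarrow> norm (f z) \<le> B"
  shows "restrict f (ball 0 1) \<in> carr H2" and "vnorm H2 (restrict f (ball 0 1)) \<le> B"
proof -
  have "0 \<le> B" using B[of 0] order_trans[OF norm_ge_zero] by simp
  then have le: "sqrt (circle_mean f r) \<le> B" if "0 \<le> r" "r < 1" for r
    using circle_mean_bounded[OF holomorphic_on_imp_continuous_on[OF f] that B] by (simp add: real_le_lsqrt)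
  then show "restrict f (ball 0 1) \<in> carr H2" by (rule restrict_in_H2[OF f])
  show "vnorm H2 (restrict f (ball 0 1)) \<le> B"
  proof (rule H2_norm_le)
    fix r :: real assume r: "0 \<le> r" "r < 1"
    have "circle_mean (restrict f (ball 0 1)) r = circle_mean f r" by (rule circle_mean_cong) (use r in auto)
    then show "sqrt (circle_mean (restrict f (ball 0 1)) r) \<le> B" using le[OF r] by simp
  qed
qed

lemma circle_mean_triangle:
  assumes "continuous_on (ball 0 1) f" "continuous_on (ball 0 1) g" "0 \<le> r" "r < 1"
  shows "sqrt (circle_mean (\<lambda>z. f z + g z) r) \<le> sqrt (circle_mean f r) + sqrt (circle_mean g r)"
proof -
  have "continuous_on (ball 0 1) (\<lambda>z. f z + g z)" using assms by (intro continuous_intros)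
  then show ?thesis
    using assms Minkowski_inequality[OF L2_circle[OF assms(1,3,4)] L2_circle[OF assms(2,3,4)]]
    by (simp add: sqrt_circle_mean divide_right_mono flip: add_divide_distrib)
qed

text \<open>A continuous nonnegative integrand with integral 0 vanishes, and \<open>z\<close> lies
  on the circle of radius \<open>norm z\<close> at the angle \<open>Arg2pi z\<close>.\<close>

lemma circle_mean_eq_0_imp:
  assumes f: "continuous_on (ball 0 1) f" and zero: "\<And>r. 0 \<le> r \<Longrightarrow> r < 1 \<Longrightarrow> circle_mean f r = 0"
    and z: "z \<in> ball 0 1"
  shows "f z = 0"
proof -
  have r: "0 \<le> norm z" "norm z < 1" using z by auto
  have "integral {0..2*pi} (\<lambda>\<theta>. (norm (f (rcis (norm z) \<theta>)))\<^sup>2) = 0"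
    using zero[OF r] by (simp add: circle_mean_def)
  then have "\<forall>\<theta>\<in>{0..2*pi}. (norm (f (rcis (norm z) \<theta>)))\<^sup>2 = 0"
    by (subst (asm) integral_eq_0_iff) (auto intro!: continuous_intros continuous_on_circle[OF f r])
  moreover have "Arg2pi z \<in> {0..2*pi}" using Arg2pi_ge_0[of z] Arg2pi_lt_2pi[of z] by simp
  moreover have "rcis (norm z) (Arg2pi z) = z"
    using Arg2pi_eq[of z] by (simp add: rcis_def cis_conv_exp)
  ultimately show ?thesis by force
qed

lemma normed_sp_laws_H2: "normed_sp_laws H2"
proof
  note [simp] = H2_ops
  show z: "vzero H2 \<in> carr H2" using bounded_in_H2(1)[of "\<lambda>_. 0" 0] by simp
  show "vnorm H2 (vzero H2) = 0"
    using bounded_in_H2(2)[of "\<lambda>_. 0" 0] H2_norm_nonneg[OF z] by simp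
next
  note [simp] = H2_ops
  fix x assume x: "x \<in> carr H2"
  note cx = H2_continuous[OF x]
  have hx: "x holomorphic_on ball 0 1" using x by (simp add: H2_carr_iff)
  have "vadd H2 (vzero H2) x = restrict x (ball 0 1)" "vscale H2 1 x = restrict x (ball 0 1)" by auto
  then show "vadd H2 (vzero H2) x = x" "vscale H2 1 x = x" unfolding H2_restrict[OF x] .
  show "vscale H2 0 x = vzero H2" by simp
  show "0 \<le> vnorm H2 x" by (rule H2_norm_nonneg[OF x])
  show "vscale H2 c x \<in> carr H2" for c
  proof -
    have "sqrt (circle_mean (\<lambda>z. c * x z) r) \<le> norm c * vnorm H2 x" if "0 \<le> r" "r < 1" for r
    proof -
      have "circle_mean (\<lambda>z. c * x z) r = (norm c)\<^sup>2 * circle_mean x r"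
        by (simp add: circle_mean_def norm_mult power_mult_distrib)
      then show ?thesis using H2_norm_ge[OF x that] by (simp add: real_sqrt_mult mult_left_mono)
    qed
    then show ?thesis using hx by (auto intro!: restrict_in_H2 holomorphic_intros)
  qed
  show "vscale H2 c (vscale H2 d x) = vscale H2 (c * d) x" for c d by (auto simp: mult.assoc)
  show "vscale H2 (c + d) x = vadd H2 (vscale H2 c x) (vscale H2 d x)" for c d
    by (auto simp: distrib_right)
  show "x = vzero H2" if "vnorm H2 x = 0"
  proof -
    have "circle_mean x r = 0" if "0 \<le> r" "r < 1" for r
      using H2_norm_ge[OF x that] circle_mean_nonneg[of x r] \<open>vnorm H2 x = 0\<close> by simp
    then have "restrict x (ball 0 1) = vzero H2" using circle_mean_eq_0_imp[OF cx] by (auto simp: fun_eq_iff)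
    then show ?thesis using H2_restrict[OF x] by simp
  qed
  show "vnorm H2 (vscale H2 (-1) x) = vnorm H2 x"
  proof -
    have "circle_mean (vscale H2 (-1) x) r = circle_mean x r" if "r \<in> {0..<1}" for r
      by (rule circle_mean_cong) (use that in auto)
    then show ?thesis by (simp add: H2_def)
  qed
  fix y assume y: "y \<in> carr H2"
  note cy = H2_continuous[OF y]
  have hy: "y holomorphic_on ball 0 1" using y by (simp add: H2_carr_iff)
  have tri: "sqrt (circle_mean (\<lambda>z. x z + y z) r) \<le> vnorm H2 x + vnorm H2 y" if "0 \<le> r" "r < 1" for r
    using circle_mean_triangle[OF cx cy that] H2_norm_ge[OF x that] H2_norm_ge[OF y that] by simp
  show "vadd H2 x y \<in> carr H2"
    using hx hy by (auto intro!: restrict_in_H2[OF _ tri] holomorphic_intros)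
  show "vnorm H2 (vadd H2 x y) \<le> vnorm H2 x + vnorm H2 y"
  proof (rule H2_norm_le)
    fix r :: real assume r: "0 \<le> r" "r < 1"
    have "circle_mean (vadd H2 x y) r = circle_mean (\<lambda>z. x z + y z) r"
      by (rule circle_mean_cong) (use r in auto)
    then show "sqrt (circle_mean (vadd H2 x y) r) \<le> vnorm H2 x + vnorm H2 y" using tri[OF r] by simp
  qed
  show "vadd H2 x y = vadd H2 y x" by (simp add: add.commute)
  show "vscale H2 c (vadd H2 x y) = vadd H2 (vscale H2 c x) (vscale H2 c y)" for c
    by (auto simp: distrib_left)
  fix z assume "z \<in> carr H2"
  show "vadd H2 (vadd H2 x y) z = vadd H2 x (vadd H2 y z)" by (auto simp: add.assoc)
qed

interpretation H2: normed_sp_laws H2 by (rule normed_sp_laws_H2)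

section \<open>The derivative as a partial operator\<close>

lemma H2_derivative_app: "op_app H2_derivative f = (\<lambda>z\<in>ball 0 1. deriv f z)"
  and H2_derivative_dom_iff: "f \<in> op_dom H2_derivative \<longleftrightarrow> f \<in> carr H2 \<and> op_app H2_derivative f \<in> carr H2"
  by (simp_all add: H2_derivative_def)

text \<open>The disk is open, so changing a function outside it does not affect derivatives inside;
  \<open>restrict\<close> can thus be dropped at every stage of an iteration.\<close>

lemma deriv_restrict_ball:
  assumes "z \<in> ball 0 1"
  shows "deriv (restrict f (ball 0 1)) z = deriv f z"
proof (rule deriv_cong_ev)
  show "\<forall>\<^sub>F w in nhds z. restrict f (ball 0 1) w = f w"
    by (rule eventually_mono[OF eventually_nhds_in_open[OF open_ball assms]]) simp
qed simp

lemma linear_operator_H2_derivative: "linear_operator H2 H2_derivative"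
proof -
  have diff: "f field_differentiable at z" if "f \<in> op_dom H2_derivative" "z \<in> ball 0 1" for f z
    using that by (auto simp: H2_derivative_dom_iff H2_carr_iff intro!: holomorphic_on_imp_differentiable_at[of _ "ball 0 1"])
  have add: "op_app H2_derivative (vadd H2 f g) = vadd H2 (op_app H2_derivative f) (op_app H2_derivative g)"
    if "f \<in> op_dom H2_derivative" "g \<in> op_dom H2_derivative" for f g
    using diff[OF that(1)] diff[OF that(2)]
    by (auto simp: H2_derivative_app H2_ops deriv_restrict_ball intro!: restrict_ext)
  have scale: "op_app H2_derivative (vscale H2 c f) = vscale H2 c (op_app H2_derivative f)"
    if "f \<in> op_dom H2_derivative" for c f
    using diff[OF that]
    by (auto simp: H2_derivative_app H2_ops deriv_restrict_ball deriv_cmult intro!: restrict_ext)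
  have zero: "op_app H2_derivative (vzero H2) = vzero H2"
    by (auto simp: H2_derivative_app H2_ops deriv_restrict_ball intro!: restrict_ext)
  show ?thesis
    unfolding linear_operator_def linear_subspace_def
    using add scale zero H2.zero_mem H2.add_mem H2.scale_mem
    by (auto simp: H2_derivative_dom_iff)
qed

lemma H2_derivative_iterate:
  assumes "f \<in> extensional (ball 0 1)"
  shows "(op_app H2_derivative ^^ n) f = (\<lambda>z\<in>ball 0 1. (deriv ^^ n) f z)"
proof (induction n)
  case (Suc n)
  have "(op_app H2_derivative ^^ Suc n) f = (\<lambda>z\<in>ball 0 1. deriv (\<lambda>z\<in>ball 0 1. (deriv ^^ n) f z) z)"
    by (simp only: funpow.simps comp_apply Suc H2_derivative_app)
  also have "\<dots> = (\<lambda>z\<in>ball 0 1. deriv ((deriv ^^ n) f) z)"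
    by (rule restrict_ext) (rule deriv_restrict_ball)
  finally show ?case by simp
qed (use assms in \<open>simp add: extensional_restrict\<close>)

text \<open>The domain asks both \<open>f\<close> and \<open>f'\<close> to lie in the space, so the
  conditions on consecutive iterates overlap.\<close>

lemma maximal_dynamical_domain_H2_iff:
  "f \<in> maximal_dynamical_domain H2 H2_derivative \<longleftrightarrow> (\<forall>n. (op_app H2_derivative ^^ n) f \<in> carr H2)"
  unfolding H2.maximal_dynamical_domain_iff[OF linear_operator_H2_derivative] H2_derivative_dom_iff
  by (metis funpow_0 funpow.simps(2) comp_apply)

lemma maximal_dynamical_domain_H2:
  "maximal_dynamical_domain H2 H2_derivative =
     {f \<in> carr H2. \<forall>n\<ge>1. (\<lambda>z\<in>ball 0 1. (deriv ^^ n) f z) \<in> carr H2}"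
proof (intro set_eqI)
  fix f
  let ?T = "op_app H2_derivative"
  have "(\<forall>n. (?T ^^ n) f \<in> carr H2) \<longleftrightarrow> f \<in> carr H2 \<and> (\<forall>n\<ge>1. (?T ^^ n) f \<in> carr H2)"
    by (metis One_nat_def Suc_leI funpow_0 not_gr_zero)
  moreover have "(?T ^^ n) f = (\<lambda>z\<in>ball 0 1. (deriv ^^ n) f z)" if "f \<in> carr H2" for n
    using that H2_derivative_iterate unfolding H2_carr_iff by blast
  ultimately show "f \<in> maximal_dynamical_domain H2 H2_derivative \<longleftrightarrow>
      f \<in> {f \<in> carr H2. \<forall>n\<ge>1. (\<lambda>z\<in>ball 0 1. (deriv ^^ n) f z) \<in> carr H2}"
    unfolding maximal_dynamical_domain_H2_iff mem_Collect_eq by metis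
qed

text \<open>
  The crude bound \<open>|f| \<le> 1 + |f|\<^sup>2\<close> in the Cauchy integral replaces the Cauchy-Schwarz inequality,
  as only boundedness of the Taylor coefficients matters.
\<close>

lemma H2_coefficients_bounded:
  assumes f: "f \<in> carr H2"
  shows "norm ((deriv ^^ n) f 0 / fact n) \<le> 1 + (vnorm H2 f)\<^sup>2"
proof -
  define a where "a = (deriv ^^ n) f 0 / fact n"
  have hol: "f holomorphic_on ball 0 1" using f by (simp add: H2_carr_iff)
  have le: "norm a * r ^ n \<le> 1 + (vnorm H2 f)\<^sup>2" if r: "0 < r" "r < 1" for r
  proof -
    \<comment> \<open>The integrand of Cauchy's formula for the \<open>n\<close>-th derivative at 0,
      pulled back to the angle.\<close>
    define k where "k \<theta> = f (0 + of_real r * cis \<theta>) / (0 + of_real r * cis \<theta> - 0) ^ Suc n * of_real r * \<i> * cis \<theta>" for \<theta>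
    have "((\<lambda>u. f u / (u - 0) ^ Suc n) has_contour_integral (2 * pi * \<i> / fact n * (deriv ^^ n) f 0)) (circlepath 0 r)"
      using r hol by (intro Cauchy_has_contour_integral_higher_derivative_circlepath)
        (auto intro!: holomorphic_on_imp_continuous_on elim!: holomorphic_on_subset)
    then have I: "(k has_integral (2 * pi * \<i> * a)) {0..2*pi}"
      unfolding circlepath_def k_def a_def by (subst (asm) has_contour_integral_part_circlepath_iff) auto
    have k: "norm (k \<theta>) \<le> (1 + (norm (f (rcis r \<theta>)))\<^sup>2) / r ^ n" for \<theta>
    proof -
      have "norm (k \<theta>) = norm (f (rcis r \<theta>)) / r ^ n"
        using r by (simp add: k_def rcis_def norm_mult norm_divide norm_power)
      \<comment> \<open>With \<open>s\<close> the norm, \<open>(s - 1/2)^2 \<ge> 0\<close> gives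
        \<open>s \<le> s^2 + 1/4\<close>.\<close>
      moreover have "norm (f (rcis r \<theta>)) \<le> 1 + (norm (f (rcis r \<theta>)))\<^sup>2"
        using zero_le_power2[of "norm (f (rcis r \<theta>)) - 1/2"] by (simp add: power2_eq_square algebra_simps)
      ultimately show ?thesis using r by (simp add: divide_right_mono)
    qed
    have cont: "continuous_on (ball 0 1) f" by (rule H2_continuous[OF f])
    have i: "(\<lambda>\<theta>. (norm (f (rcis r \<theta>)))\<^sup>2) integrable_on {0..2*pi}"
      using r by (intro circle_integrable cont) auto
    have "norm (integral {0..2*pi} k) \<le> integral {0..2*pi} (\<lambda>\<theta>. (1 + (norm (f (rcis r \<theta>)))\<^sup>2) / r ^ n)"
      using I i k by (intro integral_norm_bound_integral integrable_on_divide integrable_add integrable_const_ivl) auto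
    also have "\<dots> = (2 * pi + 2 * pi * circle_mean f r) / r ^ n"
      using i by (simp add: integral_add integrable_const_ivl circle_mean_def)
    also have "integral {0..2*pi} k = 2 * pi * \<i> * a" using I by (rule integral_unique)
    finally have "2 * pi * (norm a * r ^ n) \<le> 2 * pi * (1 + circle_mean f r)"
      using r by (simp add: norm_mult field_simps)
    then have "norm a * r ^ n \<le> 1 + circle_mean f r" by (simp only: mult_le_cancel_left) simp
    also have "circle_mean f r \<le> (vnorm H2 f)\<^sup>2"
      using H2_norm_ge[OF f, of r] r by (auto intro: sqrt_le_D)
    finally show ?thesis by simp
  qed
  \<comment> \<open>Letting the radius tend to 1 removes the factor \<open>r ^ n\<close>; the shift
    by 2 keeps the radii strictly between 0 and 1.\<close>
  have "(\<lambda>k. norm a * (1 - 1 / (real k + 2)) ^ n) \<longlonglongrightarrow> norm a * (1 - 0) ^ n"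
    by (intro tendsto_intros) real_asymp
  then have "norm a * (1 - 0) ^ n \<le> 1 + (vnorm H2 f)\<^sup>2"
    by (rule LIMSEQ_le_const2) (auto intro!: le)
  then show ?thesis by (simp add: a_def)
qed

section \<open>Power series with absolutely summable coefficients\<close>

definition disk_series :: "(nat \<Rightarrow> complex) \<Rightarrow> complex \<Rightarrow> complex" where
  "disk_series c = (\<lambda>z\<in>ball 0 1. \<Sum>n. c n * z ^ n)"

lemma
  fixes z :: complex
  assumes c: "summable (\<lambda>n. norm (c n))" and z: "norm z \<le> 1"
  shows disk_series_summable: "summable (\<lambda>n. c n * z ^ n)"
    and disk_series_norm_le: "norm (\<Sum>n. c n * z ^ n) \<le> (\<Sum>n. norm (c n))"
proof -
  have le: "norm (c n * z ^ n) \<le> norm (c n)" for n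
    using z by (simp add: norm_mult norm_power mult_left_le power_le_one)
  then have "summable (\<lambda>n. norm (c n * z ^ n))"
    by (intro summable_comparison_test'[OF c, of 0]) simp
  then show "summable (\<lambda>n. c n * z ^ n)" by (rule summable_norm_cancel)
  show "norm (\<Sum>n. c n * z ^ n) \<le> (\<Sum>n. norm (c n))"
    using \<open>summable (\<lambda>n. norm (c n * z ^ n))\<close> c le
    by (intro order_trans[OF summable_norm suminf_le]) auto
qed

lemma disk_series_derivative:
  fixes z :: complex
  assumes "summable (\<lambda>n. norm (c n))" "z \<in> ball 0 1"
  shows "((\<lambda>z. \<Sum>n. c n * z ^ n) has_field_derivative (\<Sum>n. diffs c n * z ^ n)) (at z)"
  using assms by (intro termdiffs_strong'[where K = 1] disk_series_summable) auto

text \<open>The Hardy norm is estimated through the supremum on the disk. The coefficients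
  \<open>diffs c\<close> need not be summable in modulus; their series represents the derivative on
  the open disk in any case.\<close>

lemma
  assumes c: "summable (\<lambda>n. norm (c n))"
  shows disk_series_in_H2: "disk_series c \<in> carr H2"
    and disk_series_H2_norm_le: "vnorm H2 (disk_series c) \<le> (\<Sum>n. norm (c n))"
    and H2_derivative_disk_series: "op_app H2_derivative (disk_series c) = disk_series (diffs c)"
proof -
  have hol: "(\<lambda>z. \<Sum>n. c n * z ^ n) holomorphic_on ball 0 1"
    unfolding holomorphic_on_open[OF open_ball] using disk_series_derivative[OF c] by blast
  have le: "norm (\<Sum>n. c n * z ^ n) \<le> (\<Sum>n. norm (c n))" if "z \<in> ball 0 1" for z
    using that by (intro disk_series_norm_le[OF c]) simp
  show "disk_series c \<in> carr H2" "vnorm H2 (disk_series c) \<le> (\<Sum>n. norm (c n))"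
    unfolding disk_series_def using bounded_in_H2[OF hol le] by blast+
  show "op_app H2_derivative (disk_series c) = disk_series (diffs c)"
    unfolding H2_derivative_app disk_series_def
    by (rule restrict_ext) (simp only: deriv_restrict_ball DERIV_imp_deriv[OF disk_series_derivative[OF c]])
qed

text \<open>The Taylor coefficients of \<open>f''\<close> are bounded, and those of \<open>f\<close>
  arise from them by division by \<open>(n + 1) (n + 2)\<close>, hence are of order
  \<open>1 / n^2\<close>.\<close>

lemma smooth_H2_eq_disk_series:
  assumes f: "f \<in> maximal_dynamical_domain H2 H2_derivative"
  obtains a where "f = disk_series a" "summable (\<lambda>n. norm (a n))"
proof -
  define a where "a n = (deriv ^^ n) f 0 / fact n" for n
  \<comment> \<open>Two derivatives are taken because bounded coefficients of \<open>f'\<close>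
    would yield only the order \<open>1 / n\<close>, which is not summable.\<close>
  define g where "g = (op_app H2_derivative ^^ 2) f"
  have mem: "(op_app H2_derivative ^^ n) f \<in> carr H2" for n
    using f by (simp add: maximal_dynamical_domain_H2_iff)
  have f_carr: "f \<in> carr H2" and g: "g \<in> carr H2" using mem[of 0] mem[of 2] by (simp_all add: g_def)
  have ext: "h \<in> extensional (ball 0 1)" if "h \<in> carr H2" for h using that by (simp add: H2_carr_iff)
  have "(deriv ^^ n) g 0 = (deriv ^^ (n + 2)) f 0" for n
  proof -
    have "(op_app H2_derivative ^^ n) g = (op_app H2_derivative ^^ (n + 2)) f"
      by (simp only: g_def funpow_add comp_apply)
    then have "(\<lambda>z\<in>ball 0 1. (deriv ^^ n) g z) 0 = (\<lambda>z\<in>ball 0 1. (deriv ^^ (n + 2)) f z) 0"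
      unfolding H2_derivative_iterate[OF ext[OF g]] H2_derivative_iterate[OF ext[OF f_carr]] by metis
    then show ?thesis by simp
  qed
  then have a_eq: "a (n + 2) = (deriv ^^ n) g 0 / fact n * (1 / ((of_nat n + 1) * (of_nat n + 2)))" for n
    by (simp add: a_def field_simps)
  have le: "norm (a (n + 2)) \<le> (1 + (vnorm H2 g)\<^sup>2) * inverse ((real (Suc n))\<^sup>2)" for n
  proof -
    have "norm ((of_nat n + 1) * (of_nat n + 2) :: complex) = (real n + 1) * (real n + 2)"
    proof -
      have "(of_nat n + 1) * (of_nat n + 2) = (of_nat ((n + 1) * (n + 2)) :: complex)"
        by (simp add: algebra_simps)
      then show ?thesis by (simp only: norm_of_nat) (simp add: algebra_simps)
    qed
    then have "norm (a (n + 2)) = norm ((deriv ^^ n) g 0 / fact n) * (1 / ((real n + 1) * (real n + 2)))"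
      by (simp only: a_eq norm_mult norm_divide norm_one)
    also have "\<dots> \<le> (1 + (vnorm H2 g)\<^sup>2) * (1 / ((real n + 1) * (real n + 1)))"
      by (intro mult_mono H2_coefficients_bounded[OF g] divide_left_mono) auto
    finally show ?thesis by (simp add: power2_eq_square field_simps)
  qed
  have "summable (\<lambda>n. (1 + (vnorm H2 g)\<^sup>2) * inverse ((real (Suc n))\<^sup>2))"
    by (intro summable_mult) (subst summable_Suc_iff, rule inverse_power_summable, simp)
  then have "summable (\<lambda>n. norm (a (n + 2)))"
    by (rule summable_comparison_test'[where N = 0]) (simp only: real_norm_def abs_norm_cancel le)
  then have sm: "summable (\<lambda>n. norm (a n))" by (subst (asm) summable_iff_shift)
  have "f z = (\<Sum>n. a n * z ^ n)" if "z \<in> ball 0 1" for z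
    using holomorphic_power_series[of f 0 1 z] f_carr that by (simp add: H2_carr_iff a_def sums_unique)
  then have "restrict f (ball 0 1) = disk_series a" unfolding disk_series_def by (intro restrict_ext) auto
  then show thesis using that sm H2_restrict[OF f_carr] by simp
qed

text \<open>Each \<open>diffs\<close> shifts the support down by one. Finite support also keeps all
  iterated sequences summable, so the rule for the derivative can be applied repeatedly.\<close>

lemma finite_disk_series:
  assumes "\<And>k. k \<ge> N \<Longrightarrow> c k = 0"
  shows "disk_series c \<in> maximal_dynamical_domain H2 H2_derivative"
    and "(op_app H2_derivative ^^ N) (disk_series c) = vzero H2"
proof -
  have supp: "(diffs ^^ n) c k = 0" if "k + n \<ge> N" for n k
    using that by (induction n arbitrary: k) (auto simp: assms diffs_def)
  have sm: "summable (\<lambda>k. norm ((diffs ^^ n) c k))" for n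
    by (rule summable_finite[of "{..<N}"]) (auto simp: supp)
  have iterate: "(op_app H2_derivative ^^ n) (disk_series c) = disk_series ((diffs ^^ n) c)" for n
    by (induction n) (simp_all add: H2_derivative_disk_series[OF sm])
  show "disk_series c \<in> maximal_dynamical_domain H2 H2_derivative"
    unfolding maximal_dynamical_domain_H2_iff iterate by (intro allI disk_series_in_H2 sm)
  show "(op_app H2_derivative ^^ N) (disk_series c) = vzero H2"
    unfolding iterate by (simp add: disk_series_def supp H2_ops)
qed

text \<open>The coefficients of the \<open>n\<close>-fold integral from 0, which sends
  \<open>z^m\<close> to \<open>m! / (m + n)! z^(m+n)\<close>.\<close>

definition integrated_coeffs :: "(nat \<Rightarrow> complex) \<Rightarrow> nat \<Rightarrow> nat \<Rightarrow> complex" where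
  "integrated_coeffs a n k = (if k < n then 0 else a (k - n) * (fact (k - n) / fact k))"

lemma integrated_coeffs_0: "integrated_coeffs a 0 = a"
  by (auto simp: integrated_coeffs_def)

lemma diffs_integrated_coeffs: "diffs (integrated_coeffs a (Suc n)) = integrated_coeffs a n"
  by (auto simp: integrated_coeffs_def diffs_def simp del: of_nat_Suc)

text \<open>Since \<open>k! n!\<close> divides \<open>(k + n)!\<close>, the factor
  \<open>k! / (k + n)!\<close> is at most \<open>1 / n!\<close>, uniformly in
  \<open>k\<close>.\<close>

lemma
  assumes a: "summable (\<lambda>n. norm (a n))"
  shows integrated_coeffs_summable: "summable (\<lambda>k. norm (integrated_coeffs a n k))"
    and integrated_coeffs_sum_le: "(\<Sum>k. norm (integrated_coeffs a n k)) \<le> (\<Sum>k. norm (a k)) / fact n"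
proof -
  have le: "norm (integrated_coeffs a n (k + n)) \<le> norm (a k) / fact n" for k
  proof -
    have "fact k * fact n \<le> (fact (k + n) :: nat)" by (intro dvd_imp_le fact_fact_dvd_fact) auto
    then have "real (fact k * fact n) \<le> real (fact (k + n))" by (rule of_nat_mono)
    then have "(fact k / fact (k + n) :: real) \<le> 1 / fact n" by (simp add: field_simps)
    then have "norm (a k) * (fact k / fact (k + n)) \<le> norm (a k) * (1 / fact n)" by (rule mult_left_mono) simp
    then show ?thesis by (simp add: integrated_coeffs_def norm_mult norm_divide)
  qed
  have bound: "summable (\<lambda>k. norm (a k) / fact n)" by (rule summable_divide[OF a])
  have shifted: "summable (\<lambda>k. norm (integrated_coeffs a n (k + n)))"
    by (rule summable_comparison_test'[OF bound, of 0]) (use le in simp)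
  then show sm: "summable (\<lambda>k. norm (integrated_coeffs a n k))" by (subst (asm) summable_iff_shift)
  have "(\<Sum>k. norm (integrated_coeffs a n k)) = (\<Sum>k. norm (integrated_coeffs a n (k + n)))"
    by (subst suminf_split_initial_segment[OF sm, of n]) (simp add: integrated_coeffs_def)
  also have "\<dots> \<le> (\<Sum>k. norm (a k) / fact n)" by (rule suminf_le[OF le shifted bound])
  also have "\<dots> = (\<Sum>k. norm (a k)) / fact n" by (rule suminf_divide[OF a])
  finally show "(\<Sum>k. norm (integrated_coeffs a n k)) \<le> (\<Sum>k. norm (a k)) / fact n" .
qed

proposition H2_derivative_unbounded_hypermixing:
  "unbounded_operator H2 H2_derivative \<and>
   hypermixing H2 H2_derivative (maximal_dynamical_domain H2 H2_derivative)"
proof -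
  note T = linear_operator_H2_derivative
  let ?Y = "maximal_dynamical_domain H2 H2_derivative"
  show ?thesis
  proof (rule H2.unbounded_hypermixing_criterion[OF T H2.dynamical_domain_maximal[OF T]])
    let ?c = "\<lambda>n::nat. if n = 0 then 1 else 0 :: complex"
    have "disk_series ?c 0 = 1" by (simp add: disk_series_def powser_zero)
    then have "disk_series ?c \<noteq> vzero H2" by (auto simp: H2_ops)
    moreover have "disk_series ?c \<in> ?Y" by (rule finite_disk_series[where N = 1]) auto
    ultimately show "?Y \<noteq> {vzero H2}" by auto
  next
    fix f and e :: real assume f: "f \<in> ?Y" and e: "0 < e"
    obtain a where a: "f = disk_series a" "summable (\<lambda>n. norm (a n))" by (rule smooth_H2_eq_disk_series[OF f])
    \<comment> \<open>The tail of the coefficient sum dominates the Hardy distance from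
      \<open>f\<close> to its Taylor polynomial of degree below \<open>N\<close>.\<close>
    obtain N where N: "norm (\<Sum>k. norm (a (k + N))) < e"
      using suminf_exist_split[OF e a(2)] by blast
    define d where "d k = (if k < N then a k else 0)" for k
    have d: "disk_series d \<in> ?Y" "(op_app H2_derivative ^^ N) (disk_series d) = vzero H2"
      by (rule finite_disk_series[where N = N]; simp add: d_def)+
    have d_sm: "summable (\<lambda>k. norm (d k))" by (rule summable_finite[of "{..<N}"]) (auto simp: d_def)
    have sm: "summable (\<lambda>k. norm (a k - d k))"
      by (rule summable_comparison_test'[OF a(2), of 0]) (auto simp: d_def)
    have "vadd H2 (disk_series a) (vscale H2 (-1) (disk_series d)) = disk_series (\<lambda>k. a k - d k)"
      unfolding H2_ops disk_series_def
      using suminf_diff[OF disk_series_summable[OF a(2)] disk_series_summable[OF d_sm]]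
      by (intro restrict_ext) (simp add: left_diff_distrib)
    then have "vdist H2 f (disk_series d) \<le> (\<Sum>k. norm (a k - d k))"
      using disk_series_H2_norm_le[OF sm] disk_series_in_H2[OF a(2)] disk_series_in_H2[OF d_sm]
      by (simp add: H2.vdist_eq a(1))
    also have "\<dots> = (\<Sum>k. norm (a (k + N)))"
      by (subst suminf_split_initial_segment[OF sm, of N]) (simp add: d_def)
    also have "\<dots> < e" using N by simp
    finally show "\<exists>d\<in>?Y. \<exists>m. vdist H2 f d < e \<and> (op_app H2_derivative ^^ m) d = vzero H2"
      using d by blast
  next
    fix x assume x: "x \<in> ?Y"
    obtain a where a: "x = disk_series a" "summable (\<lambda>n. norm (a n))" by (rule smooth_H2_eq_disk_series[OF x])
    define u where "u n = disk_series (integrated_coeffs a n)" for n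
    note sm = integrated_coeffs_summable[OF a(2)]
    have u0: "u 0 = x" by (simp add: u_def integrated_coeffs_0 a(1))
    have carr: "u n \<in> carr H2" for n unfolding u_def by (rule disk_series_in_H2[OF sm])
    have app: "op_app H2_derivative (u (Suc n)) = u n" for n
      unfolding u_def H2_derivative_disk_series[OF sm] diffs_integrated_coeffs ..
    have "u n \<in> ?Y" for n
      by (rule H2.backward_orbit_in_maximal_dynamical_domain[OF T])
        (simp_all add: u0 x app H2_derivative_dom_iff carr)
    moreover have "(\<lambda>n. C ^ n * vnorm H2 (u n)) \<longlonglongrightarrow> 0" for C
    proof (rule Lim_null_comparison)
      have norm_le: "vnorm H2 (u n) \<le> (\<Sum>k. norm (a k)) / fact n" for n
        unfolding u_def by (rule order_trans[OF disk_series_H2_norm_le[OF sm] integrated_coeffs_sum_le[OF a(2)]])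
      have "\<bar>C\<bar> ^ n * vnorm H2 (u n) \<le> (\<Sum>k. norm (a k)) * (inverse (fact n) * \<bar>C\<bar> ^ n)" for n
        using mult_left_mono[OF norm_le[of n], of "\<bar>C\<bar> ^ n"] by (simp add: field_simps)
      then show "\<forall>\<^sub>F n in sequentially. norm (C ^ n * vnorm H2 (u n)) \<le> (\<Sum>k. norm (a k)) * (inverse (fact n) * \<bar>C\<bar> ^ n)"
        using H2_norm_nonneg[OF carr] by (intro always_eventually allI) (simp add: abs_mult power_abs)
      \<comment> \<open>Up to a constant these are the terms of the exponential series at
        \<open>\<bar>C\<bar>\<close>.\<close>
      show "(\<lambda>n. (\<Sum>k. norm (a k)) * (inverse (fact n) * \<bar>C\<bar> ^ n)) \<longlonglongrightarrow> 0"
        by (intro tendsto_mult_right_zero summable_LIMSEQ_zero summable_exp)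
    qed
    ultimately show "\<exists>u. u 0 = x \<and> (\<forall>n. u n \<in> ?Y) \<and> (\<forall>n. op_app H2_derivative (u (Suc n)) = u n) \<and>
        (\<forall>C. (\<lambda>n. C ^ n * vnorm H2 (u n)) \<longlonglongrightarrow> 0)"
      using u0 app by blast
  qed
qed

text \<open>The explicit descriptions of the domains accompany hypermixing because the domains of
  powers are defined by recursion. The scalar type \<open>'k\<close> covers the real and the complex
  translations at once.\<close>

theorem theorem3p1:
  shows
   "(unbounded_operator H2 H2_derivative \<and>
     hypermixing H2 H2_derivative (maximal_dynamical_domain H2 H2_derivative) \<and>
     maximal_dynamical_domain H2 H2_derivative =
       {f \<in> carr H2. \<forall>n\<ge>1. (\<lambda>z\<in>ball 0 1. (deriv ^^ n) f z) \<in> carr H2})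
    \<and>
    (\<forall>\<Omega> \<Delta>. open \<Omega> \<and> bounded \<Omega> \<and> \<Omega> \<noteq> {} \<and> is_L2_Laplacian \<Omega> \<Delta> \<longrightarrow>
       unbounded_operator (Lp_space 2 (lebesgue_on \<Omega>)) \<Delta> \<and>
       hypermixing (Lp_space 2 (lebesgue_on \<Omega>)) \<Delta> (L2_polynomials \<Omega>))
    \<and>
    (\<forall>p w a :: real. 1 \<le> p \<and> 1 < w \<and> 0 < a \<longrightarrow>
       (let X = Lp_space p (lebesgue_on {0<..}) ::
                  ('k::{real_normed_field,euclidean_space}, (real \<Rightarrow> 'k) set) normed_sp;
            T = Lp_translation p w a
        in unbounded_operator X T \<and>
           hypermixing X T (maximal_dynamical_domain X T) \<and>
           (\<forall>n\<ge>1. power_dom X T n =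
              {F \<in> carr X. integrable (lebesgue_on {0<..})
                 (\<lambda>t. norm ((w powr (real n * t + (real n - 1) * real n * a / 2))
                              *\<^sub>R rep F (t + real n * a)) powr p)})))
    \<and>
    (\<forall>w a :: real. 1 < w \<and> 0 < a \<longrightarrow>
       (let X = C0_space :: ('k, real \<Rightarrow> 'k) normed_sp;
            T = C0_translation w a
        in unbounded_operator X T \<and>
           hypermixing X T (maximal_dynamical_domain X T) \<and>
           (\<forall>n\<ge>1. power_dom X T n =
              {f \<in> carr X.
                 ((\<lambda>t. (w powr (real n * t + (real n - 1) * real n * a / 2))
                         *\<^sub>R f (t + real n * a)) \<longlongrightarrow> 0) at_top})))"
proof (intro conjI allI impI)
  show "unbounded_operator H2 H2_derivative"
    "hypermixing H2 H2_derivative (maximal_dynamical_domain H2 H2_derivative)"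
    using H2_derivative_unbounded_hypermixing by blast+
next
  show "maximal_dynamical_domain H2 H2_derivative =
      {f \<in> carr H2. \<forall>n\<ge>1. (\<lambda>z\<in>ball 0 1. (deriv ^^ n) f z) \<in> carr H2}"
    by (rule maximal_dynamical_domain_H2)
next
  fix \<Omega> \<Delta>
  assume "open \<Omega> \<and> bounded \<Omega> \<and> \<Omega> \<noteq> {} \<and> is_L2_Laplacian \<Omega> \<Delta>"
  then show "unbounded_operator (Lp_space 2 (lebesgue_on \<Omega>)) \<Delta>"
    "hypermixing (Lp_space 2 (lebesgue_on \<Omega>)) \<Delta> (L2_polynomials \<Omega>)"
    using laplacian_unbounded_hypermixing by blast+
next
  fix p w a :: real
  assume "1 \<le> p \<and> 1 < w \<and> 0 < a"
  then have *: "1 \<le> p" "1 < w" "0 < a" by blast+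
  show "let X = Lp_space p (lebesgue_on {0<..}) :: ('k, (real \<Rightarrow> 'k) set) normed_sp;
      T = Lp_translation p w a
    in unbounded_operator X T \<and> hypermixing X T (maximal_dynamical_domain X T) \<and>
      (\<forall>n\<ge>1. power_dom X T n =
        {F \<in> carr X. integrable (lebesgue_on {0<..})
          (\<lambda>t. norm ((w powr (real n * t + (real n - 1) * real n * a / 2))
             *\<^sub>R rep F (t + real n * a)) powr p)})"
    unfolding Let_def
    using Lp_translation_unbounded_hypermixing[OF *, where 'k = 'k]
      power_dom_Lp_translation[OF *, where 'k = 'k, unfolded translation_power_def] by blast
next
  fix w a :: real
  assume "1 < w \<and> 0 < a"
  then have *: "1 < w" "0 < a" by blast+
  show "let X = C0_space :: ('k, real \<Rightarrow> 'k) normed_sp; T = C0_translation w a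
    in unbounded_operator X T \<and> hypermixing X T (maximal_dynamical_domain X T) \<and>
      (\<forall>n\<ge>1. power_dom X T n =
        {f \<in> carr X. ((\<lambda>t. (w powr (real n * t + (real n - 1) * real n * a / 2))
           *\<^sub>R f (t + real n * a)) \<longlongrightarrow> 0) at_top})"
    unfolding Let_def
    using C0_translation_unbounded_hypermixing[OF *, where 'k = 'k]
      power_dom_C0_translation[OF *, where 'k = 'k, unfolded translation_power_def[abs_def]] by blast
qed

end
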